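(* There is a universal $k\in\mathbb N$ such that for every flat Riemannian metric $g_0$ on $T^2$ there is $\varepsilon>0$ for which the following holds for every $C^\infty$-generic Finsler metric $g$ on $T^2$ with $\|g-g_0\|_{C^k}<\varepsilon$ (that is, for all $g$ in a $C^\infty$-residual subset of the set of such Finsler metrics). Fix a prime $p$ and a nontrivial free homotopy class $\beta$ of loops in $T^2$. Suppose there is a string $o$ such that: (1) $o$ is a $g$-geodesic string; (2) $o$ has class $\beta$; (3) $p\mid\operatorname{mult}(o)$. Then there is another string (distinct from $o$) satisfying conditions (1)--(3).
   Context: A Finsler metric $g$ is given by a function $F_g$ on the tangent bundle, smooth off the zero section, positively $1$-homogeneous and fiberwise strongly convex (not assumed reversible). $\|g-g_0\|_{C^k}$ denotes the $C^k$-distance of $F_g^2$ to $F_{g_0}^2$ on $\{\tfrac12\le F_{g_0}\le 2\}\subset TT^2$. The genericity used in the paper is that of metrics $g$ which are $\beta$-regular for all $\beta$, i.e. all of whose closed noncontractible geodesics (including multiply covered ones) are nondegenerate; by the bumpy metric theorem (Abraham, Anosov; Rademacher--Taimanov in the Finsler case) this property is $C^\infty$-generic. $S^1=\mathbb R/\mathbb Z$ acts on loops by reparametrization. A $g$-geodesic string is the equivalence class of a closed, constant speed $g$-geodesic $o:S^1\to T^2$ modulo this action; $\operatorname{mult}(o)$ is the order of the isotropy subgroup of $S^1$ at $o$. *)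

theory Defs
  imports "HOL-Analysis.Analysis"
begin

section \<open>Smooth functions and \<open>C\<^sup>k\<close> distances\<close>

text \<open>\<open>iterated_deriv [b\<^sub>1, \<dots>, b\<^sub>m] f\<close> is the iterated directional derivative
  \<open>\<partial>\<^sub>b\<^sub>1 \<dots> \<partial>\<^sub>b\<^sub>m f\<close>.\<close>

primrec iterated_deriv ::
    "'a::real_normed_vector list \<Rightarrow> ('a \<Rightarrow> 'b::real_normed_vector) \<Rightarrow> 'a \<Rightarrow> 'b" where
  "iterated_deriv [] f = f"
| "iterated_deriv (b # bs) f = (\<lambda>z. frechet_derivative (iterated_deriv bs f) (at z) b)"

text \<open>To be used for open \<open>S\<close> only: the derivatives are taken in the full space.\<close>

definition smooth_on :: "'a::euclidean_space set \<Rightarrow> ('a \<Rightarrow> 'b::real_normed_vector) \<Rightarrow> bool" where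
  "smooth_on S f \<longleftrightarrow> (\<forall>bs. set bs \<subseteq> Basis \<longrightarrow> iterated_deriv bs f differentiable_on S)"

text \<open>The value is an extended nonnegative real, so that no boundedness is needed for it to be
  meaningful.\<close>

definition Ck_dist ::
    "nat \<Rightarrow> 'a::euclidean_space set \<Rightarrow> ('a \<Rightarrow> real) \<Rightarrow> ('a \<Rightarrow> real) \<Rightarrow> ennreal" where
  "Ck_dist k A f h =
     (SUP bs \<in> {bs. set bs \<subseteq> Basis \<and> length bs \<le> k}.
        SUP z \<in> A. ennreal \<bar>iterated_deriv bs (\<lambda>z. f z - h z) z\<bar>)"


section \<open>The torus\<close>

text \<open>The torus \<open>\<real>\<^sup>2/\<int>\<^sup>2\<close> is realised as a product of two unit circles, with \<open>torus_cover\<close> as its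
  universal covering. Its smooth structure and the trivialisation of its tangent bundle come from
  this covering, so functions on the tangent bundle are functions of \<open>(x, v) \<in> \<real>\<^sup>2 \<times> \<real>\<^sup>2\<close> that are
  \<open>\<int>\<^sup>2\<close>-periodic in \<open>x\<close>.\<close>

definition torus :: "(complex \<times> complex) set" where
  "torus = sphere 0 1 \<times> sphere 0 1"

definition torus_cover :: "real^2 \<Rightarrow> complex \<times> complex" where
  "torus_cover x = (cis (2 * pi * x $ 1), cis (2 * pi * x $ 2))"

definition periodic :: "(real^2 \<Rightarrow> 'b) \<Rightarrow> bool" where
  "periodic f \<longleftrightarrow> (\<forall>x n. (\<forall>i. n $ i \<in> \<int>) \<longrightarrow> f (x + n) = f x)"


section \<open>Flat Riemannian metrics\<close>

definition riemannian_metric :: "(real^2 \<Rightarrow> real^2^2) \<Rightarrow> bool" where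
  "riemannian_metric G \<longleftrightarrow>
     periodic G \<and> smooth_on UNIV G \<and>
     (\<forall>x. transpose (G x) = G x) \<and>
     (\<forall>x v. v \<noteq> 0 \<longrightarrow> v \<bullet> (G x *v v) > 0)"

abbreviation partial_x :: "2 \<Rightarrow> (real^2 \<Rightarrow> real) \<Rightarrow> real^2 \<Rightarrow> real" where
  "partial_x i \<equiv> iterated_deriv [axis i 1]"

text \<open>\<open>christoffel G k i j\<close> is the Christoffel symbol of the second kind with upper index \<open>k\<close>.\<close>

definition christoffel :: "(real^2 \<Rightarrow> real^2^2) \<Rightarrow> 2 \<Rightarrow> 2 \<Rightarrow> 2 \<Rightarrow> real^2 \<Rightarrow> real" where
  "christoffel G k i j x =
     (\<Sum>l\<in>UNIV. matrix_inv (G x) $ k $ l *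
        (partial_x i (\<lambda>y. G y $ j $ l) x + partial_x j (\<lambda>y. G y $ i $ l) x
          - partial_x l (\<lambda>y. G y $ i $ j) x)) / 2"

text \<open>The component \<open>R\<^sup>l\<^sub>i\<^sub>j\<^sub>k\<close> of \<open>R(\<partial>\<^sub>i, \<partial>\<^sub>j)\<partial>\<^sub>k\<close>.\<close>

definition riemann_curvature ::
    "(real^2 \<Rightarrow> real^2^2) \<Rightarrow> 2 \<Rightarrow> 2 \<Rightarrow> 2 \<Rightarrow> 2 \<Rightarrow> real^2 \<Rightarrow> real" where
  "riemann_curvature G l i j k x =
     partial_x i (christoffel G l j k) x - partial_x j (christoffel G l i k) x
     + (\<Sum>m\<in>UNIV. christoffel G l i m x * christoffel G m j k x
                 - christoffel G l j m x * christoffel G m i k x)"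

definition flat_riemannian_metric :: "(real^2 \<Rightarrow> real^2^2) \<Rightarrow> bool" where
  "flat_riemannian_metric G \<longleftrightarrow>
     riemannian_metric G \<and> (\<forall>l i j k x. riemann_curvature G l i j k x = 0)"

definition riemannian_norm :: "(real^2 \<Rightarrow> real^2^2) \<Rightarrow> (real^2) \<times> (real^2) \<Rightarrow> real" where
  "riemannian_norm G = (\<lambda>(x, v). sqrt (v \<bullet> (G x *v v)))"


section \<open>Finsler metrics\<close>

type_synonym finsler = "(real^2) \<times> (real^2) \<Rightarrow> real"

abbreviation squared :: "('a \<Rightarrow> real) \<Rightarrow> 'a \<Rightarrow> real" where
  "squared F \<equiv> (\<lambda>z. (F z)\<^sup>2)"

text \<open>Homogeneity includes the factor \<open>0\<close>, so \<open>F\<close> vanishes on the zero section. The last condition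
  is positive definiteness of the fibrewise Hessian of \<open>F\<^sup>2\<close> off the zero section.\<close>

definition finsler_metric :: "finsler \<Rightarrow> bool" where
  "finsler_metric F \<longleftrightarrow>
     (\<forall>v. periodic (\<lambda>x. F (x, v))) \<and>
     smooth_on (UNIV \<times> (- {0})) F \<and>
     (\<forall>x v. v \<noteq> 0 \<longrightarrow> F (x, v) > 0) \<and>
     (\<forall>x v c. c \<ge> 0 \<longrightarrow> F (x, c *\<^sub>R v) = c * F (x, v)) \<and>
     (\<forall>x v w. v \<noteq> 0 \<longrightarrow> w \<noteq> 0 \<longrightarrow>
        iterated_deriv [(0, w), (0, w)] (squared F) (x, v) > 0)"

definition finsler_dist :: "nat \<Rightarrow> finsler \<Rightarrow> finsler \<Rightarrow> ennreal" where
  "finsler_dist k F F\<^sub>0 = Ck_dist k {z. 1/2 \<le> F\<^sub>0 z \<and> F\<^sub>0 z \<le> 2} (squared F) (squared F\<^sub>0)"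

text \<open>The \<open>C\<^sup>\<infinity>\<close> topology on the set of all Finsler metrics. By homogeneity, controlling all
  derivatives of \<open>F\<^sup>2\<close> on a fixed annulus bundle controls them on every compact subset of the
  tangent bundle minus its zero section.\<close>

definition Cinf_topology :: "finsler topology" where
  "Cinf_topology = topology_generated_by
     {{H. finsler_metric H \<and>
          Ck_dist k {(x, v). 1/2 \<le> norm v \<and> norm v \<le> 2} (squared H) (squared F) < ennreal \<epsilon>}
      | k F \<epsilon>. finsler_metric F \<and> \<epsilon> > 0}"

definition residual_in :: "'a topology \<Rightarrow> 'a set \<Rightarrow> bool" where
  "residual_in X R \<longleftrightarrow> R \<subseteq> topspace X \<and>
     (\<exists>U :: nat \<Rightarrow> 'a set. (\<forall>n. openin X (U n) \<and> X closure_of (U n) = topspace X) \<and>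
        topspace X \<inter> (\<Inter>n. U n) \<subseteq> R)"


section \<open>Closed geodesics and strings\<close>

text \<open>A constant speed geodesic, given in the universal covering: a nonconstant solution of the
  Euler--Lagrange equation \<open>d/dt \<partial>\<^sub>vL(\<gamma>, \<gamma>') = \<partial>\<^sub>xL(\<gamma>, \<gamma>')\<close> of the energy \<open>L = F\<^sup>2/2\<close>.\<close>

definition geodesic :: "finsler \<Rightarrow> (real \<Rightarrow> real^2) \<Rightarrow> bool" where
  "geodesic F \<gamma> \<longleftrightarrow>
     (let \<gamma>' = (\<lambda>t. vector_derivative \<gamma> (at t)); L = (\<lambda>z. (F z)\<^sup>2 / 2) in
       smooth_on UNIV \<gamma> \<and>
       (\<exists>c>0. \<forall>t. F (\<gamma> t, \<gamma>' t) = c) \<and>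
       (\<forall>b t. ((\<lambda>s. iterated_deriv [(0, b)] L (\<gamma> s, \<gamma>' s)) has_real_derivative
                 iterated_deriv [(b, 0)] L (\<gamma> t, \<gamma>' t)) (at t)))"

text \<open>Maps on \<open>S\<^sup>1 = \<real>/\<int>\<close> are \<open>1\<close>-periodic functions on \<open>\<real>\<close>.\<close>

definition closed_geodesic :: "finsler \<Rightarrow> (real \<Rightarrow> complex \<times> complex) \<Rightarrow> bool" where
  "closed_geodesic F c \<longleftrightarrow>
     (\<forall>t. c (t + 1) = c t) \<and> (\<exists>\<gamma>. geodesic F \<gamma> \<and> c = torus_cover \<circ> \<gamma>)"

definition rotate_loop :: "real \<Rightarrow> (real \<Rightarrow> 'a) \<Rightarrow> real \<Rightarrow> 'a" where
  "rotate_loop a c = (\<lambda>t. c (t + a))"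

definition geodesic_string :: "finsler \<Rightarrow> (real \<Rightarrow> complex \<times> complex) set \<Rightarrow> bool" where
  "geodesic_string F s \<longleftrightarrow> (\<exists>c. closed_geodesic F c \<and> s = range (\<lambda>a. rotate_loop a c))"

text \<open>The order of the isotropy group in \<open>\<real>/\<int>\<close>, whose elements are represented in \<open>[0, 1)\<close>. As the
  group is abelian, all loops in a string have the same isotropy group.\<close>

definition string_mult :: "(real \<Rightarrow> 'a) set \<Rightarrow> nat" where
  "string_mult s = card {a \<in> {0..<1}. \<forall>c\<in>s. rotate_loop a c = c}"

text \<open>A loop in the sense of \<^const>\<open>homotopic_loops\<close> only matters on \<open>[0, 1]\<close>; a \<open>1\<close>-periodic function
  belongs to a class if its restriction to \<open>[0, 1]\<close> does.\<close>

definition free_homotopy_class :: "(real \<Rightarrow> complex \<times> complex) set \<Rightarrow> bool" where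
  "free_homotopy_class \<beta> \<longleftrightarrow>
     (\<exists>p. path p \<and> path_image p \<subseteq> torus \<and> pathfinish p = pathstart p \<and>
        \<beta> = {q. homotopic_loops torus p q})"

definition nontrivial_class :: "(real \<Rightarrow> complex \<times> complex) set \<Rightarrow> bool" where
  "nontrivial_class \<beta> \<longleftrightarrow> (\<forall>a\<in>torus. (\<lambda>_. a) \<notin> \<beta>)"

text \<open>Rotating a loop does not change its free homotopy class, so a string has class \<open>\<beta>\<close> as soon as
  one of its loops lies in \<open>\<beta>\<close>.\<close>

definition string_has_class ::
    "(real \<Rightarrow> complex \<times> complex) set \<Rightarrow> (real \<Rightarrow> complex \<times> complex) set \<Rightarrow> bool" where
  "string_has_class s \<beta> \<longleftrightarrow> s \<subseteq> \<beta>"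

end

theory Submission
  imports Defs "HOL-Complex_Analysis.Great_Picard"
begin

text \<open>
  If \<open>p\<close> divides the multiplicity of a closed geodesic in \<open>\<beta>\<close>, the geodesic is the \<open>p\<close>-fold iterate of one whose
  lift \<open>\<gamma>\<close> satisfies \<open>\<gamma> (t + 1) = \<gamma> t + a\<close> for a lattice vector \<open>a \<noteq> 0\<close>, so it suffices to find two
  closed geodesics with translation vector \<open>a\<close> whose iterates are distinct strings. These come from a minimax
  argument: the minimal action \<open>m\<close> of such loops, and the minimax value \<open>M\<close> of the action over paths
  of loops leading from a loop to its translate by a lattice vector transversal to \<open>a\<close>. If \<open>m < M\<close>, both values
  are actions of closed geodesics. If \<open>m = M\<close>, there are minimisers with any prescribed mean position
  transversal to \<open>a\<close>.

  To avoid infinite-dimensional loop spaces and the geodesic flow, the action of \<open>L = F\<^sup>2 / 2\<close> is discretised by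
  \<open>(1/N) \<Sum> L (x\<^sub>i, N (x\<^sub>i\<^sub>+\<^sub>1 - x\<^sub>i))\<close>. Gradient steps provide almost critical points on each level, and as
  \<open>N \<rightarrow> \<infinity>\<close> these converge, by a compactness argument for positions and momenta, to solutions of the
  Euler--Lagrange equation.
\<close>

section \<open>Calculus of smooth functions\<close>

text \<open>Two invariants of a string tell the constructed geodesics apart. One is the energy. The
  other is the mean of \<open>\<gamma> \<bullet> l\<close> modulo \<int>, for an integer vector
  \<open>l\<close> orthogonal to \<open>a\<close>: as \<open>\<gamma> \<bullet> l\<close> is
  1-periodic, a time shift keeps its mean, and another lift changes it by an integer. Two different
  strings suffice, since at most one of them is the given one.

  The values m and M are not formed as limits. The cases are whether or not the gap between the
  discrete minimum and the discrete minimax tends to 0; if it does not, a subsequence keeps the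
  energies of the limits apart.

  The main obstacle is the zero section: F^2 has first derivatives there, but second derivatives may
  fail to exist, and discrete loops may have zero velocities. Descent therefore uses moduli of
  continuity instead of second derivative bounds. The discrete equation controls increments of the
  momentum, and the velocity is recovered by a continuous inverse of the Legendre map. Energy
  conservation then excludes zero velocities, after which the limit curves are shown to be
  smooth.\<close>

definition Cn_on :: "nat \<Rightarrow> 'a::euclidean_space set \<Rightarrow> ('a \<Rightarrow> 'b::real_normed_vector) \<Rightarrow> bool" where
  "Cn_on n S f \<longleftrightarrow>
     (\<forall>bs. set bs \<subseteq> Basis \<longrightarrow> length bs \<le> n \<longrightarrow> iterated_deriv bs f differentiable_on S)"

abbreviation dir_deriv :: "'a \<Rightarrow> ('a::real_normed_vector \<Rightarrow> 'b::real_normed_vector) \<Rightarrow> 'a \<Rightarrow> 'b" where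
  "dir_deriv b f z \<equiv> frechet_derivative f (at z) b"

lemma smooth_on_iff_Cn_on: "smooth_on S f \<longleftrightarrow> (\<forall>n. Cn_on n S f)"
  unfolding smooth_on_def Cn_on_def by blast

lemma iterated_deriv_snoc: "iterated_deriv (bs @ [b]) f = iterated_deriv bs (dir_deriv b f)"
  by (induction bs) auto

text \<open>Derivative formulas below hold on an open set \<open>S\<close> only. At its points a
  derivative depends on the values in \<open>S\<close> alone, so functions may be exchanged
  there.\<close>

lemma frechet_derivative_cong_open:
  assumes "open S" "z \<in> S" "\<And>y. y \<in> S \<Longrightarrow> f y = g y"
  shows "frechet_derivative f (at z) = frechet_derivative g (at z)"
proof -
  have "(f has_derivative f') (at z) \<longleftrightarrow> (g has_derivative f') (at z)" for f'
    using assms has_derivative_transform_within_open[of f f' z UNIV S g]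
      has_derivative_transform_within_open[of g f' z UNIV S f] by auto
  then show ?thesis
    by (simp add: frechet_derivative_def)
qed

lemma iterated_deriv_cong_open:
  assumes "open S" "\<And>y. y \<in> S \<Longrightarrow> f y = g y" "z \<in> S"
  shows "iterated_deriv bs f z = iterated_deriv bs g z"
  using assms(3)
proof (induction bs arbitrary: z)
  case (Cons b bs)
  then show ?case
    using frechet_derivative_cong_open[OF assms(1) Cons.prems Cons.IH] by simp
qed (use assms in auto)

lemma differentiable_on_cong_open:
  assumes "open S" "\<And>y. y \<in> S \<Longrightarrow> f y = g y"
  shows "f differentiable_on S \<longleftrightarrow> g differentiable_on S"
proof -
  have "f differentiable_on S" if "g differentiable_on S" "\<And>y. y \<in> S \<Longrightarrow> f y = g y" for f g
    unfolding differentiable_on_def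
  proof
    fix z assume "z \<in> S"
    with that show "f differentiable (at z within S)"
      by (intro differentiable_transform_within[of g z S 1 f]) (auto simp: differentiable_on_def)
  qed
  then show ?thesis
    using assms(2) by auto
qed

lemma Cn_on_cong:
  assumes "open S" "\<And>y. y \<in> S \<Longrightarrow> f y = g y"
  shows "Cn_on n S f \<longleftrightarrow> Cn_on n S g"
proof -
  have "iterated_deriv bs f differentiable_on S \<longleftrightarrow> iterated_deriv bs g differentiable_on S" for bs
    by (rule differentiable_on_cong_open[OF assms(1)]) (rule iterated_deriv_cong_open[OF assms])
  then show ?thesis
    by (simp add: Cn_on_def)
qed

text \<open>Splits off the innermost derivative, whereas the recursion of
  \<open>iterated_deriv\<close> adds outer ones. Closure properties thus follow by induction on the
  order from a rule for one derivative; smoothness itself has no order to induct on.\<close>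

lemma Cn_on_Suc:
  "Cn_on (Suc n) S f \<longleftrightarrow> f differentiable_on S \<and> (\<forall>b\<in>Basis. Cn_on n S (dir_deriv b f))"
proof safe
  assume *: "Cn_on (Suc n) S f"
  then show "f differentiable_on S"
    unfolding Cn_on_def by (metis iterated_deriv.simps(1) empty_subsetI list.set(1) list.size(3) zero_le)
  fix b :: 'a assume "b \<in> Basis"
  with * show "Cn_on n S (dir_deriv b f)"
    unfolding Cn_on_def iterated_deriv_snoc[symmetric] by auto
next
  assume *: "f differentiable_on S" "\<forall>b\<in>Basis. Cn_on n S (dir_deriv b f)"
  show "Cn_on (Suc n) S f"
    unfolding Cn_on_def
  proof safe
    fix bs :: "'a list" assume bs: "set bs \<subseteq> Basis" "length bs \<le> Suc n"
    show "iterated_deriv bs f differentiable_on S"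
    proof (cases bs rule: rev_cases)
      case (snoc bs' b)
      with bs * show ?thesis
        unfolding snoc iterated_deriv_snoc Cn_on_def by auto
    qed (use * in auto)
  qed
qed

lemma Cn_on_0: "Cn_on 0 S f \<longleftrightarrow> f differentiable_on S"
  by (auto simp: Cn_on_def)

lemma Cn_on_mono: "Cn_on n S f \<Longrightarrow> m \<le> n \<Longrightarrow> Cn_on m S f"
  by (auto simp: Cn_on_def)

lemma differentiable_on_openD:
  "f differentiable_on S \<Longrightarrow> open S \<Longrightarrow> z \<in> S \<Longrightarrow> (f has_derivative frechet_derivative f (at z)) (at z)"
  unfolding differentiable_on_def by (metis at_within_open frechet_derivative_works)

lemma Cn_on_linear:
  assumes "bounded_linear f" shows "Cn_on n S f"
proof (induction n)
  case 0 show ?case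
    using assms by (simp add: Cn_on_0 bounded_linear_imp_differentiable_on)
next
  case (Suc n)
  have const: "Cn_on n S (\<lambda>_::'a. c::'b)" for c
  proof (induction n arbitrary: c)
    case (Suc n)
    then show ?case by (simp add: Cn_on_Suc frechet_derivative_const)
  qed (simp add: Cn_on_0)
  show ?case
    using const frechet_derivative_at[OF bounded_linear_imp_has_derivative[OF assms], symmetric]
    by (simp add: Cn_on_Suc bounded_linear_imp_differentiable_on assms)
qed

lemma Cn_on_const: "Cn_on n S (\<lambda>_. c)"
proof (induction n arbitrary: c)
  case (Suc n)
  then show ?case by (simp add: Cn_on_Suc frechet_derivative_const)
qed (simp add: Cn_on_0)

lemma Cn_on_add:
  assumes "open S" "Cn_on n S f" "Cn_on n S g"
  shows "Cn_on n S (\<lambda>z. f z + g z)"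
  using assms(2,3)
proof (induction n arbitrary: f g)
  case (Suc n)
  note df = differentiable_on_openD[OF _ \<open>open S\<close>, of f] and dg = differentiable_on_openD[OF _ \<open>open S\<close>, of g]
  have "dir_deriv b (\<lambda>z. f z + g z) z = dir_deriv b f z + dir_deriv b g z" if "z \<in> S" for z b
    using frechet_derivative_at[OF has_derivative_add[OF df dg], symmetric] that Suc.prems by (simp add: Cn_on_Suc)
  note eq = this
  have "Cn_on n S (dir_deriv b (\<lambda>z. f z + g z))" if "b \<in> Basis" for b
    using Suc that by (intro Cn_on_cong[OF \<open>open S\<close> eq, THEN iffD2]) (auto simp: Cn_on_Suc)
  with Suc.prems show ?case
    by (simp add: Cn_on_Suc)
qed (simp add: Cn_on_0)

lemma Cn_on_scaleR:
  fixes g :: "'a::euclidean_space \<Rightarrow> 'b::real_normed_vector"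
  assumes "open S" "Cn_on n S f" "Cn_on n S g"
  shows "Cn_on n S (\<lambda>z. f z *\<^sub>R g z)"
  using assms(2,3)
proof (induction n arbitrary: f g)
  case (Suc n)
  note df = differentiable_on_openD[OF _ \<open>open S\<close>, of f] and dg = differentiable_on_openD[OF _ \<open>open S\<close>, of g]
  have eq: "dir_deriv b (\<lambda>z. f z *\<^sub>R g z) z = f z *\<^sub>R dir_deriv b g z + dir_deriv b f z *\<^sub>R g z" if "z \<in> S" for z b
    using frechet_derivative_at[OF has_derivative_scaleR[OF df dg], symmetric] that Suc.prems by (simp add: Cn_on_Suc)
  have "Cn_on n S (dir_deriv b (\<lambda>z. f z *\<^sub>R g z))" if "b \<in> Basis" for b
    using Suc that by (intro Cn_on_cong[OF \<open>open S\<close> eq, THEN iffD2] Cn_on_add \<open>open S\<close> Suc.IH) (auto simp: Cn_on_Suc intro: Cn_on_mono[of "Suc n" _ _ n])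
  moreover have "f differentiable_on S" "g differentiable_on S" 
    using Suc.prems by (auto simp: Cn_on_Suc)
  ultimately show ?case
    by (simp add: Cn_on_Suc differentiable_on_def)
qed (simp add: Cn_on_0 differentiable_on_def)

lemma Cn_on_inverse:
  fixes f :: "'a::euclidean_space \<Rightarrow> real"
  assumes "open S" "Cn_on n S f" and nz: "\<And>z. z \<in> S \<Longrightarrow> f z \<noteq> 0"
  shows "Cn_on n S (\<lambda>z. inverse (f z))"
  using assms(2)
proof (induction n)
  case (Suc n)
  note df = differentiable_on_openD[OF _ \<open>open S\<close>, of f]
  have "((\<lambda>z. inverse (f z)) has_derivative
          (\<lambda>h. - (inverse (f z) * frechet_derivative f (at z) h * inverse (f z)))) (at z)" if "z \<in> S" for z
    using df nz that Suc.prems by (intro Deriv.has_derivative_inverse) (auto simp: Cn_on_Suc)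
  \<comment> \<open>Phrased with \<open>*\<^sub>R\<close> so that \<open>Cn_on_scaleR\<close>
    applies; the factors \<open>inverse (f z)\<close> are covered at order \<open>n\<close> by the
    induction hypothesis.\<close>
  then have eq: "dir_deriv b (\<lambda>z. inverse (f z)) z = (- 1) *\<^sub>R (inverse (f z) *\<^sub>R dir_deriv b f z *\<^sub>R inverse (f z))"
    if "z \<in> S" for z b
    using that by (subst frechet_derivative_at[symmetric]) (auto simp: mult.assoc)
  have "Cn_on n S (dir_deriv b (\<lambda>z. inverse (f z)))" if "b \<in> Basis" for b
    using Suc that Cn_on_mono[OF Suc.prems, of n]
    by (intro Cn_on_cong[OF \<open>open S\<close> eq, THEN iffD2] Cn_on_scaleR Cn_on_const \<open>open S\<close>) (auto simp: Cn_on_Suc)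
  moreover have "f differentiable_on S"
    using Suc.prems by (auto simp: Cn_on_Suc)
  ultimately show ?case
    using nz by (simp add: Cn_on_Suc differentiable_on_def differentiable_inverse)
qed (use nz in \<open>simp add: Cn_on_0 differentiable_on_def differentiable_inverse\<close>)

lemma Cn_on_bounded_linear:
  assumes "open S" "bounded_linear h" "Cn_on n S f"
  shows "Cn_on n S (\<lambda>z. h (f z))"
  using assms(3)
proof (induction n arbitrary: f)
  case (Suc n)
  have deriv: "((\<lambda>z. h (f z)) has_derivative (\<lambda>b. h (dir_deriv b f z))) (at z)" if "z \<in> S" for z
    using Suc.prems that \<open>open S\<close>
    by (auto intro!: bounded_linear.has_derivative[OF assms(2)] differentiable_on_openD simp: Cn_on_Suc)
  then have eq: "dir_deriv b (\<lambda>z. h (f z)) z = h (dir_deriv b f z)" if "z \<in> S" for b z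
    using frechet_derivative_at[OF deriv[OF that], symmetric] by simp
  have "Cn_on n S (dir_deriv b (\<lambda>z. h (f z)))" if "b \<in> Basis" for b
    using Suc that by (intro Cn_on_cong[OF \<open>open S\<close> eq, THEN iffD2]) (auto simp: Cn_on_Suc)
  moreover have "(\<lambda>z. h (f z)) differentiable_on S"
    using deriv unfolding differentiable_on_def differentiable_def by (blast intro: has_derivative_at_withinI)
  ultimately show ?case
    by (simp add: Cn_on_Suc)
next
  case 0
  then show ?case
    using bounded_linear.has_derivative[OF assms(2)]
    unfolding Cn_on_0 differentiable_on_def differentiable_def by blast
qed

lemma smooth_on_const: "smooth_on S (\<lambda>_. c)"
  by (simp add: smooth_on_iff_Cn_on Cn_on_const)

lemma smooth_on_linear: "bounded_linear f \<Longrightarrow> smooth_on S f"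
  by (simp add: smooth_on_iff_Cn_on Cn_on_linear)

lemma smooth_on_add: "open S \<Longrightarrow> smooth_on S f \<Longrightarrow> smooth_on S g \<Longrightarrow> smooth_on S (\<lambda>z. f z + g z)"
  by (simp add: smooth_on_iff_Cn_on Cn_on_add)

lemma smooth_on_scaleR: "open S \<Longrightarrow> smooth_on S f \<Longrightarrow> smooth_on S g \<Longrightarrow> smooth_on S (\<lambda>z. f z *\<^sub>R g z)"
  by (simp add: smooth_on_iff_Cn_on Cn_on_scaleR)

lemma smooth_on_mult:
  fixes f g :: "'a::euclidean_space \<Rightarrow> real"
  shows "open S \<Longrightarrow> smooth_on S f \<Longrightarrow> smooth_on S g \<Longrightarrow> smooth_on S (\<lambda>z. f z * g z)"
  using smooth_on_scaleR[of S f g] by simp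

lemma smooth_on_diff: 
  assumes "open S" "smooth_on S f" "smooth_on S g" shows "smooth_on S (\<lambda>z. f z - g z)"
  using smooth_on_add[OF assms(1,2) smooth_on_scaleR[OF assms(1) smooth_on_const[where c="-1"] assms(3)]] by simp

lemma smooth_on_inverse:
  fixes f :: "'a::euclidean_space \<Rightarrow> real"
  shows "open S \<Longrightarrow> smooth_on S f \<Longrightarrow> (\<And>z. z \<in> S \<Longrightarrow> f z \<noteq> 0) \<Longrightarrow> smooth_on S (\<lambda>z. inverse (f z))"
  by (simp add: smooth_on_iff_Cn_on Cn_on_inverse)

lemma smooth_on_bounded_linear:
  "open S \<Longrightarrow> bounded_linear h \<Longrightarrow> smooth_on S f \<Longrightarrow> smooth_on S (\<lambda>z. h (f z))"
  by (simp add: smooth_on_iff_Cn_on Cn_on_bounded_linear)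

lemma smooth_on_sum:
  assumes "open S" "finite I" "\<And>i. i \<in> I \<Longrightarrow> smooth_on S (f i)"
  shows "smooth_on S (\<lambda>z. \<Sum>i\<in>I. f i z)"
  using assms(2,3) by (induction I rule: finite_induct) (auto simp: smooth_on_const intro!: smooth_on_add assms(1))

lemma smooth_on_differentiable: "smooth_on S f \<Longrightarrow> f differentiable_on S"
  by (simp add: smooth_on_iff_Cn_on Cn_on_0[symmetric])

lemma smooth_on_has_derivative:
  "smooth_on S f \<Longrightarrow> open S \<Longrightarrow> z \<in> S \<Longrightarrow> (f has_derivative frechet_derivative f (at z)) (at z)"
  by (rule differentiable_on_openD[OF smooth_on_differentiable])

lemma smooth_on_dir_deriv_Basis: "smooth_on S f \<Longrightarrow> b \<in> Basis \<Longrightarrow> smooth_on S (dir_deriv b f)"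
  unfolding smooth_on_iff_Cn_on
proof
  fix n assume "\<forall>n. Cn_on n S f" "b \<in> Basis"
  then show "Cn_on n S (dir_deriv b f)"
    using Cn_on_Suc[of n S f] by simp
qed

lemma smooth_on_cong: "open S \<Longrightarrow> (\<And>y. y \<in> S \<Longrightarrow> f y = g y) \<Longrightarrow> smooth_on S f \<longleftrightarrow> smooth_on S g"
  unfolding smooth_on_iff_Cn_on using Cn_on_cong[of S f g] by simp

lemma dir_deriv_eq_sum:
  fixes f :: "'a::euclidean_space \<Rightarrow> 'b::real_normed_vector"
  assumes "(f has_derivative frechet_derivative f (at z)) (at z)"
  shows "dir_deriv b f z = (\<Sum>i\<in>Basis. (b \<bullet> i) *\<^sub>R dir_deriv i f z)"
proof -
  interpret bounded_linear "frechet_derivative f (at z)"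
    using assms has_derivative_bounded_linear by blast
  have "dir_deriv (\<Sum>i\<in>Basis. (b \<bullet> i) *\<^sub>R i) f z = (\<Sum>i\<in>Basis. (b \<bullet> i) *\<^sub>R dir_deriv i f z)"
    by (simp only: sum scaleR)
  then show ?thesis
    by (simp only: euclidean_representation)
qed

text \<open>Expanding the direction in \<open>Basis\<close> leaves partial derivatives with smooth
  coefficients. A moving direction occurs in time derivatives along a curve and in the term
  \<open>dir_deriv (snd z, 0) P z\<close> of \<open>rhs\<close>.\<close>

lemma smooth_on_deriv_along:
  fixes f :: "'a::euclidean_space \<Rightarrow> 'b::real_normed_vector"
  assumes "open S" "smooth_on S f" "smooth_on S X"
  shows "smooth_on S (\<lambda>z. dir_deriv (X z) f z)"
proof -
  have "smooth_on S (\<lambda>z. \<Sum>i\<in>Basis. (X z \<bullet> i) *\<^sub>R dir_deriv i f z)"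
  proof (intro smooth_on_sum smooth_on_scaleR assms smooth_on_dir_deriv_Basis)
    fix i :: 'a
    show "smooth_on S (\<lambda>z. X z \<bullet> i)"
      by (intro smooth_on_bounded_linear[OF _ bounded_linear_inner_left] assms)
  qed auto
  then show ?thesis
    by (rule smooth_on_cong[OF assms(1) dir_deriv_eq_sum, THEN iffD2, rotated])
       (auto intro!: smooth_on_has_derivative assms)
qed

lemma smooth_on_dir_deriv: "open S \<Longrightarrow> smooth_on S f \<Longrightarrow> smooth_on S (dir_deriv b f)"
  by (rule smooth_on_deriv_along[OF _ _ smooth_on_const])

text \<open>Bootstrapping: the time derivative of \<open>g (z t)\<close> is the value at
  \<open>z t\<close> of the derivative of \<open>g\<close> along \<open>X\<close>, again a smooth
  function of the point. So each iterated derivative has the form \<open>g (z t)\<close>, and only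
  first differentiability of \<open>z\<close> is assumed.\<close>

lemma smooth_on_real_chain:
  fixes f :: "'a::euclidean_space \<Rightarrow> 'b::real_normed_vector" and z :: "real \<Rightarrow> 'a"
  assumes S: "open S" and X: "smooth_on S X" 
    and z: "\<And>t. (z has_vector_derivative X (z t)) (at t)" "\<And>t. z t \<in> S"
    and f: "smooth_on S f"
  shows "smooth_on UNIV (\<lambda>t. f (z t))"
proof -
  have deriv: "((\<lambda>t. f (z t)) has_derivative (\<lambda>h. h *\<^sub>R dir_deriv (X (z t)) f (z t))) (at t)"
    if "smooth_on S f" for f :: "'a \<Rightarrow> 'b" and t
  proof -
    note df = smooth_on_has_derivative[OF that S z(2), of t]
    interpret bounded_linear "frechet_derivative f (at (z t))"
      using df has_derivative_bounded_linear by blast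
    have "((\<lambda>t. f (z t)) has_derivative (\<lambda>h. dir_deriv (h *\<^sub>R X (z t)) f (z t))) (at t)"
      using has_derivative_compose[OF z(1)[unfolded has_vector_derivative_def] df] .
    then show ?thesis
      unfolding scaleR .
  qed
  have "\<exists>g. smooth_on S g \<and> iterated_deriv bs (\<lambda>t. f (z t)) = (\<lambda>t. g (z t))" if "set bs \<subseteq> Basis" for bs
    using that
  proof (induction bs)
    case (Cons b bs)
    then obtain g where g: "smooth_on S g" "iterated_deriv bs (\<lambda>t. f (z t)) = (\<lambda>t. g (z t))"
      by auto
    have "dir_deriv b (\<lambda>t. g (z t)) t = dir_deriv (X (z t)) g (z t)" for t
      using frechet_derivative_at[OF deriv[OF g(1), of t], symmetric] Cons.prems by simp
    then show ?case
      using smooth_on_deriv_along[OF S g(1) X] by (auto simp: g(2) intro!: exI)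
  qed (use f in auto)
  moreover have "(\<lambda>t. g (z t)) differentiable_on UNIV" if "smooth_on S g" for g :: "'a \<Rightarrow> 'b"
    using deriv[OF that] by (auto simp: differentiable_on_def differentiable_def)
  ultimately show ?thesis
    unfolding smooth_on_def by fastforce
qed

section \<open>Periodic and homogeneous functions\<close>

definition lattice :: "(real^2) set" where
  "lattice = {n. \<forall>i. n $ i \<in> \<int>}"

lemma lattice_0: "0 \<in> lattice"
  and lattice_scaleR: "m \<in> lattice \<Longrightarrow> k \<in> \<int> \<Longrightarrow> k *\<^sub>R m \<in> lattice"
  by (auto simp: lattice_def)

lemma periodic_lattice: "periodic f \<Longrightarrow> n \<in> lattice \<Longrightarrow> f (x + n) = f x"
  by (auto simp: periodic_def lattice_def)

text \<open>Stands in for compactness of the torus: after a lattice shift it is enough to look at a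
  fixed ball. The radius 2 comes from the l1 norm of two coordinates of size at most 1.\<close>

lemma lattice_reduce:
  fixes x :: "real^2"
  obtains n where "n \<in> lattice" "norm (x + n) \<le> 2"
proof
  let ?n = "(\<chi> i. - real_of_int \<lfloor>x $ i\<rfloor>) :: real^2"
  show "?n \<in> lattice" by (auto simp: lattice_def)
  have "\<bar>(x + ?n) $ i\<bar> \<le> 1" for i
    by (simp; linarith)
  then have "norm (x + ?n) \<le> (\<Sum>i\<in>(UNIV::2 set). 1)"
    using norm_le_l1_cart[of "x + ?n"] sum_mono[of UNIV "\<lambda>i. \<bar>(x + ?n) $ i\<bar>" "\<lambda>_. 1"] by fastforce
  then show "norm (x + ?n) \<le> 2" by simp
qed

lemma periodic_uniformly_continuous:
  fixes f :: "(real^2) \<times> 'a::euclidean_space \<Rightarrow> 'b::metric_space"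
  assumes "continuous_on UNIV f" "\<And>v. periodic (\<lambda>x. f (x, v))" "e > 0"
  obtains d where "d > 0"
    "\<And>x y v w. norm v \<le> V \<Longrightarrow> norm w \<le> V \<Longrightarrow> dist x y < d \<Longrightarrow> dist v w < d \<Longrightarrow>
       dist (f (x, v)) (f (y, w)) < e"
proof -
  \<comment> \<open>The radius is 2 for the reduced first point plus 1 for the distance to the
    second. Below, \<open>d / 2\<close> is used because a distance of pairs is at most the sum of
    the two component distances.\<close>
  have "compact (cball (0::real^2) 3 \<times> cball (0::'a) V)"
    by (intro compact_Times compact_cball)
  then have "uniformly_continuous_on (cball (0::real^2) 3 \<times> cball (0::'a) V) f"
    using assms(1) by (intro compact_uniformly_continuous) (auto intro: continuous_on_subset)
  then obtain d where d: "d > 0"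
      "\<And>p q. p \<in> cball 0 3 \<times> cball 0 V \<Longrightarrow> q \<in> cball 0 3 \<times> cball 0 V \<Longrightarrow> dist q p < d \<Longrightarrow> dist (f q) (f p) < e"
    using \<open>e > 0\<close> unfolding uniformly_continuous_on_def by metis
  show thesis
  proof (rule that[of "min 1 (d/2)"])
    fix x y :: "real^2" and v w :: 'a
    assume *: "norm v \<le> V" "norm w \<le> V" "dist x y < min 1 (d/2)" "dist v w < min 1 (d/2)"
    obtain n where n: "n \<in> lattice" "norm (x + n) \<le> 2"
      by (rule lattice_reduce)
    have "dist (x + n) (y + n) < 1"
      using * by (simp add: dist_norm)
    then have "norm (y + n) \<le> 3"
      using n(2) norm_triangle_ineq2[of "y + n" "x + n"] by (simp add: dist_norm norm_minus_commute)
    moreover have "dist (x + n, v) (y + n, w) < d"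
      using * sqrt_sum_squares_le_sum[of "dist (x + n) (y + n)" "dist v w"]
      by (simp add: dist_Pair_Pair)
    ultimately have "dist (f (x + n, v)) (f (y + n, w)) < e"
      using * n(2) by (intro d(2)) auto
    then show "dist (f (x, v)) (f (y, w)) < e"
      using periodic_lattice[OF assms(2) n(1)] by simp
  qed (use d in auto)
qed

lemma periodic_bounded:
  fixes f :: "(real^2) \<times> 'a::euclidean_space \<Rightarrow> 'b::real_normed_vector"
  assumes "compact K" "continuous_on (UNIV \<times> K) f" "\<And>v. periodic (\<lambda>x. f (x, v))"
  obtains B where "B > 0" "\<And>x v. v \<in> K \<Longrightarrow> norm (f (x, v)) \<le> B"
proof -
  have "compact (f ` (cball (0::real^2) 2 \<times> K))"
    using assms(1) by (intro compact_continuous_image compact_Times continuous_on_subset[OF assms(2)]) auto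
  then obtain B where B: "B > 0" "\<And>z. z \<in> f ` (cball 0 2 \<times> K) \<Longrightarrow> norm z \<le> B"
    using compact_imp_bounded bounded_pos by metis
  show thesis
  proof (rule that[OF B(1)])
    fix x :: "real^2" and v :: 'a assume v: "v \<in> K"
    obtain n where n: "n \<in> lattice" "norm (x + n) \<le> 2"
      by (rule lattice_reduce)
    have "norm (f (x + n, v)) \<le> B"
      using n v by (intro B) auto
    then show "norm (f (x, v)) \<le> B"
      using periodic_lattice[OF assms(3) n(1)] by simp
  qed
qed

lemma homogeneous_bounded:
  fixes f :: "(real^2) \<times> 'a::euclidean_space \<Rightarrow> 'b::real_normed_vector"
  assumes cont: "continuous_on (UNIV \<times> sphere 0 1) f" and per: "\<And>v. periodic (\<lambda>x. f (x, v))"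
    and hom: "\<And>x v c. c \<ge> 0 \<Longrightarrow> f (x, c *\<^sub>R v) = c ^ k *\<^sub>R f (x, v)"
  obtains C where "C > 0" "\<And>x v. norm (f (x, v)) \<le> C * norm v ^ k"
proof -
  obtain B where B: "B > 0" "\<And>x v. v \<in> sphere 0 1 \<Longrightarrow> norm (f (x, v)) \<le> B"
    by (rule periodic_bounded[OF compact_sphere cont per]) blast
  \<comment> \<open>On the zero section homogeneity forces the value 0 if \<open>k > 0\<close>; for
    \<open>k = 0\<close> the value is that at any unit vector, because
    \<open>0 ^ 0 = 1\<close>.\<close>
  obtain B0 where B0: "B0 > 0" "\<And>x v. v \<in> {0} \<Longrightarrow> norm (f (x, v)) \<le> B0"
  proof (cases "k = 0")
    case True
    obtain u :: 'a where u: "norm u = 1" 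
      using vector_choose_size[of 1] by auto
    have "f (x, 0) = f (x, u)" for x
      using hom[of 0 x u] True by simp
    then show ?thesis using B that[of B] u by auto
  next
    case False
    then have "f (x, 0) = 0" for x 
      using hom[of 0 x 0] by (simp add: power_0_left)
    then show ?thesis using that[of 1] by auto
  qed
  show thesis
  proof (rule that[of "B + B0"])
    fix x v
    show "norm (f (x, v)) \<le> (B + B0) * norm v ^ k"
    proof (cases "v = 0")
      case True
      then show ?thesis using B0(2)[of v x] B(1) hom[of 0 x 0] by (cases "k = 0") (auto simp: power_0_left)
    next
      case False
      have "f (x, v) = norm v ^ k *\<^sub>R f (x, v /\<^sub>R norm v)"
        using hom[of "norm v" x "v /\<^sub>R norm v"] False by simp
      then have "norm (f (x, v)) = norm v ^ k * norm (f (x, v /\<^sub>R norm v))"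
        by simp
      also have "\<dots> \<le> norm v ^ k * (B + B0)"
        using B(2)[of "v /\<^sub>R norm v" x] False B0(1) by (intro mult_left_mono) auto
      finally show ?thesis by (simp add: mult.commute)
    qed
  qed (use B B0 in auto)
qed

text \<open>Positive degree makes \<open>f\<close> tend to 0 at the zero section, uniformly in the
  base point. In this way the first derivatives of F^2, a priori regular only off the zero section,
  become continuous everywhere.\<close>

lemma homogeneous_continuous:
  fixes f :: "(real^2) \<times> 'a::euclidean_space \<Rightarrow> 'b::real_normed_vector"
  assumes cont: "continuous_on (UNIV \<times> - {0}) f" and per: "\<And>v. periodic (\<lambda>x. f (x, v))"
    and hom: "\<And>x v c. c \<ge> 0 \<Longrightarrow> f (x, c *\<^sub>R v) = c ^ k *\<^sub>R f (x, v)" and "k > 0"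
  shows "continuous_on UNIV f"
proof -
  have "continuous_on (UNIV \<times> sphere 0 1) f"
    using cont by (rule continuous_on_subset) auto
  then obtain C where C: "C > 0" "\<And>x v. norm (f (x, v)) \<le> C * norm v ^ k"
    by (rule homogeneous_bounded[OF _ per hom]) blast+
  have "isCont f z" for z
  proof (cases "snd z = 0")
    case False
    have "open (UNIV \<times> - {0} :: ((real^2) \<times> 'a) set)"
      by (intro open_Times) auto
    then show ?thesis
      using cont False by (cases z) (simp add: continuous_on_eq_continuous_at)
  next
    case True
    have "((\<lambda>y. C * norm (snd y) ^ k) \<longlongrightarrow> C * norm (snd z) ^ k) (at z)"
      by (intro tendsto_intros)
    then have "((\<lambda>y. C * norm (snd y) ^ k) \<longlongrightarrow> 0) (at z)"
      using True \<open>k > 0\<close> by (simp add: power_0_left)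
    then have "(f \<longlongrightarrow> 0) (at z)"
      by (rule Lim_null_comparison[rotated]) (auto intro!: always_eventually simp: C)
    moreover have "f z = 0"
      using C(2)[of "fst z" "snd z"] True \<open>k > 0\<close> by (cases z) (simp add: power_0_left)
    ultimately show ?thesis
      by (simp add: isCont_def)
  qed
  then show ?thesis
    by (simp add: continuous_at_imp_continuous_on)
qed

section \<open>Discretised action\<close>

lemma euler_homogeneous:
  fixes L :: "'a::real_inner \<times> 'b::real_inner \<Rightarrow> real"
  assumes deriv: "(L has_derivative (\<lambda>h. q \<bullet> fst h + p \<bullet> snd h)) (at (x, v))"
    and hom: "\<And>c. c \<ge> 0 \<Longrightarrow> L (x, c *\<^sub>R v) = c\<^sup>2 * L (x, v)"
  shows "p \<bullet> v = 2 * L (x, v)"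
proof -
  have "((\<lambda>c. L (x, c *\<^sub>R v)) has_derivative (\<lambda>h. q \<bullet> fst (0, h *\<^sub>R v) + p \<bullet> snd (0::'a, h *\<^sub>R v))) (at 1)"
    by (rule has_derivative_compose[where f = "\<lambda>c. (x, c *\<^sub>R v)" and g = L])
       (use deriv in \<open>auto intro!: derivative_eq_intros\<close>)
  then have "((\<lambda>c. L (x, c *\<^sub>R v)) has_real_derivative p \<bullet> v) (at 1)"
    by (simp add: has_field_derivative_def mult_commute_abs)
  moreover have "((\<lambda>c. c\<^sup>2 * L (x, v)) has_real_derivative 2 * L (x, v)) (at 1)"
    by (auto intro!: derivative_eq_intros)
  then have "((\<lambda>c. L (x, c *\<^sub>R v)) has_real_derivative 2 * L (x, v)) (at 1)"
    by (rule has_field_derivative_transform_within_open[where S = "{0<..}"]) (auto simp: hom)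
  ultimately show ?thesis
    by (rule DERIV_unique)
qed

text \<open>\<open>Q\<close> and \<open>P\<close> are the derivatives of \<open>L\<close> in
  position and velocity, so \<open>P\<close> is the momentum. Only first derivatives occur, since
  F^2 / 2 may have no second derivatives on the zero section; convexity enters through injectivity
  of \<open>P\<close>.\<close>

locale lagrangian =
  fixes L :: "(real^2) \<times> (real^2) \<Rightarrow> real" and P Q :: "(real^2) \<times> (real^2) \<Rightarrow> real^2"
  assumes L_deriv: "\<And>z. (L has_derivative (\<lambda>h. Q z \<bullet> fst h + P z \<bullet> snd h)) (at z)"
    and P_cont: "continuous_on UNIV P" and Q_cont: "continuous_on UNIV Q"
    and L_periodic: "\<And>v. periodic (\<lambda>x. L (x, v))"
    and P_periodic: "\<And>v. periodic (\<lambda>x. P (x, v))"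
    and Q_periodic: "\<And>v. periodic (\<lambda>x. Q (x, v))"
    and L_hom: "\<And>x v c. c \<ge> 0 \<Longrightarrow> L (x, c *\<^sub>R v) = c\<^sup>2 * L (x, v)"
    and P_hom: "\<And>x v c. c \<ge> 0 \<Longrightarrow> P (x, c *\<^sub>R v) = c *\<^sub>R P (x, v)"
    and Q_hom: "\<And>x v c. c \<ge> 0 \<Longrightarrow> Q (x, c *\<^sub>R v) = c\<^sup>2 *\<^sub>R Q (x, v)"
    and L_pos: "\<And>x v. v \<noteq> 0 \<Longrightarrow> L (x, v) > 0"
    and P_inj: "\<And>x v w. P (x, v) = P (x, w) \<Longrightarrow> v = w"
begin

lemma L_cont: "continuous_on UNIV L"
  using has_derivative_continuous[OF L_deriv] by (intro continuous_at_imp_continuous_on) simp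

lemma L_0: "L (x, 0) = 0"
  using L_hom[of 0 x 0] by simp

lemma L_nonneg: "L z \<ge> 0"
  using L_pos[of "snd z" "fst z"] L_0[of "fst z"] by (cases z; cases "snd z = 0") (auto simp: less_imp_le)

lemma Q_bound:
  obtains C where "C > 0" "\<And>x v. norm (Q (x, v)) \<le> C * (norm v)\<^sup>2"
  by (rule homogeneous_bounded[OF continuous_on_subset[OF Q_cont] Q_periodic Q_hom]) auto

lemma L_upper:
  obtains C where "C > 0" "\<And>x v. L (x, v) \<le> C * (norm v)\<^sup>2"
proof -
  obtain C where "C > 0" "\<And>x v. norm (L (x, v)) \<le> C * (norm v)\<^sup>2"
    by (rule homogeneous_bounded[OF continuous_on_subset[OF L_cont] L_periodic, where k = 2]) (auto simp: L_hom)
  then show thesis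
    using that[of C] by (simp add: abs_le_iff)
qed

lemma L_lower:
  obtains c where "c > 0" "\<And>x v. c * (norm v)\<^sup>2 \<le> L (x, v)"
proof -
  have nz: "L z \<noteq> 0" if "z \<in> UNIV \<times> sphere 0 1" for z
  proof -
    have "snd z \<noteq> 0" using that by auto
    then show ?thesis using L_pos[of "snd z" "fst z"] by simp
  qed
  have "continuous_on (UNIV \<times> sphere 0 1) (\<lambda>z. inverse (L z))"
    by (intro continuous_on_inverse continuous_on_subset[OF L_cont] ballI nz) auto
  moreover have "periodic (\<lambda>x. inverse (L (x, v)))" for v
    using L_periodic by (simp add: periodic_def)
  ultimately obtain B where B: "B > 0" "\<And>x v. v \<in> sphere 0 1 \<Longrightarrow> norm (inverse (L (x, v))) \<le> B"
    using periodic_bounded[OF compact_sphere, of 0 1 "\<lambda>z. inverse (L z)"] by auto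
  show thesis
  proof (rule that[of "inverse B"])
    fix x v
    show "inverse B * (norm v)\<^sup>2 \<le> L (x, v)"
    proof (cases "v = 0")
      case False
      let ?u = "v /\<^sub>R norm v"
      have "inverse (L (x, ?u)) \<le> B"
        using B(2)[of ?u x] False L_nonneg[of "(x, ?u)"] by simp
      moreover have "L (x, ?u) > 0"
        using False by (intro L_pos) auto
      ultimately have "inverse B \<le> L (x, ?u)"
        using le_imp_inverse_le[of "inverse (L (x, ?u))" B] by simp
      then have "inverse B * (norm v)\<^sup>2 \<le> L (x, ?u) * (norm v)\<^sup>2"
        by (intro mult_right_mono) auto
      also have "\<dots> = L (x, v)"
        using L_hom[of "norm v" x ?u] False by (simp add: mult.commute)
      finally show ?thesis .
    qed (simp add: L_0)
  qed (use B in auto)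
qed

text \<open>The error is relative to the squared velocity, so its mean along a loop is controlled by
  the action. This makes the estimate in \<open>multiplier_bound\<close> uniform in
  \<open>N\<close>, where no uniform velocity bound is at hand.\<close>

lemma Q_modulus:
  assumes "e > 0"
  obtains d where "d > 0" "\<And>x a v. norm a < d \<Longrightarrow> norm (Q (x + a, v) - Q (x, v)) \<le> e * (norm v)\<^sup>2"
proof -
  obtain d where d: "d > 0"
    "\<And>x y v w. norm v \<le> 1 \<Longrightarrow> norm w \<le> 1 \<Longrightarrow> dist x y < d \<Longrightarrow> dist v w < d \<Longrightarrow> dist (Q (x, v)) (Q (y, w)) < e"
    using periodic_uniformly_continuous[OF Q_cont Q_periodic assms, of 1] by blast
  show thesis
  proof (rule that[OF d(1)])
    fix x a v :: "real^2" assume a: "norm a < d"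
    let ?u = "v /\<^sub>R norm v"
    show "norm (Q (x + a, v) - Q (x, v)) \<le> e * (norm v)\<^sup>2"
    proof (cases "v = 0")
      case True
      then show ?thesis using Q_hom[of 0 _ 0] by simp
    next
      case False
      then have "Q (y, v) = (norm v)\<^sup>2 *\<^sub>R Q (y, ?u)" for y
        using Q_hom[of "norm v" y ?u] by simp
      then have "norm (Q (x + a, v) - Q (x, v)) = (norm v)\<^sup>2 * norm (Q (x + a, ?u) - Q (x, ?u))"
        by (simp flip: scaleR_diff_right)
      also have "\<dots> \<le> (norm v)\<^sup>2 * e"
        using d(2)[of ?u ?u "x + a" x] a False \<open>d > 0\<close>
        by (intro mult_left_mono) (auto simp: dist_norm)
      finally show ?thesis by (simp add: mult.commute)
    qed
  qed
qed

lemma P_snd: "P (x, v) \<bullet> v = 2 * L (x, v)"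
  by (rule euler_homogeneous[OF L_deriv L_hom])

text \<open>By Euler's identity the momentum pairs with the velocity to \<open>2 * L\<close>, which
  grows quadratically. Bounds on momenta thus become bounds on velocities.\<close>

lemma P_coercive:
  obtains c where "c > 0" "\<And>x v. c * norm v \<le> norm (P (x, v))"
proof -
  obtain c where c: "c > 0" "\<And>x v. c * (norm v)\<^sup>2 \<le> L (x, v)"
    using L_lower by blast
  show thesis
  proof (rule that[OF c(1)])
    fix x v
    have "c * (norm v)\<^sup>2 \<le> norm (P (x, v)) * norm v"
      using c(2)[of v x] P_snd[of x v] L_nonneg[of "(x, v)"] Cauchy_Schwarz_ineq2[of "P (x, v)" v] by linarith
    then show "c * norm v \<le> norm (P (x, v))"
      by (cases "v = 0") (auto simp: power2_eq_square mult.assoc[symmetric])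
  qed
qed

text \<open>The velocity with momentum \<open>p\<close> minimises
  \<open>L (x, v) - p \<bullet> v\<close>. Outside the ball of radius \<open>norm p / c\<close> the
  quadratic lower bound keeps this function nonnegative, while it is 0 at the origin, so a minimum
  over the ball is global.\<close>

lemma P_surj: "\<exists>v. P (x, v) = p"
proof -
  obtain c where c: "c > 0" "\<And>x v. c * (norm v)\<^sup>2 \<le> L (x, v)"
    using L_lower by blast
  let ?f = "\<lambda>v. L (x, v) - p \<bullet> v" and ?R = "norm p / c"
  have "continuous_on (cball 0 ?R) ?f"
    by (intro continuous_intros continuous_on_compose2[OF L_cont]) auto
  then obtain v where v: "v \<in> cball 0 ?R" "\<And>w. w \<in> cball 0 ?R \<Longrightarrow> ?f v \<le> ?f w"
  proof -
    have "0 \<in> cball (0::real^2) ?R" using c(1) by simp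
    then show thesis
      using continuous_attains_inf[OF compact_cball _ \<open>continuous_on (cball 0 ?R) ?f\<close>] that by blast
  qed
  have "?f v \<le> ?f w" for w
  proof (cases "w \<in> cball 0 ?R")
    case False
    then have "norm p \<le> c * norm w"
      using c(1) by (simp add: field_simps)
    then have "norm p * norm w \<le> c * (norm w)\<^sup>2"
      by (simp add: power2_eq_square mult.assoc[symmetric] mult_right_mono)
    then have "0 \<le> ?f w"
      using c(2)[of w x] norm_cauchy_schwarz[of p w] by linarith
    moreover have "?f v \<le> ?f 0"
      using c(1) by (intro v(2)) auto
    ultimately show ?thesis
      by (simp add: L_0)
  qed (use v in auto)
  moreover have "(?f has_derivative (\<lambda>h. (Q (x, v) \<bullet> fst (0, h) + P (x, v) \<bullet> snd (0::real^2, h)) - p \<bullet> h)) (at v)"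
    by (intro has_derivative_diff has_derivative_compose[where f = "\<lambda>v. (x, v)", OF _ L_deriv])
       (auto intro!: derivative_eq_intros)
  ultimately have "(\<lambda>h. (Q (x, v) \<bullet> fst (0, h) + P (x, v) \<bullet> snd (0::real^2, h)) - p \<bullet> h) = (\<lambda>h. 0)"
    by (intro differential_zero_maxmin[of v UNIV ?f]) auto
  then have "(P (x, v) - p) \<bullet> h = 0" for h
    by (auto simp: fun_eq_iff inner_diff_left)
  then have "P (x, v) - p = 0"
    using inner_eq_zero_iff by blast
  then show ?thesis by auto
qed

definition W :: "(real^2) \<times> (real^2) \<Rightarrow> real^2" where
  "W y = (THE v. P (fst y, v) = snd y)"

lemma W_P: "W (x, P (x, v)) = v"
  unfolding W_def by (rule the_equality) (auto dest: P_inj)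

lemma P_W: "P (x, W (x, p)) = p"
  using P_surj[of x p] W_P by auto

text \<open>Invariance of domain: the Legendre map \<open>(x, v) \<mapsto> (x, P (x, v))\<close> is
  a continuous bijection of a Euclidean space, so its inverse is continuous. The inverse function
  theorem would ask for a derivative of \<open>P\<close> at zero velocity.\<close>

lemma W_cont: "continuous_on UNIV W"
proof -
  let ?\<Phi> = "\<lambda>z. (fst z, P z)"
  have "continuous_on (range ?\<Phi>) (\<lambda>y. (fst y, W y))"
  proof (rule continuous_on_inverse_open)
    show "continuous_on UNIV ?\<Phi>"
      by (intro continuous_on_Pair continuous_on_fst continuous_on_id P_cont)
  qed (auto simp: W_P)
  moreover have "range ?\<Phi> = UNIV"
  proof -
    have "?\<Phi> (fst y, W y) = y" for y
      using P_W[of "fst y" "snd y"] by simp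
    then show ?thesis by (rule surjI)
  qed
  ultimately have "continuous_on UNIV (\<lambda>y. snd (fst y, W y))"
    by (intro continuous_on_snd) auto
  then show ?thesis by simp
qed

lemma W_periodic: "periodic (\<lambda>x. W (x, p))"
  using P_periodic by (simp add: W_def periodic_def)

end

section \<open>Quasi-periodic sequences and their means\<close>

definition mean :: "nat \<Rightarrow> (int \<Rightarrow> 'b::real_vector) \<Rightarrow> 'b" where
  "mean N f = (\<Sum>i\<in>{0..<int N}. f i) /\<^sub>R real N"

text \<open>Lift of a closed polygon with \<open>N\<close> vertices that advances by
  \<open>a\<close> per turn; \<open>a = 0\<close> means an \<open>N\<close>-periodic sequence.
  Indices are integers so that a cyclic shift is a plain shift.\<close>

definition quasi_periodic :: "nat \<Rightarrow> 'b::real_vector \<Rightarrow> (int \<Rightarrow> 'b) \<Rightarrow> bool" where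
  "quasi_periodic N a x \<longleftrightarrow> (\<forall>i. x (i + int N) = x i + a)"

lemma quasi_periodic_int:
  assumes "quasi_periodic N a x"
  shows "x (i + k * int N) = x i + of_int k *\<^sub>R a"
proof -
  have nat: "x (i + int n * int N) = x i + real n *\<^sub>R a" for n i
  proof (induction n)
    case (Suc n)
    have "x (i + int (Suc n) * int N) = x ((i + int n * int N) + int N)"
      by (simp add: algebra_simps)
    also have "\<dots> = x i + real n *\<^sub>R a + a"
      using assms Suc by (simp only: quasi_periodic_def)
    finally show ?case by (simp add: scaleR_add_left)
  qed simp
  show ?thesis
  proof (cases "k \<ge> 0")
    case True
    then show ?thesis using nat[of i "nat k"] by simp
  next
    case False
    then show ?thesis using nat[of "i + k * int N" "nat (- k)"] by (simp add: algebra_simps)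
  qed
qed

lemma quasi_periodic_mod:
  assumes "quasi_periodic N a x"
  shows "x i = x (i mod int N) + of_int (i div int N) *\<^sub>R a"
  using quasi_periodic_int[OF assms, of "i mod int N" "i div int N"] by (simp add: mod_mult_div_eq add.commute mult.commute)

lemma periodic_all:
  assumes "quasi_periodic N 0 f" "N > 0" "\<And>i. i \<in> {0..<int N} \<Longrightarrow> R (f i)"
  shows "R (f i)"
  using quasi_periodic_mod[OF assms(1), of i] assms(3)[of "i mod int N"] assms(2) by simp

lemma quasi_periodic_shift: "quasi_periodic N a x \<Longrightarrow> quasi_periodic N a (\<lambda>i. x (i + k))"
  by (simp add: quasi_periodic_def add.assoc add.commute[of "int N"]) (simp add: add.assoc[symmetric])

lemma mean_shift:
  assumes "quasi_periodic N 0 f" "N > 0"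
  shows "mean N (\<lambda>i. f (i + 1)) = mean N f"
proof -
  have "(\<Sum>i\<in>{0..<int N}. f (i + 1)) = (\<Sum>i\<in>{1..<int N + 1}. f i)"
    by (rule sum.reindex_bij_witness[of _ "\<lambda>i. i - 1" "\<lambda>i. i + 1"]) auto
  also have "{1..<int N + 1} = insert (int N) {1..<int N}"
    using \<open>N > 0\<close> by auto
  also have "(\<Sum>i\<in>insert (int N) {1..<int N}. f i) = (\<Sum>i\<in>insert 0 {1..<int N}. f i)"
    using assms(1)[unfolded quasi_periodic_def, rule_format, of 0] by simp
  also have "insert 0 {1..<int N} = {0..<int N}"
    using \<open>N > 0\<close> by auto
  finally show ?thesis by (simp add: mean_def)
qed

lemma mean_cong: "(\<And>i. i \<in> {0..<int N} \<Longrightarrow> f i = g i) \<Longrightarrow> mean N f = mean N g"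
  by (simp add: mean_def)

lemma mean_add: "mean N (\<lambda>i. f i + g i) = mean N f + mean N g"
  by (simp add: mean_def sum.distrib scaleR_add_right)

lemma mean_diff: "mean N (\<lambda>i. f i - g i) = mean N f - mean N g"
  by (simp add: mean_def sum_subtractf scaleR_diff_right)

lemma mean_const: "N > 0 \<Longrightarrow> mean N (\<lambda>i. c) = c"
  by (simp add: mean_def sum_constant_scaleR)

lemma mean_linear: "linear h \<Longrightarrow> mean N (\<lambda>i. h (f i)) = h (mean N f)"
  by (simp add: mean_def linear_sum[of h] linear_scale[of h])

lemma mean_scaleR: "mean N (\<lambda>i. c *\<^sub>R f i) = c *\<^sub>R mean N f"
  by (rule mean_linear) (simp add: linear_scale_self)

lemma mean_mult: "mean N (\<lambda>i. c * f i) = c * (mean N f :: real)"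
  using mean_scaleR[of N c f] by simp

lemma mean_inner: "mean N (\<lambda>i. f i \<bullet> c) = mean N f \<bullet> (c::'a::real_inner)"
  by (rule mean_linear) (simp add: linear_iff inner_add_left)

lemma mean_mono: "(\<And>i. i \<in> {0..<int N} \<Longrightarrow> f i \<le> g i) \<Longrightarrow> mean N f \<le> (mean N g :: real)"
  using sum_mono[of "{0..<int N}" f g] by (simp add: mean_def mult_left_mono)

lemma norm_mean_le: "norm (mean N f) \<le> mean N (\<lambda>i. norm (f i))"
  by (simp add: mean_def sum_norm_le divide_right_mono field_simps)

lemma mean_ge_component:
  assumes "j \<in> {0..<int N}" "\<And>i. f i \<ge> 0"
  shows "f j \<le> real N * mean N f"
proof -
  have "N > 0" using assms(1) by auto
  then show ?thesis
    using assms member_le_sum[of j "{0..<int N}" f] by (simp add: mean_def flip: mult.assoc)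
qed

lemma mean_le_ex:
  assumes "mean N f \<le> (c::real)" "N > 0"
  obtains j where "j \<in> {0..<int N}" "f j \<le> c"
proof (rule ccontr)
  assume *: "\<not> thesis"
  have "(\<Sum>i\<in>{0..<int N}. c) < (\<Sum>i\<in>{0..<int N}. f i)"
  proof (rule sum_strict_mono)
    fix i assume "i \<in> {0..<int N}"
    with * that show "c < f i"
      by (meson not_le_imp_less)
  qed (use \<open>N > 0\<close> in auto)
  then show False
    using assms by (simp add: mean_def field_simps)
qed

section \<open>The discrete action, its gradient and descent\<close>

context lagrangian
begin

definition pt :: "nat \<Rightarrow> (int \<Rightarrow> real^2) \<Rightarrow> int \<Rightarrow> (real^2) \<times> (real^2)" where
  "pt N x i = (x i, real N *\<^sub>R (x (i + 1) - x i))"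

definition act :: "nat \<Rightarrow> (int \<Rightarrow> real^2) \<Rightarrow> real" where
  "act N x = mean N (\<lambda>i. L (pt N x i))"

text \<open>\<open>N\<close> times the gradient of \<^const>\<open>act\<close>: the defect in the discrete Euler--Lagrange equation.\<close>

definition res :: "nat \<Rightarrow> (int \<Rightarrow> real^2) \<Rightarrow> int \<Rightarrow> real^2" where
  "res N x i = Q (pt N x i) - real N *\<^sub>R (P (pt N x i) - P (pt N x (i - 1)))"

lemma act_nonneg: "act N x \<ge> 0"
  by (simp add: act_def mean_def sum_nonneg L_nonneg)

lemma pt_periodic:
  assumes "quasi_periodic N a x"
  shows "pt N x (i + int N) = (x i + a, snd (pt N x i))"
proof -
  have "x (i + int N + 1) = x (i + 1) + a"
    using assms[unfolded quasi_periodic_def, rule_format, of "i + 1"] by (simp add: add.commute add.left_commute)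
  then show ?thesis
    using assms by (simp add: pt_def quasi_periodic_def)
qed

lemma pt_translate: "pt N (\<lambda>i. x i + a) i = (x i + a, snd (pt N x i))"
  by (simp add: pt_def)

context
  fixes N :: nat and a :: "real^2" and x :: "int \<Rightarrow> real^2"
  assumes N: "N > 0" and a: "a \<in> lattice" and x: "quasi_periodic N a x"
begin

lemma LPQ_pt_periodic:
  "quasi_periodic N 0 (\<lambda>i. L (pt N x i))"
  "quasi_periodic N 0 (\<lambda>i. P (pt N x i))"
  "quasi_periodic N 0 (\<lambda>i. Q (pt N x i))"
  "quasi_periodic N 0 (\<lambda>i. snd (pt N x i))"
  by (simp_all only: quasi_periodic_def pt_periodic[OF x] periodic_lattice[OF L_periodic a]
      periodic_lattice[OF P_periodic a] periodic_lattice[OF Q_periodic a])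
     (simp_all add: pt_def)

lemma res_periodic: "quasi_periodic N 0 (res N x)"
  using LPQ_pt_periodic(2,3) quasi_periodic_shift[OF LPQ_pt_periodic(2), of "- 1"]
  by (simp add: quasi_periodic_def res_def)

text \<open>The momentum increments cancel around the loop. What remains is the gradient of the
  action under translations of the whole loop.\<close>

lemma mean_res: "mean N (res N x) = mean N (\<lambda>i. Q (pt N x i))"
proof -
  have "mean N (\<lambda>i. P (pt N x (i - 1))) = mean N (\<lambda>i. P (pt N x i))"
    using mean_shift[OF quasi_periodic_shift[OF LPQ_pt_periodic(2), of "- 1"] N] by simp
  then show ?thesis
    unfolding res_def mean_diff mean_scaleR by simp
qed

text \<open>Summation by parts: an index shift moves the difference from \<open>y\<close> to
  \<open>P\<close>, and there is no boundary term because all sequences are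
  \<open>N\<close>-periodic.\<close>

lemma first_variation:
  assumes y: "quasi_periodic N 0 y"
  shows "mean N (\<lambda>i. Q (pt N x i) \<bullet> y i + P (pt N x i) \<bullet> (real N *\<^sub>R (y (i + 1) - y i)))
       = mean N (\<lambda>i. res N x i \<bullet> y i)"
proof -
  have "quasi_periodic N 0 (\<lambda>i. P (pt N x (i - 1)) \<bullet> y i)"
    using quasi_periodic_shift[OF LPQ_pt_periodic(2), of "- 1"] y by (simp add: quasi_periodic_def)
  from mean_shift[OF this N]
  have *: "mean N (\<lambda>i. P (pt N x i) \<bullet> y (i + 1)) = mean N (\<lambda>i. P (pt N x (i - 1)) \<bullet> y i)"
    by simp
  have "mean N (\<lambda>i. Q (pt N x i) \<bullet> y i + P (pt N x i) \<bullet> (real N *\<^sub>R (y (i + 1) - y i)))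
      = mean N (\<lambda>i. Q (pt N x i) \<bullet> y i) + real N * (mean N (\<lambda>i. P (pt N x i) \<bullet> y (i + 1)) - mean N (\<lambda>i. P (pt N x i) \<bullet> y i))"
    by (simp only: mean_add inner_scaleR_right mean_mult inner_diff_right mean_diff)
  also have "\<dots> = mean N (\<lambda>i. res N x i \<bullet> y i)"
    unfolding * res_def inner_diff_left inner_scaleR_left mean_diff mean_mult by (simp add: algebra_simps)
  finally show ?thesis .
qed

end

lemma act_deriv:
  assumes "N > 0" "a \<in> lattice" "quasi_periodic N a x" "quasi_periodic N 0 y"
  shows "((\<lambda>s. act N (\<lambda>i. x i + s *\<^sub>R y i)) has_real_derivative
            mean N (\<lambda>i. res N (\<lambda>i. x i + s *\<^sub>R y i) i \<bullet> y i)) (at s)"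
proof -
  let ?x = "\<lambda>s i. x i + s *\<^sub>R y i"
  let ?v = "\<lambda>i. real N *\<^sub>R (y (i + 1) - y i)"
  have pt: "pt N (?x s) i = pt N x i + s *\<^sub>R (y i, ?v i)" for s i
    by (simp add: pt_def algebra_simps)
  have "((\<lambda>s. L (pt N (?x s) i)) has_real_derivative Q (pt N (?x s) i) \<bullet> y i + P (pt N (?x s) i) \<bullet> ?v i) (at s)" for i
  proof -
    have "((\<lambda>s. pt N (?x s) i) has_derivative (\<lambda>h. h *\<^sub>R (y i, ?v i))) (at s)"
      unfolding pt by (auto intro!: derivative_eq_intros)
    from has_derivative_compose[OF this L_deriv] show ?thesis
      by (rule has_derivative_imp_has_field_derivative) (simp add: algebra_simps)
  qed
  then have "((\<lambda>s. act N (?x s)) has_real_derivative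
      mean N (\<lambda>i. Q (pt N (?x s) i) \<bullet> y i + P (pt N (?x s) i) \<bullet> ?v i)) (at s)"
    unfolding act_def mean_def by (auto intro!: derivative_eq_intros)
  moreover have "quasi_periodic N a (?x s)"
    using assms by (simp add: quasi_periodic_def)
  ultimately show ?thesis
    using first_variation[OF assms(1,2) _ assms(4)] by simp
qed

text \<open>A single term is bounded by \<open>N\<close> times the mean, so \<open>V\<close> depends
  on \<open>N\<close>. This is enough for descent at a fixed \<open>N\<close>; bounds uniform in
  \<open>N\<close> come from the momenta in \<open>limit_solution\<close>.\<close>

lemma velocity_bound:
  assumes "N > 0"
  obtains V where "V > 0"
    "\<And>a x i. a \<in> lattice \<Longrightarrow> quasi_periodic N a x \<Longrightarrow> act N x \<le> K \<Longrightarrow> norm (snd (pt N x i)) \<le> V"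
proof -
  obtain c where c: "c > 0" "\<And>x v. c * (norm v)\<^sup>2 \<le> L (x, v)"
    using L_lower by blast
  let ?V = "sqrt (real N * \<bar>K\<bar> / c) + 1"
  show thesis
  proof (rule that[of ?V])
    fix a x i assume *: "a \<in> lattice" "quasi_periodic N a x" "act N x \<le> K"
    show "norm (snd (pt N x i)) \<le> ?V"
    proof (rule periodic_all[OF LPQ_pt_periodic(4)[OF assms *(1,2)] assms])
      fix j assume "j \<in> {0..<int N}"
      then have "L (pt N x j) \<le> real N * act N x"
        unfolding act_def by (rule mean_ge_component) (rule L_nonneg)
      also have "\<dots> \<le> real N * \<bar>K\<bar>"
        using *(3) by (intro mult_left_mono) auto
      finally have "c * (norm (snd (pt N x j)))\<^sup>2 \<le> real N * \<bar>K\<bar>"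
        using c(2)[of "snd (pt N x j)" "fst (pt N x j)"] by simp
      then have "norm (snd (pt N x j)) \<le> sqrt (real N * \<bar>K\<bar> / c)"
        using c(1) by (intro real_le_rsqrt) (simp add: field_simps)
      then show "norm (snd (pt N x j)) \<le> ?V" by simp
    qed
  qed (use c(1) in \<open>auto intro: add_nonneg_pos\<close>)
qed

lemma res_bounded:
  obtains B where "B > 0" "\<And>x i. (\<And>i. norm (snd (pt N x i)) \<le> V) \<Longrightarrow> norm (res N x i) \<le> B"
proof -
  obtain B1 where B1: "B1 > 0" "\<And>x v. v \<in> cball 0 V \<Longrightarrow> norm (P (x, v)) \<le> B1"
    by (rule periodic_bounded[OF compact_cball continuous_on_subset[OF P_cont] P_periodic, of 0 V]) auto
  obtain B2 where B2: "B2 > 0" "\<And>x v. v \<in> cball 0 V \<Longrightarrow> norm (Q (x, v)) \<le> B2"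
    by (rule periodic_bounded[OF compact_cball continuous_on_subset[OF Q_cont] Q_periodic, of 0 V]) auto
  show thesis
  proof (rule that[of "B2 + real N * (B1 + B1)"])
    fix x i assume V: "\<And>i. norm (snd (pt N x i)) \<le> V"
    have PQ: "norm (P (pt N x i)) \<le> B1" "norm (Q (pt N x i)) \<le> B2" for i
      using B1(2)[of "snd (pt N x i)" "fst (pt N x i)"] B2(2)[of "snd (pt N x i)" "fst (pt N x i)"] V by auto
    have "norm (res N x i) \<le> norm (Q (pt N x i)) + norm (real N *\<^sub>R (P (pt N x i) - P (pt N x (i - 1))))"
      unfolding res_def by (rule norm_triangle_ineq4)
    also have "\<dots> \<le> B2 + real N * (B1 + B1)"
      using PQ[of i] PQ[of "i - 1"] norm_triangle_ineq4[of "P (pt N x i)" "P (pt N x (i - 1))"]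
      by (simp add: add_mono mult_left_mono)
    finally show "norm (res N x i) \<le> B2 + real N * (B1 + B1)" .
  qed (use B1 B2 in \<open>auto intro: add_pos_nonneg\<close>)
qed

text \<open>\<open>P\<close> and \<open>Q\<close> are merely continuous, so the gradient need not be
  Lipschitz. A modulus of continuity common to all loops of bounded velocity takes the place of a
  second derivative bound in the choice of a step size.\<close>

lemma res_modulus:
  assumes "e > 0"
  obtains h where "h > 0"
    "\<And>x y i. (\<And>i. norm (snd (pt N x i)) \<le> V) \<Longrightarrow> (\<And>i. norm (y i - x i) \<le> h) \<Longrightarrow> norm (res N y i - res N x i) \<le> e"
proof -
  \<comment> \<open>\<open>res\<close> consists of one value of \<open>Q\<close> and
    \<open>N\<close> times a difference of two values of \<open>P\<close>.\<close>
  define e' where "e' = e / (2 * real N + 1)"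
  have "e' > 0"
    using assms by (simp add: e'_def)
  obtain d1 where d1: "d1 > 0"
    "\<And>x y v w. norm v \<le> V + 1 \<Longrightarrow> norm w \<le> V + 1 \<Longrightarrow> dist x y < d1 \<Longrightarrow> dist v w < d1 \<Longrightarrow> dist (P (x, v)) (P (y, w)) < e'"
    using periodic_uniformly_continuous[OF P_cont P_periodic \<open>e' > 0\<close>, of "V + 1"] by blast
  obtain d2 where d2: "d2 > 0"
    "\<And>x y v w. norm v \<le> V + 1 \<Longrightarrow> norm w \<le> V + 1 \<Longrightarrow> dist x y < d2 \<Longrightarrow> dist v w < d2 \<Longrightarrow> dist (Q (x, v)) (Q (y, w)) < e'"
    using periodic_uniformly_continuous[OF Q_cont Q_periodic \<open>e' > 0\<close>, of "V + 1"] by blast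
  define d where "d = min 1 (min d1 d2)"
  have d: "d > 0" "d \<le> 1" "d \<le> d1" "d \<le> d2" using d1 d2 by (auto simp: d_def)
  \<comment> \<open>Moving each vertex by at most \<open>h\<close> changes the difference quotients
    by up to \<open>N * (2 * h)\<close>.\<close>
  define h where "h = d / (2 * (2 * real N + 1))"
  have h: "h > 0" "h < d" "real N * (2 * h) < d"
    using d by (auto simp: h_def field_simps intro: add_pos_nonneg)
  show thesis
  proof (rule that[OF h(1)])
    fix x y i assume V: "\<And>i. norm (snd (pt N x i)) \<le> V" and xy: "\<And>i. norm (y i - x i) \<le> h"
    have 1: "dist (y j) (x j) < d" for j
      using xy[of j] h by (simp add: dist_norm)
    have 2: "dist (snd (pt N y j)) (snd (pt N x j)) < d" for j
    proof -
      have "snd (pt N y j) - snd (pt N x j) = real N *\<^sub>R ((y (j + 1) - x (j + 1)) - (y j - x j))"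
        by (simp add: pt_def algebra_simps)
      then have "dist (snd (pt N y j)) (snd (pt N x j)) = real N * norm ((y (j + 1) - x (j + 1)) - (y j - x j))"
        by (simp add: dist_norm)
      also have "\<dots> \<le> real N * (2 * h)"
        using xy[of j] xy[of "j + 1"] norm_triangle_ineq4[of "y (j + 1) - x (j + 1)" "y j - x j"]
        by (intro mult_left_mono) auto
      finally show ?thesis using h by simp
    qed
    have 3: "norm (snd (pt N y j)) \<le> V + 1" for j
      using 2[of j] V[of j] d norm_triangle_ineq2[of "snd (pt N y j)" "snd (pt N x j)"] by (simp add: dist_norm)
    have V': "norm (snd (pt N x j)) \<le> V + 1" for j
      using V[of j] by simp
    have pt: "pt N u j = (u j, snd (pt N u j))" for u j
      by (simp add: pt_def)
    have P: "norm (P (pt N y j) - P (pt N x j)) \<le> e'" for j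
      using d1(2)[OF 3 V', of "y j" "x j" j j] 1[of j] 2[of j] d pt[of x j] pt[of y j] by (simp add: dist_norm)
    have Q: "norm (Q (pt N y j) - Q (pt N x j)) \<le> e'" for j
      using d2(2)[OF 3 V', of "y j" "x j" j j] 1[of j] 2[of j] d pt[of x j] pt[of y j] by (simp add: dist_norm)
    let ?p = "P (pt N y i) - P (pt N x i) - (P (pt N y (i - 1)) - P (pt N x (i - 1)))"
    have "norm (res N y i - res N x i) = norm ((Q (pt N y i) - Q (pt N x i)) - real N *\<^sub>R ?p)"
      by (simp add: res_def algebra_simps)
    also have "\<dots> \<le> norm (Q (pt N y i) - Q (pt N x i)) + real N * norm ?p"
      using norm_triangle_ineq4 by (metis norm_scaleR abs_of_nat)
    also have "\<dots> \<le> e' + real N * (e' + e')"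
      using P[of i] P[of "i - 1"] Q[of i] norm_triangle_ineq4[of "P (pt N y i) - P (pt N x i)" "P (pt N y (i - 1)) - P (pt N x (i - 1))"]
      by (intro add_mono mult_left_mono) auto
    also have "\<dots> = (2 * real N + 1) * e'"
      by (simp add: algebra_simps)
    also have "\<dots> = e"
      by (simp add: e'_def add_pos_nonneg)
    finally show "norm (res N y i - res N x i) \<le> e" .
  qed
qed

text \<open>One step of (possibly projected) gradient descent with uniform step size. As the step size does
  not depend on \<open>x\<close>, it can be applied to a whole path of loops at once.\<close>

definition descent_step :: "nat \<Rightarrow> real^2 \<Rightarrow> real \<Rightarrow> real \<Rightarrow> real \<Rightarrow> real \<Rightarrow> bool" where
  "descent_step N a K \<delta> \<tau> \<kappa> \<longleftrightarrow>
     (\<forall>x d. quasi_periodic N a x \<and> act N x \<le> K \<and> quasi_periodic N 0 d \<and>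
        mean N (\<lambda>i. res N x i \<bullet> d i) = mean N (\<lambda>i. d i \<bullet> d i) \<and>
        (\<forall>B. (\<forall>i. norm (res N x i) \<le> B) \<longrightarrow> (\<forall>i. norm (d i) \<le> 2 * B)) \<longrightarrow>
        act N (\<lambda>i. x i - \<tau> *\<^sub>R d i) \<le> act N x + \<delta> \<and>
        (act N (\<lambda>i. x i - \<tau> *\<^sub>R d i) > act N x - \<kappa> \<longrightarrow> (\<forall>i. norm (d i) < \<delta>)))"

lemma descent_stepD:
  assumes "descent_step N a K \<delta> \<tau> \<kappa>" "quasi_periodic N a x" "act N x \<le> K" "quasi_periodic N 0 d"
    "mean N (\<lambda>i. res N x i \<bullet> d i) = mean N (\<lambda>i. d i \<bullet> d i)"
    "\<And>B i. (\<And>i. norm (res N x i) \<le> B) \<Longrightarrow> norm (d i) \<le> 2 * B"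
  shows "act N (\<lambda>i. x i - \<tau> *\<^sub>R d i) \<le> act N x + \<delta>"
    and "act N (\<lambda>i. x i - \<tau> *\<^sub>R d i) > act N x - \<kappa> \<Longrightarrow> norm (d i) < \<delta>"
  using assms(1)[unfolded descent_step_def, rule_format, of x d] assms(2-) by auto

text \<open>In the applications \<open>d\<close> is the gradient or its projection to sequences of
  mean 0; the factor 2 in its bound leaves room for subtracting the mean. By the mean value theorem
  the step lowers the action by about \<open>\<tau>\<close> times the mean of
  \<open>d i \<bullet> d i\<close>. If the drop is below \<open>\<kappa>\<close>, that mean is below
  \<open>\<delta>\<^sup>2 / N\<close>, hence each single term is below
  \<open>\<delta>\<^sup>2\<close>.\<close>

lemma descent:
  assumes N: "N > 0" and a: "a \<in> lattice" and "\<delta> > 0"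
  obtains \<tau> \<kappa> where "\<tau> > 0" "0 < \<kappa>" "\<kappa> \<le> \<delta>" "descent_step N a K \<delta> \<tau> \<kappa>"
proof -
  obtain V where V: "V > 0"
    "\<And>x i. quasi_periodic N a x \<Longrightarrow> act N x \<le> K \<Longrightarrow> norm (snd (pt N x i)) \<le> V"
    using velocity_bound[OF N] a by metis
  obtain B where B: "B > 0" "\<And>x i. (\<And>i. norm (snd (pt N x i)) \<le> V) \<Longrightarrow> norm (res N x i) \<le> B"
    using res_bounded by blast
  \<comment> \<open>As \<open>norm (d i) \<le> 2 * B\<close>, a gradient error of
    \<open>\<omega>\<close> costs at most \<open>\<delta>\<^sup>2 / (2 * N)\<close>, half of the
    allowed mean.\<close>
  define \<omega> where "\<omega> = \<delta>\<^sup>2 / (2 * real N) / (2 * B)"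
  have "\<omega> > 0" using N B \<open>\<delta> > 0\<close> by (simp add: \<omega>_def)
  obtain h where h: "h > 0"
    "\<And>x y i. (\<And>i. norm (snd (pt N x i)) \<le> V) \<Longrightarrow> (\<And>i. norm (y i - x i) \<le> h) \<Longrightarrow> norm (res N y i - res N x i) \<le> \<omega>"
    using res_modulus[OF \<open>\<omega> > 0\<close>] by blast
  \<comment> \<open>The first bound keeps the displacement \<open>\<tau> * norm (d i)\<close> within
    \<open>h\<close>, the second keeps a possible increase of the action within
    \<open>\<delta>\<close>.\<close>
  define \<tau> where "\<tau> = min (h / (2 * B)) (2 * real N / \<delta>)"
  define \<kappa> where "\<kappa> = min \<delta> (\<tau> * (\<delta>\<^sup>2 / (2 * real N)))"
  have \<tau>: "\<tau> > 0" using h B N \<open>\<delta> > 0\<close> by (simp add: \<tau>_def)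
  have \<tau>_le: "\<tau> * (2 * B) \<le> h" "\<tau> * (\<delta>\<^sup>2 / (2 * real N)) \<le> \<delta>"
  proof -
    have "\<tau> * (2 * B) \<le> h / (2 * B) * (2 * B)"
      using B by (intro mult_right_mono) (auto simp: \<tau>_def)
    then show "\<tau> * (2 * B) \<le> h" using B by simp
    have "\<tau> * (\<delta>\<^sup>2 / (2 * real N)) \<le> 2 * real N / \<delta> * (\<delta>\<^sup>2 / (2 * real N))"
      by (intro mult_right_mono) (auto simp: \<tau>_def)
    then show "\<tau> * (\<delta>\<^sup>2 / (2 * real N)) \<le> \<delta>" using N \<open>\<delta> > 0\<close> by (simp add: power2_eq_square)
  qed
  have main: "act N (\<lambda>i. x i - \<tau> *\<^sub>R d i) \<le> act N x + \<delta> \<and>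
      (act N (\<lambda>i. x i - \<tau> *\<^sub>R d i) > act N x - \<kappa> \<longrightarrow> norm (d i) < \<delta>)"
    if x: "quasi_periodic N a x" "act N x \<le> K" and d: "quasi_periodic N 0 d"
      and eq: "mean N (\<lambda>i. res N x i \<bullet> d i) = mean N (\<lambda>i. d i \<bullet> d i)"
      and dB: "\<And>B i. (\<And>i. norm (res N x i) \<le> B) \<Longrightarrow> norm (d i) \<le> 2 * B"
    for x d i
  proof -
    have d_le: "norm (d i) \<le> 2 * B" for i
      by (intro dB B(2) V(2) x)
    let ?x = "\<lambda>s i. x i + s *\<^sub>R d i"
    have "\<exists>s>- \<tau>. s < 0 \<and> act N (?x 0) - act N (?x (- \<tau>)) = (0 - (- \<tau>)) * mean N (\<lambda>i. res N (?x s) i \<bullet> d i)"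
      using \<tau> act_deriv[OF N a x(1) d] by (intro MVT2) auto
    then obtain s where s: "- \<tau> < s" "s < 0"
      "act N (?x 0) - act N (?x (- \<tau>)) = \<tau> * mean N (\<lambda>i. res N (?x s) i \<bullet> d i)"
      by auto
    have "norm (?x s i - x i) \<le> h" for i
    proof -
      have "norm (?x s i - x i) = \<bar>s\<bar> * norm (d i)" by simp
      also have "\<dots> \<le> \<tau> * (2 * B)" using s d_le[of i] by (intro mult_mono) auto
      finally show ?thesis using \<tau>_le by simp
    qed
    then have "norm (res N (?x s) i - res N x i) \<le> \<omega>" for i
      using V(2)[OF x] by (intro h(2)) auto
    then have "(res N x i - res N (?x s) i) \<bullet> d i \<le> \<omega> * (2 * B)" for i
      using d_le[of i] norm_cauchy_schwarz[of "res N x i - res N (?x s) i" "d i"] \<open>\<omega> > 0\<close>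
      by (smt (verit) mult_mono norm_ge_zero norm_minus_commute)
    then have "mean N (\<lambda>i. (res N x i - res N (?x s) i) \<bullet> d i) \<le> mean N (\<lambda>i. \<omega> * (2 * B))"
      by (intro mean_mono)
    then have *: "mean N (\<lambda>i. d i \<bullet> d i) - \<delta>\<^sup>2 / (2 * real N) \<le> mean N (\<lambda>i. res N (?x s) i \<bullet> d i)"
      using N B by (simp add: inner_diff_left mean_diff eq mean_const \<omega>_def)
    have "0 \<le> mean N (\<lambda>i. d i \<bullet> d i)"
      by (simp add: mean_def sum_nonneg)
    with * have "\<tau> * - (\<delta>\<^sup>2 / (2 * real N)) \<le> \<tau> * mean N (\<lambda>i. res N (?x s) i \<bullet> d i)"
      using \<tau> by (intro mult_left_mono) auto
    with \<tau>_le(2) have "act N (\<lambda>i. x i - \<tau> *\<^sub>R d i) \<le> act N x + \<delta>"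
      using s(3) by simp
    moreover have "norm (d i) < \<delta>" if gt: "act N (\<lambda>i. x i - \<tau> *\<^sub>R d i) > act N x - \<kappa>"
    proof -
      have "\<tau> * mean N (\<lambda>i. res N (?x s) i \<bullet> d i) < \<tau> * (\<delta>\<^sup>2 / (2 * real N))"
        using gt s(3) by (simp add: \<kappa>_def)
      then have "mean N (\<lambda>i. res N (?x s) i \<bullet> d i) < \<delta>\<^sup>2 / (2 * real N)"
        using mult_left_less_imp_less[OF _ less_imp_le[OF \<tau>]] by blast
      with * have "mean N (\<lambda>i. d i \<bullet> d i) < \<delta>\<^sup>2 / (2 * real N) + \<delta>\<^sup>2 / (2 * real N)"
        by linarith
      then have "mean N (\<lambda>i. d i \<bullet> d i) < \<delta>\<^sup>2 / real N"
        by simp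
      then have lt: "real N * mean N (\<lambda>i. d i \<bullet> d i) < \<delta>\<^sup>2"
        using N by (simp add: field_simps)
      show "norm (d i) < \<delta>"
      proof (rule periodic_all[OF d N])
        fix j assume "j \<in> {0..<int N}"
        then have "d j \<bullet> d j \<le> real N * mean N (\<lambda>i. d i \<bullet> d i)"
          by (rule mean_ge_component) simp
        with lt have "(norm (d j))\<^sup>2 < \<delta>\<^sup>2"
          by (simp add: power2_norm_eq_inner)
        then show "norm (d j) < \<delta>"
          using \<open>\<delta> > 0\<close> by (intro power2_less_imp_less[of "norm (d j)" \<delta>]) auto
      qed
    qed
    ultimately show ?thesis by blast
  qed
  show thesis
  proof (rule that[of \<tau> \<kappa>])
    show "descent_step N a K \<delta> \<tau> \<kappa>"
      unfolding descent_step_def by (intro allI impI) (use main in blast)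
  qed (use \<tau> \<open>\<delta> > 0\<close> N in \<open>auto simp: \<kappa>_def\<close>)
qed

end

section \<open>Almost critical loops\<close>

definition straight :: "nat \<Rightarrow> 'a::real_vector \<Rightarrow> int \<Rightarrow> 'a" where
  "straight N a i = (of_int i / real N) *\<^sub>R a"

lemma quasi_periodic_straight: "N > 0 \<Longrightarrow> quasi_periodic N a (straight N a)"
  by (simp add: quasi_periodic_def straight_def add_divide_distrib scaleR_add_left)

lemma quasi_periodic_translate: "quasi_periodic N a x \<Longrightarrow> quasi_periodic N a (\<lambda>i. x i + c)"
  by (simp add: quasi_periodic_def)

text \<open>For a lattice vector \<open>e\<close> both ends project to the same loop on the torus,
  so this is a closed curve in the space of loops on the torus.\<close>

definition loop_path :: "nat \<Rightarrow> real^2 \<Rightarrow> real^2 \<Rightarrow> (real \<Rightarrow> int \<Rightarrow> real^2) \<Rightarrow> bool" where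
  "loop_path N a e X \<longleftrightarrow> (\<forall>i. continuous_on {0..1} (\<lambda>t. X t i)) \<and>
     (\<forall>t\<in>{0..1}. quasi_periodic N a (X t)) \<and> (\<forall>i. X 1 i = X 0 i + e)"

lemma continuous_on_mean:
  "(\<And>i. continuous_on S (\<lambda>t. f t i)) \<Longrightarrow> continuous_on S (\<lambda>t. mean N (f t) :: 'b::real_normed_vector)"
  unfolding mean_def by (intro continuous_intros)

text \<open>The mean in the direction \<open>l\<close> moves continuously by at least 1 along the
  path, so it meets every class modulo \<int>.\<close>

lemma loop_path_mean:
  assumes X: "loop_path N a e X" and N: "N > 0" and e: "\<bar>e \<bullet> l\<bar> \<ge> 1"
  obtains t where "t \<in> {0..1}" "mean N (X t) \<bullet> l - \<theta> \<in> \<int>"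
proof -
  let ?f = "\<lambda>t. mean N (X t) \<bullet> l"
  have cont: "continuous_on {0..1} ?f"
    using X by (auto simp: loop_path_def intro!: continuous_intros continuous_on_mean)
  have "mean N (X 1) = mean N (\<lambda>i. X 0 i + e)"
    using X by (intro mean_cong) (simp add: loop_path_def)
  then have f1: "?f 1 = ?f 0 + e \<bullet> l"
    using N by (simp add: mean_add mean_const inner_add_left)
  define m where "m = min (?f 0) (?f 1)"
  \<comment> \<open>The first number congruent to \<open>\<theta>\<close> from the lower end value
    on; it is passed because the end values differ by at least 1.\<close>
  define c where "c = \<theta> + real_of_int \<lceil>m - \<theta>\<rceil>"
  have c: "m \<le> c" "c \<le> max (?f 0) (?f 1)"
    unfolding c_def m_def using e f1 by linarith+
  have "\<exists>t. 0 \<le> t \<and> t \<le> 1 \<and> ?f t = c"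
  proof (cases "?f 0 \<le> ?f 1")
    case True
    then show ?thesis using c cont by (intro IVT') (auto simp: m_def)
  next
    case False
    then show ?thesis using c cont by (intro IVT2') (auto simp: m_def)
  qed
  then obtain t where "t \<in> {0..1}" "?f t = c" by auto
  then show thesis
    using that[of t] by (simp add: c_def)
qed

section \<open>Minimal action, minimax value and almost critical loops\<close>

context lagrangian
begin

definition min_act :: "nat \<Rightarrow> real^2 \<Rightarrow> real" where
  "min_act N a = Inf (act N ` {x. quasi_periodic N a x})"

text \<open>Collecting upper bounds, instead of taking a maximum along each path, turns the minimax
  into a single infimum.\<close>

definition path_levels :: "nat \<Rightarrow> real^2 \<Rightarrow> real^2 \<Rightarrow> real set" where
  "path_levels N a e = {c. \<exists>X. loop_path N a e X \<and> (\<forall>t\<in>{0..1}. act N (X t) \<le> c)}"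

definition minimax :: "nat \<Rightarrow> real^2 \<Rightarrow> real^2 \<Rightarrow> real" where
  "minimax N a e = Inf (path_levels N a e)"

lemma min_act_le: "quasi_periodic N a x \<Longrightarrow> min_act N a \<le> act N x"
  unfolding min_act_def by (intro cInf_lower bdd_belowI[of _ 0]) (auto simp: act_nonneg)

lemma path_levels_nonneg: "c \<in> path_levels N a e \<Longrightarrow> c \<ge> 0"
  using act_nonneg by (auto simp: path_levels_def dest!: bspec[of _ _ 0] intro: order_trans)

lemma minimax_le: "c \<in> path_levels N a e \<Longrightarrow> minimax N a e \<le> c"
  unfolding minimax_def by (intro cInf_lower bdd_belowI[of _ 0]) (auto simp: path_levels_nonneg)

text \<open>Translates of the straight loop have velocity \<open>a\<close> at each vertex, which
  gives a level independent of \<open>N\<close>; this later bounds all actions in use. The summand 1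
  in the witness only makes \<open>C\<close> positive.\<close>

lemma path_levels_upper:
  obtains C where "C > 0" "\<And>N. N > 0 \<Longrightarrow> C \<in> path_levels N a e"
proof -
  obtain C where C: "C > 0" "\<And>x v. L (x, v) \<le> C * (norm v)\<^sup>2"
    using L_upper by blast
  show thesis
  proof (rule that[of "C * (norm a)\<^sup>2 + 1"])
    fix N :: nat assume N: "N > 0"
    let ?X = "\<lambda>t i. straight N a i + t *\<^sub>R e"
    have "loop_path N a e ?X"
      using quasi_periodic_straight[OF N, of a]
      by (auto simp: loop_path_def quasi_periodic_translate intro!: continuous_intros)
    moreover have "act N (?X t) \<le> C * (norm a)\<^sup>2 + 1" for t
    proof -
      have "snd (pt N (?X t) i) = a" for i
        using N by (simp add: pt_def straight_def add_divide_distrib flip: scaleR_diff_left)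
      then have "L (pt N (?X t) i) \<le> C * (norm a)\<^sup>2" for i
        using C(2) by (metis prod.collapse)
      then have "act N (?X t) \<le> mean N (\<lambda>i. C * (norm a)\<^sup>2)"
        unfolding act_def by (intro mean_mono)
      then show ?thesis using N by (simp add: mean_const)
    qed
    ultimately show "C * (norm a)\<^sup>2 + 1 \<in> path_levels N a e"
      by (auto simp: path_levels_def)
  qed (use C in \<open>auto intro: add_nonneg_pos\<close>)
qed

lemma min_act_le_minimax:
  assumes "N > 0" shows "min_act N a \<le> minimax N a e"
  unfolding minimax_def
proof (rule cInf_greatest)
  show "path_levels N a e \<noteq> {}"
    using path_levels_upper[of a e] assms by blast
  fix c assume "c \<in> path_levels N a e"
  then obtain X where "loop_path N a e X" "\<forall>t\<in>{0..1}. act N (X t) \<le> c"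
    by (auto simp: path_levels_def)
  then show "min_act N a \<le> c"
    using min_act_le[of N a "X 0"] by (auto simp: loop_path_def dest!: bspec[of _ _ 0])
qed

text \<open>A loop within \<open>\<kappa>\<close> of the infimum cannot drop by
  \<open>\<kappa>\<close>, so by the descent step its gradient is already small.\<close>

lemma near_minimiser:
  assumes N: "N > 0" and a: "a \<in> lattice" and \<delta>: "\<delta> > 0"
  obtains x where "quasi_periodic N a x" "act N x \<le> min_act N a + \<delta>" "\<And>i. norm (res N x i) < \<delta>"
proof -
  obtain \<tau> \<kappa> where \<tau>\<kappa>: "\<tau> > 0" "0 < \<kappa>" "\<kappa> \<le> \<delta>"
    and step: "descent_step N a (min_act N a + \<delta>) \<delta> \<tau> \<kappa>"
    using descent[OF N a \<delta>, of "min_act N a + \<delta>"] by blast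
  have "\<exists>c\<in>act N ` {x. quasi_periodic N a x}. c < min_act N a + \<kappa>"
    using quasi_periodic_straight[OF N, of a] \<tau>\<kappa>(2) unfolding min_act_def
    by (intro cInf_lessD) auto
  then obtain x where x: "quasi_periodic N a x" "act N x < min_act N a + \<kappa>" by auto
  show thesis
  proof (rule that[OF x(1)])
    show "act N x \<le> min_act N a + \<delta>" using x \<tau>\<kappa> by simp
    fix i show "norm (res N x i) < \<delta>"
    proof (rule descent_stepD(2)[OF step x(1)])
      show per: "quasi_periodic N 0 (res N x)" by (rule res_periodic[OF N a x(1)])
      then have "quasi_periodic N a (\<lambda>i. x i - \<tau> *\<^sub>R res N x i)"
        using x(1) by (simp add: quasi_periodic_def)
      from min_act_le[OF this] show "act N (\<lambda>i. x i - \<tau> *\<^sub>R res N x i) > act N x - \<kappa>"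
        using x(2) by simp
      show "norm (res N x i) \<le> 2 * B" if "\<And>i. norm (res N x i) \<le> B" for B i
        using that[of i] norm_ge_zero[of "res N x i"] by linarith
    qed (use x \<tau>\<kappa> in auto)
  qed
qed

text \<open>Descent along the gradient minus its mean preserves the mean position. The part of the
  gradient left uncontrolled is its mean, the Lagrange multiplier, which
  \<open>multiplier_bound\<close> treats.\<close>

lemma near_constrained_minimiser:
  assumes N: "N > 0" and a: "a \<in> lattice" and \<delta>: "\<delta> > 0" and y: "quasi_periodic N a y"
  obtains x where "quasi_periodic N a x" "mean N x = mean N y" "act N x \<le> act N y + \<delta>"
    "\<And>i. norm (res N x i - mean N (res N x)) < \<delta>"
proof -
  define A where "A = act N ` {x. quasi_periodic N a x \<and> mean N x = mean N y}"
  define m where "m = Inf A"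
  have A: "A \<noteq> {}" "bdd_below A" "m \<le> act N y"
    using y by (auto simp: A_def m_def act_nonneg intro!: cInf_lower bdd_belowI[of _ 0])
  obtain \<tau> \<kappa> where \<tau>\<kappa>: "\<tau> > 0" "0 < \<kappa>" "\<kappa> \<le> \<delta>"
    and step: "descent_step N a (m + \<delta>) \<delta> \<tau> \<kappa>"
    using descent[OF N a \<delta>, of "m + \<delta>"] by blast
  have "\<exists>c\<in>A. c < m + \<kappa>"
    using A \<tau>\<kappa>(2) unfolding m_def by (intro cInf_lessD) auto
  then obtain x where x: "quasi_periodic N a x" "mean N x = mean N y" "act N x < m + \<kappa>"
    by (auto simp: A_def)
  show thesis
  proof (rule that[OF x(1,2)])
    show "act N x \<le> act N y + \<delta>" using x A \<tau>\<kappa> by simp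
    fix i
    let ?d = "\<lambda>i. res N x i - mean N (res N x)"
    have md: "mean N ?d = 0"
      using N by (simp add: mean_diff mean_const)
    show "norm (?d i) < \<delta>"
    proof (rule descent_stepD(2)[OF step x(1)])
      show per: "quasi_periodic N 0 ?d"
        using res_periodic[OF N a x(1)] by (simp add: quasi_periodic_def)
      have "quasi_periodic N a (\<lambda>i. x i - \<tau> *\<^sub>R ?d i)"
        using x(1) per by (simp add: quasi_periodic_def)
      moreover have "mean N (\<lambda>i. x i - \<tau> *\<^sub>R ?d i) = mean N y"
        unfolding mean_diff[of N x] mean_scaleR md using x(2) by simp
      ultimately have "act N (\<lambda>i. x i - \<tau> *\<^sub>R ?d i) \<in> A"
        by (auto simp: A_def)
      then have "m \<le> act N (\<lambda>i. x i - \<tau> *\<^sub>R ?d i)"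
        using A(2) unfolding m_def by (rule cInf_lower)
      then show "act N (\<lambda>i. x i - \<tau> *\<^sub>R ?d i) > act N x - \<kappa>"
        using x(3) by simp
      \<comment> \<open>Subtracting the mean is an orthogonal projection: the removed constant is
        orthogonal to \<open>?d\<close>, which has mean 0.\<close>
      have "mean N (\<lambda>i. (res N x i - ?d i) \<bullet> ?d i) = mean N (\<lambda>i. ?d i \<bullet> mean N (res N x))"
        by (simp add: inner_commute)
      also have "\<dots> = 0"
        by (simp only: mean_inner md inner_zero_left)
      finally show "mean N (\<lambda>i. res N x i \<bullet> ?d i) = mean N (\<lambda>i. ?d i \<bullet> ?d i)"
        by (simp only: inner_diff_left[of _ _ "?d _"] mean_diff)
      show "norm (?d i) \<le> 2 * B" if B: "\<And>i. norm (res N x i) \<le> B" for B i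
      proof -
        have "norm (mean N (res N x)) \<le> mean N (\<lambda>i. norm (res N x i))"
          by (rule norm_mean_le)
        also have "\<dots> \<le> mean N (\<lambda>i. B)" by (intro mean_mono B)
        finally show ?thesis
          using B[of i] N norm_triangle_ineq4[of "res N x i" "mean N (res N x)"] by (simp add: mean_const)
      qed
    qed (use x \<tau>\<kappa> in auto)
  qed
qed

text \<open>All loops of an almost optimal path are moved by one gradient step. The new path cannot
  lie below the infimum, so at some time the step fails to lower the action by
  \<open>\<kappa>\<close>, and the loop at that time has a small gradient.\<close>

lemma near_minimax:
  assumes N: "N > 0" and a: "a \<in> lattice" and e: "e \<in> lattice" and \<delta>: "\<delta> > 0"
  obtains x where "quasi_periodic N a x" "\<bar>act N x - minimax N a e\<bar> \<le> \<delta>" "\<And>i. norm (res N x i) < \<delta>"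
proof -
  define M where "M = minimax N a e"
  obtain \<tau> \<kappa> where \<tau>\<kappa>: "\<tau> > 0" "0 < \<kappa>" "\<kappa> \<le> \<delta> / 2"
    and step: "descent_step N a (M + \<delta>) (\<delta> / 2) \<tau> \<kappa>"
    using descent[OF N a half_gt_zero[OF \<delta>], of "M + \<delta>"] by blast
  obtain C where "C \<in> path_levels N a e"
    using path_levels_upper[of a e] N by blast
  then have "\<exists>c\<in>path_levels N a e. c < M + \<kappa> / 2"
    using \<tau>\<kappa>(2) unfolding M_def minimax_def by (intro cInf_lessD) auto
  then obtain X c where X: "loop_path N a e X" and c: "\<And>t. t \<in> {0..1} \<Longrightarrow> act N (X t) \<le> c" "c < M + \<kappa> / 2"
    unfolding path_levels_def by blast
  have qp: "quasi_periodic N a (X t)" if "t \<in> {0..1}" for t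
    using X that by (simp add: loop_path_def)
  have pt_cont: "continuous_on {0..1} (\<lambda>t. pt N (X t) i)" for i
    using X unfolding pt_def loop_path_def by (auto intro!: continuous_intros)
  \<comment> \<open>A step size common to all \<open>t\<close> keeps the path continuous, and
    invariance of the gradient under lattice translations keeps the displacement \<open>e\<close> of
    the ends.\<close>
  define Y where "Y t i = X t i - \<tau> *\<^sub>R res N (X t) i" for t i
  have res_per: "quasi_periodic N 0 (res N (X t))" if "t \<in> {0..1}" for t
    by (rule res_periodic[OF N a qp[OF that]])
  have Y: "loop_path N a e Y"
    unfolding loop_path_def
  proof safe
    fix i
    have "continuous_on {0..1} (\<lambda>t. P (pt N (X t) i))" "continuous_on {0..1} (\<lambda>t. Q (pt N (X t) i))" for i
      by (auto intro!: continuous_on_compose2[OF P_cont] continuous_on_compose2[OF Q_cont] pt_cont)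
    then show "continuous_on {0..1} (\<lambda>t. Y t i)"
      using X unfolding Y_def res_def loop_path_def by (auto intro!: continuous_intros)
    have X1: "X 1 = (\<lambda>i. X 0 i + e)"
      using X by (auto simp: loop_path_def)
    have "pt N (X 1) j = (X 0 j + e, snd (pt N (X 0) j))" for j
      unfolding X1 by (rule pt_translate)
    then have "P (pt N (X 1) j) = P (pt N (X 0) j)" "Q (pt N (X 1) j) = Q (pt N (X 0) j)" for j
      using periodic_lattice[OF P_periodic e] periodic_lattice[OF Q_periodic e] by (simp_all add: pt_def)
    then have "res N (X 1) i = res N (X 0) i"
      by (simp add: res_def)
    then show "Y 1 i = Y 0 i + e"
      by (simp add: Y_def X1)
  next
    fix t :: real assume "t \<in> {0..1}"
    then show "quasi_periodic N a (Y t)"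
      using qp[of t] res_per[of t] by (simp add: Y_def quasi_periodic_def)
  qed
  have "M - \<kappa> / 2 \<notin> path_levels N a e"
    using minimax_le[of "M - \<kappa> / 2" N a e] \<tau>\<kappa> by (auto simp: M_def)
  then obtain t where t: "t \<in> {0..1}" "act N (Y t) > M - \<kappa> / 2"
    using Y by (auto simp: path_levels_def not_le)
  have le: "act N (X t) \<le> M + \<delta>"
    using c(1)[OF t(1)] c(2) \<tau>\<kappa> by simp
  have two: "norm (res N (X t) i) \<le> 2 * B" if "\<And>i. norm (res N (X t) i) \<le> B" for B i
    using that[of i] norm_ge_zero[of "res N (X t) i"] by linarith
  have Yt: "Y t = (\<lambda>i. X t i - \<tau> *\<^sub>R res N (X t) i)"
    by (simp add: Y_def fun_eq_iff)
  \<comment> \<open>The bounded increase serves the lower estimate: \<open>X t\<close> cannot lie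
    far below \<open>Y t\<close>, whose action exceeds \<open>M - \<kappa> / 2\<close>.\<close>
  have "act N (Y t) \<le> act N (X t) + \<delta> / 2"
    unfolding Yt using two by (intro descent_stepD(1)[OF step qp[OF t(1)] le res_per[OF t(1)]]) auto
  then have "\<bar>act N (X t) - minimax N a e\<bar> \<le> \<delta>"
    using t(2) le \<tau>\<kappa> by (simp add: M_def abs_le_iff)
  moreover have "norm (res N (X t) i) < \<delta> / 2" for i
  proof (rule descent_stepD(2)[OF step qp[OF t(1)] le res_per[OF t(1)] _ two])
    show "act N (X t) - \<kappa> < act N (\<lambda>i. X t i - \<tau> *\<^sub>R res N (X t) i)"
      using c(1)[OF t(1)] c(2) t(2) by (simp add: Yt)
  qed auto
  then have "norm (res N (X t) i) < \<delta>" for i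
    using \<delta> by (smt (verit) field_sum_of_halves)
  ultimately show thesis
    using that qp[OF t(1)] by blast
qed

text \<open>The mean of \<^const>\<open>res\<close> is the Lagrange multiplier of the constraint on the mean position. It is small
  for almost minimisers, because translations cannot lower the action below its minimum.\<close>

lemma multiplier_bound:
  assumes "e > 0"
  obtains d where "d > 0"
    "\<And>N a x. N > 0 \<Longrightarrow> a \<in> lattice \<Longrightarrow> quasi_periodic N a x \<Longrightarrow> act N x \<le> K \<Longrightarrow>
       act N x \<le> min_act N a + d \<Longrightarrow> norm (mean N (res N x)) \<le> e"
proof -
  obtain c where c: "c > 0" "\<And>x v. c * (norm v)\<^sup>2 \<le> L (x, v)"
    using L_lower by blast
  \<comment> \<open>The mean of the squared velocities is at most \<open>\<bar>K\<bar> / c\<close>,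
    so this choice makes the averaged error of \<open>Q\<close> at most \<open>e / 2\<close>. The
    summand 1 avoids a division by 0.\<close>
  define e1 where "e1 = e / (2 * (\<bar>K\<bar> / c + 1))"
  have pos: "\<bar>K\<bar> / c + 1 > 0"
    using c(1) by (intro add_nonneg_pos) auto
  then have "e1 > 0" using assms by (simp add: e1_def)
  obtain h where h: "h > 0" "\<And>x a v. norm a < h \<Longrightarrow> norm (Q (x + a, v) - Q (x, v)) \<le> e1 * (norm v)\<^sup>2"
    using Q_modulus[OF \<open>e1 > 0\<close>] by blast
  define s where "s = h / 2"
  have s: "s > 0" "s < h" using h(1) by (auto simp: s_def)
  show thesis
  proof (rule that[of "s * (e / 2)"])
    fix N :: nat and a x
    assume N: "N > 0" and a: "a \<in> lattice" and x: "quasi_periodic N a x"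
      and K: "act N x \<le> K" and m: "act N x \<le> min_act N a + s * (e / 2)"
    define u where "u = mean N (res N x)"
    show "norm (mean N (res N x)) \<le> e"
    proof (cases "u = 0")
      case True
      then show ?thesis using assms by (simp add: u_def)
    next
      case False
      \<comment> \<open>Translating against the multiplier \<open>u\<close> lowers the action at a
        rate of about \<open>norm u\<close>, for which an almost minimiser leaves no room.\<close>
      define w where "w = - (u /\<^sub>R norm u)"
      have w: "norm w = 1" "u \<bullet> w = - norm u"
        using False by (simp_all add: w_def dot_square_norm power2_eq_square)
      let ?x = "\<lambda>s i. x i + s *\<^sub>R w"
      have w_per: "quasi_periodic N 0 (\<lambda>i. w)" by (simp add: quasi_periodic_def)
      have "\<exists>r>0. r < s \<and> act N (?x s) - act N (?x 0) = (s - 0) * mean N (\<lambda>i. res N (?x r) i \<bullet> w)"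
        using s act_deriv[OF N a x w_per] by (intro MVT2) auto
      then obtain r where r: "0 < r" "r < s"
          "act N (?x s) - act N (?x 0) = s * (mean N (res N (?x r)) \<bullet> w)"
        by (auto simp: mean_inner)
      have pt: "pt N (?x r) i = (x i + r *\<^sub>R w, snd (pt N x i))" "pt N x i = (x i, snd (pt N x i))" for i
        by (simp_all add: pt_def)
      have "norm (Q (pt N (?x r) i) - Q (pt N x i)) \<le> e1 * (norm (snd (pt N x i)))\<^sup>2" for i
        using h(2)[of "r *\<^sub>R w" "x i" "snd (pt N x i)"] r s w(1) pt[of i] by simp
      moreover have "(norm (snd (pt N x i)))\<^sup>2 \<le> L (pt N x i) / c" for i
        using c(2)[of "snd (pt N x i)" "x i"] c(1) pt(2)[of i] by (simp add: field_simps)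
      ultimately have le: "norm (Q (pt N (?x r) i) - Q (pt N x i)) \<le> (e1 / c) * L (pt N x i)" for i
        using \<open>e1 > 0\<close> by (smt (verit) mult_left_mono times_divide_eq_left times_divide_eq_right)
      have "norm (mean N (\<lambda>i. Q (pt N (?x r) i) - Q (pt N x i))) \<le> mean N (\<lambda>i. norm (Q (pt N (?x r) i) - Q (pt N x i)))"
        by (rule norm_mean_le)
      also have "\<dots> \<le> mean N (\<lambda>i. (e1 / c) * L (pt N x i))"
        by (intro mean_mono le)
      also have "\<dots> = (e1 / c) * act N x"
        by (simp only: mean_mult act_def)
      also have "\<dots> \<le> (e1 / c) * \<bar>K\<bar>"
        using K c(1) \<open>e1 > 0\<close> by (intro mult_left_mono) auto
      also have "\<dots> = e1 * (\<bar>K\<bar> / c)" by simp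
      also have "\<dots> \<le> e1 * (\<bar>K\<bar> / c + 1)"
        using \<open>e1 > 0\<close> by (intro mult_left_mono) auto
      also have "\<dots> = e / 2"
        using pos by (simp add: e1_def del: distrib_left_numeral)
      finally have "norm (mean N (res N (?x r)) - u) \<le> e / 2"
        unfolding u_def mean_res[OF N a x] mean_res[OF N a quasi_periodic_translate[OF x]] mean_diff .
      then have "(mean N (res N (?x r)) - u) \<bullet> w \<le> e / 2"
        using norm_cauchy_schwarz[of "mean N (res N (?x r)) - u" w] w(1) by simp
      then have "mean N (res N (?x r)) \<bullet> w \<le> e / 2 - norm u"
        using w(2) by (simp add: inner_diff_left)
      then have "s * (mean N (res N (?x r)) \<bullet> w) \<le> s * (e / 2 - norm u)"
        using s by (intro mult_left_mono) auto
      moreover have "min_act N a \<le> act N (?x s)"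
        by (intro min_act_le quasi_periodic_translate x)
      ultimately have "s * (norm u - e / 2) \<le> s * (e / 2)"
        using r(3) m by (simp add: algebra_simps)
      then have "norm u - e / 2 \<le> e / 2"
        by (rule mult_left_le_imp_le[OF _ s(1)])
      then show ?thesis by (simp add: u_def)
    qed
  qed (use s assms in auto)
qed

end

section \<open>Limits of discrete curves\<close>

text \<open>Uniform convergence over the whole line, tested at grid points only. Sequences can then
  be composed with periodic continuous maps without interpolating velocities or forces.\<close>

definition grid_conv :: "(nat \<Rightarrow> nat) \<Rightarrow> (nat \<Rightarrow> int \<Rightarrow> 'b::metric_space) \<Rightarrow> (real \<Rightarrow> 'b) \<Rightarrow> bool" where
  "grid_conv N y g \<longleftrightarrow>
     (\<forall>e>0. \<forall>\<^sub>F n in sequentially. \<forall>i. dist (y n i) (g (of_int i / real (N n))) < e)"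

lemma grid_convD:
  "grid_conv N y g \<Longrightarrow> e > 0 \<Longrightarrow>
     \<forall>\<^sub>F n in sequentially. \<forall>i. dist (y n i) (g (of_int i / real (N n))) < e"
  by (simp add: grid_conv_def)

lemma eventually_gt_nat_filterlim:
  assumes "filterlim N at_top sequentially"
  shows "\<forall>\<^sub>F n in sequentially. real (N n) > c"
  using filterlim_compose[OF filterlim_real_sequentially assms] by (simp add: filterlim_at_top_dense)

lemma telescope_norm_le:
  fixes y :: "int \<Rightarrow> 'b::real_normed_vector"
  assumes "i \<le> j"
  shows "norm (y j - y i) \<le> (\<Sum>k\<in>{i..<j}. norm (y (k + 1) - y k))"
  using assms
proof (induction j rule: int_ge_induct)
  case (step j)
  have "{i..<j + 1} = insert j {i..<j}" using step.hyps by auto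
  moreover have "norm (y (j + 1) - y i) \<le> norm (y (j + 1) - y j) + norm (y j - y i)"
    using norm_triangle_ineq[of "y (j + 1) - y j" "y j - y i"] by simp
  ultimately show ?case using step.IH by simp
qed simp

lemma telescope_norm_le_const:
  fixes y :: "int \<Rightarrow> 'b::real_normed_vector"
  assumes "i \<le> j" "\<And>k. i \<le> k \<Longrightarrow> k < j \<Longrightarrow> norm (y (k + 1) - y k) \<le> D"
  shows "norm (y j - y i) \<le> D * of_int (j - i)"
proof -
  have "norm (y j - y i) \<le> (\<Sum>k\<in>{i..<j}. norm (y (k + 1) - y k))"
    by (rule telescope_norm_le[OF assms(1)])
  also have "\<dots> \<le> (\<Sum>k\<in>{i..<j}. D)"
    using assms(2) by (intro sum_mono) auto
  finally show ?thesis using assms(1) by (simp add: mult.commute)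
qed

section \<open>Interpolation, convergent subsequences and limits of difference quotients\<close>

definition interpolate :: "(int \<Rightarrow> 'b::real_vector) \<Rightarrow> real \<Rightarrow> 'b" where
  "interpolate y u = y \<lfloor>u\<rfloor> + frac u *\<^sub>R (y (\<lfloor>u\<rfloor> + 1) - y \<lfloor>u\<rfloor>)"

lemma interpolate_of_int: "interpolate y (of_int i) = y i"
  by (simp add: interpolate_def)

lemma interpolate_quasi_periodic:
  assumes "quasi_periodic N a y"
  shows "interpolate y (u + of_int k * real N) = interpolate y u + of_int k *\<^sub>R a"
proof -
  have fl: "\<lfloor>u + of_int k * real N\<rfloor> = \<lfloor>u\<rfloor> + k * int N"
    using floor_add_int[of u "k * int N"] by simp
  then have "frac (u + of_int k * real N) = frac u"
    by (simp add: frac_def)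
  moreover have "y (\<lfloor>u\<rfloor> + k * int N + 1) = y (\<lfloor>u\<rfloor> + 1) + of_int k *\<^sub>R a"
    using quasi_periodic_int[OF assms, of "\<lfloor>u\<rfloor> + 1" k] by (simp add: ac_simps)
  ultimately show ?thesis
    using quasi_periodic_int[OF assms, of "\<lfloor>u\<rfloor>" k] by (simp add: interpolate_def fl)
qed

lemma interpolate_Lipschitz:
  fixes y :: "int \<Rightarrow> 'b::real_normed_vector"
  assumes D: "\<And>i. norm (y (i + 1) - y i) \<le> D"
  shows "norm (interpolate y u - interpolate y w) \<le> D * \<bar>u - w\<bar>"
proof -
  have *: "norm (interpolate y w - interpolate y u) \<le> D * (w - u)" if "u \<le> w" for u w
  proof (cases "\<lfloor>u\<rfloor> = \<lfloor>w\<rfloor>")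
    case True
    then have "interpolate y w - interpolate y u = (w - u) *\<^sub>R (y (\<lfloor>u\<rfloor> + 1) - y \<lfloor>u\<rfloor>)"
      by (simp add: interpolate_def frac_def flip: scaleR_diff_left)
    then have "norm (interpolate y w - interpolate y u) = (w - u) * norm (y (\<lfloor>u\<rfloor> + 1) - y \<lfloor>u\<rfloor>)"
      using that by simp
    also have "\<dots> \<le> (w - u) * D" using that D by (intro mult_left_mono) auto
    finally show ?thesis by (simp add: mult.commute)
  next
    case False
    then have lt: "\<lfloor>u\<rfloor> + 1 \<le> \<lfloor>w\<rfloor>" using floor_mono[OF that] by simp
    have "interpolate y w - interpolate y u
        = frac w *\<^sub>R (y (\<lfloor>w\<rfloor> + 1) - y \<lfloor>w\<rfloor>) + (y \<lfloor>w\<rfloor> - y (\<lfloor>u\<rfloor> + 1)) + (1 - frac u) *\<^sub>R (y (\<lfloor>u\<rfloor> + 1) - y \<lfloor>u\<rfloor>)"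
      by (simp add: interpolate_def algebra_simps)
    also have "norm \<dots> \<le> norm (frac w *\<^sub>R (y (\<lfloor>w\<rfloor> + 1) - y \<lfloor>w\<rfloor>)) + norm (y \<lfloor>w\<rfloor> - y (\<lfloor>u\<rfloor> + 1))
        + norm ((1 - frac u) *\<^sub>R (y (\<lfloor>u\<rfloor> + 1) - y \<lfloor>u\<rfloor>))"
      by (rule norm_triangle_le, rule add_right_mono, rule norm_triangle_ineq)
    also have "\<dots> \<le> frac w * D + D * of_int (\<lfloor>w\<rfloor> - (\<lfloor>u\<rfloor> + 1)) + (1 - frac u) * D"
      using D frac_lt_1[of u] by (intro add_mono telescope_norm_le_const lt) (auto intro!: mult_left_mono)
    also have "\<dots> = D * (w - u)"
      by (simp add: frac_def algebra_simps)
    finally show ?thesis .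
  qed
  show ?thesis
    using *[of u w] *[of w u] by (cases "u \<le> w") (auto simp: norm_minus_commute)
qed

text \<open>Arzela-Ascoli for the interpolants on [0, 1]. Quasi-periodicity extends the limit to the
  line, and uniformity survives because the difference to the limit depends only on the fractional
  part of the time.\<close>

lemma grid_limit:
  fixes y :: "nat \<Rightarrow> int \<Rightarrow> 'b::euclidean_space"
  assumes N: "\<And>n. N n > 0" and qp: "\<And>n. quasi_periodic (N n) a (y n)"
    and B: "\<And>n. norm (y n 0) \<le> B" and step: "\<And>n i. norm (y n (i + 1) - y n i) \<le> C / real (N n)"
  obtains r g where "strict_mono (r :: nat \<Rightarrow> nat)" "grid_conv (\<lambda>n. N (r n)) (\<lambda>n. y (r n)) g"
    "\<And>s t. norm (g s - g t) \<le> C * \<bar>s - t\<bar>" "\<And>t. g (t + 1) = g t + a"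
proof -
  define F where "F n t = interpolate (y n) (real (N n) * t)" for n t
  have Lip: "norm (F n s - F n t) \<le> C * \<bar>s - t\<bar>" for n s t
  proof -
    have "norm (F n s - F n t) \<le> C / real (N n) * \<bar>real (N n) * s - real (N n) * t\<bar>"
      unfolding F_def by (rule interpolate_Lipschitz) (rule step)
    also have "\<dots> = C * \<bar>s - t\<bar>"
      using N[of n] by (simp add: abs_mult flip: right_diff_distrib)
    finally show ?thesis .
  qed
  have C: "C \<ge> 0"
    using order_trans[OF norm_ge_zero Lip[of 0 0 1]] by simp
  have shift: "F n (t + of_int k) = F n t + of_int k *\<^sub>R a" for n t k
    using interpolate_quasi_periodic[OF qp[of n], of "real (N n) * t" k] by (simp add: F_def algebra_simps)
  have bound: "norm (F n t) \<le> B + C" if "t \<in> {0..1}" for n t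
  proof -
    have "norm (F n t - F n 0) \<le> C * 1"
      using Lip[of n t 0] that C mult_left_mono[of t 1 C] by simp
    moreover have "F n 0 = y n 0"
      using interpolate_of_int[of "y n" 0] by (simp add: F_def)
    ultimately show ?thesis
      using B[of n] norm_triangle_ineq2[of "F n t" "F n 0"] by simp
  qed
  have equi: "\<exists>d>0. \<forall>n u. u \<in> {0..1} \<and> norm (t - u) < d \<longrightarrow> norm (F n t - F n u) < e" if "e > 0" for t e
  proof (intro exI[of _ "e / (C + 1)"] conjI allI impI)
    fix n u assume "u \<in> {0..1} \<and> norm (t - u) < e / (C + 1)"
    then have "(C + 1) * \<bar>t - u\<bar> < e"
      using C by (simp add: field_simps)
    moreover have "C * \<bar>t - u\<bar> \<le> (C + 1) * \<bar>t - u\<bar>"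
      by (intro mult_right_mono) auto
    ultimately show "norm (F n t - F n u) < e"
      using Lip[of n t u] by linarith
  qed (use C that in simp)
  obtain g0 and r :: "nat \<Rightarrow> nat" where r: "strict_mono r"
    and unif: "\<And>e. 0 < e \<Longrightarrow> \<exists>M. \<forall>n t. n \<ge> M \<and> t \<in> {0..1} \<longrightarrow> norm (F (r n) t - g0 t) < e"
    using Arzela_Ascoli[OF compact_Icc[of 0 "1::real"] bound equi] by metis
  define g where "g t = g0 (frac t) + of_int \<lfloor>t\<rfloor> *\<^sub>R a" for t
  have Fg: "F n t - g t = F n (frac t) - g0 (frac t)" for n t
    using shift[of n "frac t" "\<lfloor>t\<rfloor>"] by (simp add: g_def frac_def)
  have ev: "\<forall>\<^sub>F n in sequentially. \<forall>t. norm (F (r n) t - g t) < e" if "e > 0" for e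
    unfolding Fg eventually_sequentially using unif[OF that] frac_lt_1
    by (meson atLeastAtMost_iff frac_ge_0 less_imp_le)
  have lim: "(\<lambda>n. F (r n) t) \<longlonglongrightarrow> g t" for t
  proof (rule tendstoI)
    fix e :: real assume "e > 0"
    from ev[OF this] show "\<forall>\<^sub>F n in sequentially. dist (F (r n) t) (g t) < e"
      by (rule eventually_mono) (simp add: dist_norm)
  qed
  show thesis
  proof (rule that[OF r])
    show "grid_conv (\<lambda>n. N (r n)) (\<lambda>n. y (r n)) g"
      unfolding grid_conv_def
    proof (intro allI impI)
      fix e :: real assume "e > 0"
      from ev[OF this] show "\<forall>\<^sub>F n in sequentially. \<forall>i. dist (y (r n) i) (g (of_int i / real (N (r n)))) < e"
      proof (rule eventually_mono, intro allI)
        fix n i assume *: "\<forall>t. norm (F (r n) t - g t) < e"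
        have "F (r n) (of_int i / real (N (r n))) = y (r n) i"
          using N[of "r n"] by (simp add: F_def interpolate_of_int)
        with * show "dist (y (r n) i) (g (of_int i / real (N (r n)))) < e"
          by (metis dist_norm)
      qed
    qed
    show "norm (g s - g t) \<le> C * \<bar>s - t\<bar>" for s t
      by (rule tendsto_upperbound[OF tendsto_norm[OF tendsto_diff[OF lim lim]]]) (auto simp: Lip)
    show "g (t + 1) = g t + a" for t
      by (simp add: g_def frac_def algebra_simps)
  qed
qed

lemma floor_grid_tendsto:
  assumes "filterlim N at_top sequentially"
  shows "(\<lambda>n. of_int \<lfloor>real (N n) * s\<rfloor> / real (N n)) \<longlonglongrightarrow> s"
proof -
  have inv: "(\<lambda>n. inverse (real (N n))) \<longlonglongrightarrow> 0"
    by (intro tendsto_inverse_0_at_top filterlim_compose[OF filterlim_real_sequentially assms])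
  have "(\<lambda>n. of_int \<lfloor>real (N n) * s\<rfloor> / real (N n) - s) \<longlonglongrightarrow> 0"
  proof (rule Lim_null_comparison[OF _ inv])
    have "\<forall>\<^sub>F n in sequentially. N n > 0"
      using eventually_gt_nat_filterlim[OF assms, of 0] by simp
    then show "\<forall>\<^sub>F n in sequentially. norm (of_int \<lfloor>real (N n) * s\<rfloor> / real (N n) - s) \<le> inverse (real (N n))"
    proof (rule eventually_mono)
      fix n assume n: "N n > 0"
      have "norm (of_int \<lfloor>real (N n) * s\<rfloor> / real (N n) - s) = \<bar>of_int \<lfloor>real (N n) * s\<rfloor> - real (N n) * s\<bar> / real (N n)"
        using n by (simp add: field_simps abs_mult)
      also have "\<dots> \<le> 1 / real (N n)"
        by (intro divide_right_mono) linarith+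
      finally show "norm (of_int \<lfloor>real (N n) * s\<rfloor> / real (N n) - s) \<le> inverse (real (N n))"
        by (simp add: divide_inverse)
    qed
  qed
  then show ?thesis
    by (simp add: LIM_zero_iff)
qed

lemma grid_conv_tendsto:
  assumes N: "filterlim N at_top sequentially" and conv: "grid_conv N y g" and g: "isCont g s"
  shows "(\<lambda>n. y n \<lfloor>real (N n) * s\<rfloor>) \<longlonglongrightarrow> g s"
proof (rule tendstoI)
  fix e :: real assume "e > 0"
  let ?t = "\<lambda>n. of_int \<lfloor>real (N n) * s\<rfloor> / real (N n)"
  have "(\<lambda>n. g (?t n)) \<longlonglongrightarrow> g s"
    by (rule isCont_tendsto_compose[OF g floor_grid_tendsto[OF N]])
  then have "\<forall>\<^sub>F n in sequentially. dist (g (?t n)) (g s) < e / 2"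
    using \<open>e > 0\<close> by (intro tendstoD) auto
  moreover have "\<forall>\<^sub>F n in sequentially. \<forall>i. dist (y n i) (g (of_int i / real (N n))) < e / 2"
    by (rule grid_convD[OF conv half_gt_zero[OF \<open>e > 0\<close>]])
  ultimately show "\<forall>\<^sub>F n in sequentially. dist (y n \<lfloor>real (N n) * s\<rfloor>) (g s) < e"
  proof eventually_elim
    case (elim n)
    then show ?case
      using dist_triangle_half_l[of "y n \<lfloor>real (N n) * s\<rfloor>" "g (?t n)" e "g s"]
      by (simp add: dist_commute)
  qed
qed

text \<open>A discrete fundamental theorem of calculus. Removing the linear part with slope
  \<open>h t\<close> and telescoping gives the estimate for the derivative directly, without an
  integral equation.\<close>

lemma grid_deriv:
  fixes y u :: "nat \<Rightarrow> int \<Rightarrow> 'b::real_normed_vector"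
  assumes N: "filterlim N at_top sequentially" and y: "grid_conv N y g" and u: "grid_conv N u h"
    and step: "\<And>n i. y n (i + 1) - y n i = u n i /\<^sub>R real (N n)"
    and g: "\<And>s. isCont g s" and h: "isCont h t"
  shows "(g has_vector_derivative h t) (at t)"
proof -
  have ev_pos: "\<forall>\<^sub>F n in sequentially. N n > 0"
    using eventually_gt_nat_filterlim[OF N, of 0] by simp
  \<comment> \<open>The floor of \<open>N * p\<close> can lie up to one cell to the left of
    \<open>p\<close>, hence the margin \<open>d\<close> on that side only.\<close>
  have core: "norm (g q - g p - (q - p) *\<^sub>R h t) \<le> e * (q - p)"
    if "p \<le> q" "e > 0" "d > 0" and d: "\<And>s. p - d < s \<Longrightarrow> s \<le> q \<Longrightarrow> dist (h s) (h t) < e / 2" for p q e d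
  proof -
    let ?fl = "\<lambda>n s. \<lfloor>real (N n) * s\<rfloor>"
    have "(\<lambda>n. norm (y n (?fl n q) - y n (?fl n p) - (of_int (?fl n q) / real (N n) - of_int (?fl n p) / real (N n)) *\<^sub>R h t))
            \<longlonglongrightarrow> norm (g q - g p - (q - p) *\<^sub>R h t)"
      by (intro tendsto_intros grid_conv_tendsto[OF N y] floor_grid_tendsto[OF N] g)
    moreover have "(\<lambda>n. e * (of_int (?fl n q) / real (N n) - of_int (?fl n p) / real (N n))) \<longlonglongrightarrow> e * (q - p)"
      by (intro tendsto_intros floor_grid_tendsto[OF N])
    moreover have "\<forall>\<^sub>F n in sequentially. norm (y n (?fl n q) - y n (?fl n p) - (of_int (?fl n q) / real (N n) - of_int (?fl n p) / real (N n)) *\<^sub>R h t)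
        \<le> e * (of_int (?fl n q) / real (N n) - of_int (?fl n p) / real (N n))"
    proof -
      have "\<forall>\<^sub>F n in sequentially. \<forall>i. dist (u n i) (h (of_int i / real (N n))) < e / 2"
        by (rule grid_convD[OF u half_gt_zero[OF \<open>e > 0\<close>]])
      moreover have "\<forall>\<^sub>F n in sequentially. real (N n) > 1 / d"
        by (rule eventually_gt_nat_filterlim[OF N])
      ultimately show ?thesis
        using ev_pos
      proof eventually_elim
        case (elim n)
        let ?z = "\<lambda>i. y n i - (of_int i / real (N n)) *\<^sub>R h t"
        have "norm (?z (?fl n q) - ?z (?fl n p)) \<le> e / real (N n) * of_int (?fl n q - ?fl n p)"
        proof (rule telescope_norm_le_const)
          show "?fl n p \<le> ?fl n q"
            using \<open>p \<le> q\<close> by (intro floor_mono mult_left_mono) auto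
          fix k assume k: "?fl n p \<le> k" "k < ?fl n q"
          let ?s = "of_int k / real (N n)"
          have "real (N n) * p - 1 < of_int k" "of_int k \<le> real (N n) * q"
            using k by linarith+
          then have "(real (N n) * p - 1) / real (N n) < ?s" "?s \<le> q"
            using elim(3) by (simp_all add: divide_strict_right_mono pos_divide_le_eq mult.commute)
          then have "p - 1 / real (N n) < ?s" "?s \<le> q"
            using elim(3) by (simp_all add: diff_divide_distrib)
          moreover have "1 / real (N n) < d"
            using elim(2,3) \<open>d > 0\<close> by (simp add: field_simps)
          ultimately have "dist (h ?s) (h t) < e / 2"
            by (intro d) auto
          then have "dist (u n k) (h t) < e"
            using elim(1) by (meson dist_triangle_half_l dist_commute dist_commute_lessI)
          have "?z (k + 1) - ?z k = (y n (k + 1) - y n k) - h t /\<^sub>R real (N n)"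
            by (simp add: distrib_right scaleR_add_left divide_inverse)
          also have "\<dots> = (u n k - h t) /\<^sub>R real (N n)"
            by (simp add: step scaleR_diff_right)
          also have "norm \<dots> \<le> e / real (N n)"
            using \<open>dist (u n k) (h t) < e\<close> by (simp add: dist_norm divide_inverse_commute mult_left_mono)
          finally show "norm (?z (k + 1) - ?z k) \<le> e / real (N n)" .
        qed
        moreover have "?z (?fl n q) - ?z (?fl n p)
          = y n (?fl n q) - y n (?fl n p) - (of_int (?fl n q) / real (N n) - of_int (?fl n p) / real (N n)) *\<^sub>R h t"
          by (simp add: algebra_simps)
        ultimately show ?case
          by (simp add: diff_divide_distrib right_diff_distrib)
      qed
    qed
    ultimately show ?thesis
      by (intro tendsto_le[OF sequentially_bot]) auto
  qed
  show ?thesis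
    unfolding has_vector_derivative_def has_derivative_within_alt
  proof (intro conjI allI impI bounded_linear_scaleR_left)
    fix e :: real assume "e > 0"
    then obtain d where d: "d > 0" "\<And>s. dist s t < d \<Longrightarrow> dist (h s) (h t) < e / 2"
      using h half_gt_zero unfolding continuous_at_eps_delta by (metis dist_commute)
    show "\<exists>d>0. \<forall>s\<in>UNIV. norm (s - t) < d \<longrightarrow> norm (g s - g t - (s - t) *\<^sub>R h t) \<le> e * norm (s - t)"
    proof (intro exI[of _ "d / 2"] conjI ballI impI)
      fix s assume s: "norm (s - t) < d / 2"
      show "norm (g s - g t - (s - t) *\<^sub>R h t) \<le> e * norm (s - t)"
      proof (cases "t \<le> s")
        case True
        have "norm (g s - g t - (s - t) *\<^sub>R h t) \<le> e * (s - t)"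
          by (rule core[OF True \<open>e > 0\<close> d(1)], rule d(2)) (use s True in \<open>auto simp: dist_real_def\<close>)
        then show ?thesis using True by simp
      next
        case False
        have "norm (g t - g s - (t - s) *\<^sub>R h t) \<le> e * (t - s)"
        proof (rule core[of s t e "d / 2"])
          show "dist (h u) (h t) < e / 2" if "s - d / 2 < u" "u \<le> t" for u
            using that s False by (intro d(2)) (auto simp: dist_real_def)
        qed (use False \<open>e > 0\<close> d(1) in auto)
        moreover have "norm (g s - g t - (s - t) *\<^sub>R h t) = norm (g t - g s - (t - s) *\<^sub>R h t)"
          by (subst norm_minus_cancel[symmetric]) (simp add: algebra_simps)
        ultimately show ?thesis using False by simp
      qed
    qed (use d in simp)
  qed
qed

lemma sum_telescope_int: "(\<Sum>i\<in>{0..<int n}. f (i + 1) - f i) = f (int n) - (f 0 :: 'b::ab_group_add)"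
proof (induction n)
  case (Suc n)
  have "{0..<int (Suc n)} = insert (int n) {0..<int n}" by auto
  then show ?case using Suc by (simp add: algebra_simps)
qed simp

text \<open>Convergence of Riemann sums, with the integral given by an antiderivative
  \<open>Y\<close>: by the mean value theorem the increment of \<open>Y\<close> over a cell is a
  value of \<open>g\<close> divided by \<open>N\<close>.\<close>

lemma grid_mean_tendsto:
  fixes y :: "nat \<Rightarrow> int \<Rightarrow> real"
  assumes N: "filterlim N at_top sequentially" "\<And>n. N n > 0" and y: "grid_conv N y g"
    and Lip: "\<And>s t. \<bar>g s - g t\<bar> \<le> C * \<bar>s - t\<bar>" and Y: "\<And>t. (Y has_real_derivative g t) (at t)"
  shows "(\<lambda>n. mean (N n) (y n)) \<longlonglongrightarrow> Y 1 - Y 0"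
proof (rule tendstoI)
  fix e :: real assume "e > 0"
  have C: "C \<ge> 0" using Lip[of 0 1] by simp
  have "\<forall>\<^sub>F n in sequentially. \<forall>i. dist (y n i) (g (of_int i / real (N n))) < e / 2"
    by (rule grid_convD[OF y half_gt_zero[OF \<open>e > 0\<close>]])
  moreover have "\<forall>\<^sub>F n in sequentially. real (N n) > 2 * (C + 1) / e"
    by (rule eventually_gt_nat_filterlim[OF N(1)])
  ultimately show "\<forall>\<^sub>F n in sequentially. dist (mean (N n) (y n)) (Y 1 - Y 0) < e"
  proof eventually_elim
    case (elim n)
    let ?N = "real (N n)" and ?t = "\<lambda>i. of_int i / real (N n)"
    have N0: "?N > 0" using N(2) by simp
    have small: "C / ?N < e / 2"
    proof -
      have "(C + 1) * 2 < e * ?N" using elim(2) \<open>e > 0\<close> by (simp add: field_simps)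
      then have "C * 2 < e * ?N" by simp
      then show ?thesis using N0 by (simp add: field_simps)
    qed
    have each: "\<bar>y n i - ?N * (Y (?t (i + 1)) - Y (?t i))\<bar> \<le> e / 2 + C / ?N" for i
    proof -
      have "?t i < ?t (i + 1)" using N0 by (simp add: field_simps)
      then obtain s where s: "?t i < s" "s < ?t (i + 1)" "Y (?t (i + 1)) - Y (?t i) = (?t (i + 1) - ?t i) * g s"
        using MVT2[of "?t i" "?t (i + 1)" Y g] Y by blast
      have gap: "?t (i + 1) - ?t i = 1 / ?N" by (simp add: add_divide_distrib)
      then have eq: "?N * (Y (?t (i + 1)) - Y (?t i)) = g s" using s(3) N0 by simp
      have "\<bar>g (?t i) - g s\<bar> \<le> C * \<bar>?t i - s\<bar>" by (rule Lip)
      also have "\<dots> \<le> C * (1 / ?N)" using s gap C by (intro mult_left_mono) auto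
      finally show ?thesis using elim(1)[rule_format, of i] unfolding eq dist_real_def times_divide_eq_right mult_1_right by linarith
    qed
    have "Y 1 - Y 0 = mean (N n) (\<lambda>i. ?N * (Y (?t (i + 1)) - Y (?t i)))"
      using sum_telescope_int[of "\<lambda>i. Y (?t i)" "N n"] N0 by (simp add: mean_def sum_distrib_left[symmetric])
    then have "mean (N n) (y n) - (Y 1 - Y 0) = mean (N n) (\<lambda>i. y n i - ?N * (Y (?t (i + 1)) - Y (?t i)))"
      by (simp add: mean_diff)
    then have "\<bar>mean (N n) (y n) - (Y 1 - Y 0)\<bar> \<le> mean (N n) (\<lambda>i. \<bar>y n i - ?N * (Y (?t (i + 1)) - Y (?t i))\<bar>)"
      using norm_mean_le[of "N n" "\<lambda>i. y n i - ?N * (Y (?t (i + 1)) - Y (?t i))"] by simp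
    also have "\<dots> \<le> mean (N n) (\<lambda>i. e / 2 + C / ?N)"
      by (intro mean_mono each)
    also have "\<dots> < e"
      unfolding mean_const[OF N(2)] using small by linarith
    finally show ?case by (simp add: dist_real_def)
  qed
qed

lemma grid_conv_mean_const:
  fixes y :: "nat \<Rightarrow> int \<Rightarrow> real"
  assumes "\<And>n. N n > 0" "grid_conv N y (\<lambda>t. c)"
  shows "(\<lambda>n. mean (N n) (y n)) \<longlonglongrightarrow> c"
proof (rule tendstoI)
  fix e :: real assume "e > 0"
  then have "\<forall>\<^sub>F n in sequentially. \<forall>i. dist (y n i) c < e / 2"
    using grid_convD[OF assms(2) half_gt_zero] by simp
  then show "\<forall>\<^sub>F n in sequentially. dist (mean (N n) (y n)) c < e"
  proof eventually_elim
    case (elim n)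
    have "norm (mean (N n) (\<lambda>i. y n i - c)) \<le> mean (N n) (\<lambda>i. norm (y n i - c))"
      by (rule norm_mean_le)
    also have "\<dots> \<le> mean (N n) (\<lambda>i. e / 2)"
      using elim by (intro mean_mono) (auto simp: dist_real_def less_imp_le)
    finally show ?case
      using assms(1)[of n] \<open>e > 0\<close> by (simp add: mean_diff mean_const dist_real_def)
  qed
qed

text \<open>Needed because the discrete Euler-Lagrange equation ties the momentum increment from
  \<open>i\<close> to \<open>i + 1\<close> to the force at \<open>i + 1\<close>.\<close>

lemma grid_conv_shift:
  fixes y :: "nat \<Rightarrow> int \<Rightarrow> 'b::real_normed_vector"
  assumes N: "filterlim N at_top sequentially" and y: "grid_conv N y g"
    and Lip: "\<And>s t. norm (g s - g t) \<le> C * \<bar>s - t\<bar>"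
  shows "grid_conv N (\<lambda>n i. y n (i + 1)) g"
  unfolding grid_conv_def
proof (intro allI impI)
  fix e :: real assume "e > 0"
  have C: "C \<ge> 0" using order_trans[OF norm_ge_zero Lip[of 0 1]] by simp
  have "\<forall>\<^sub>F n in sequentially. \<forall>i. dist (y n i) (g (of_int i / real (N n))) < e / 2"
    by (rule grid_convD[OF y half_gt_zero[OF \<open>e > 0\<close>]])
  moreover have "\<forall>\<^sub>F n in sequentially. real (N n) > 2 * (C + 1) / e"
    by (rule eventually_gt_nat_filterlim[OF N])
  ultimately show "\<forall>\<^sub>F n in sequentially. \<forall>i. dist (y n (i + 1)) (g (of_int i / real (N n))) < e"
  proof (eventually_elim, intro allI)
    fix n i
    assume 1: "\<forall>i. dist (y n i) (g (of_int i / real (N n))) < e / 2" and 2: "real (N n) > 2 * (C + 1) / e"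
    have N0: "real (N n) > 0" using 2 C \<open>e > 0\<close> by (smt (verit) divide_pos_pos)
    have "(C + 1) * 2 < e * real (N n)" using 2 \<open>e > 0\<close> by (simp add: field_simps)
    then have small: "C / real (N n) < e / 2" using N0 by (simp add: field_simps)
    have "dist (g (of_int (i + 1) / real (N n))) (g (of_int i / real (N n))) \<le> C * \<bar>of_int (i + 1) / real (N n) - of_int i / real (N n)\<bar>"
      unfolding dist_norm by (rule Lip)
    also have "\<dots> = C / real (N n)" by (simp flip: diff_divide_distrib)
    finally have "dist (g (of_int (i + 1) / real (N n))) (g (of_int i / real (N n))) < e / 2" using small by (rule le_less_trans)
    with 1[rule_format, of "i + 1"] show "dist (y n (i + 1)) (g (of_int i / real (N n))) < e"
      by (meson dist_triangle_half_l dist_commute_lessI)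
  qed
qed

lemma grid_conv_compose:
  fixes f :: "(real^2) \<times> 'a::euclidean_space \<Rightarrow> 'b::metric_space"
  assumes f: "continuous_on UNIV f" "\<And>v. periodic (\<lambda>x. f (x, v))"
    and x: "grid_conv N x g" and w: "grid_conv N w h" and V: "\<And>n i. norm (w n i) \<le> V"
  shows "grid_conv N (\<lambda>n i. f (x n i, w n i)) (\<lambda>t. f (g t, h t))"
  unfolding grid_conv_def
proof (intro allI impI)
  fix e :: real assume "e > 0"
  \<comment> \<open>The bound is \<open>V + 1\<close> because \<open>h\<close> is bounded only
    through its distance to \<open>w\<close>, less than 1 on the grid.\<close>
  then obtain d where d: "d > 0"
    "\<And>x y v w. norm v \<le> V + 1 \<Longrightarrow> norm w \<le> V + 1 \<Longrightarrow> dist x y < d \<Longrightarrow> dist v w < d \<Longrightarrow> dist (f (x, v)) (f (y, w)) < e"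
    using periodic_uniformly_continuous[OF f, of e "V + 1"] by blast
  have "min d 1 > 0" using d by simp
  then have "\<forall>\<^sub>F n in sequentially. \<forall>i. dist (x n i) (g (of_int i / real (N n))) < min d 1"
    "\<forall>\<^sub>F n in sequentially. \<forall>i. dist (w n i) (h (of_int i / real (N n))) < min d 1"
    using x w unfolding grid_conv_def by blast+
  then show "\<forall>\<^sub>F n in sequentially. \<forall>i. dist (f (x n i, w n i)) (f (g (of_int i / real (N n)), h (of_int i / real (N n)))) < e"
  proof (eventually_elim, intro allI)
    fix n i
    let ?t = "of_int i / real (N n)"
    assume 1: "\<forall>i. dist (x n i) (g (of_int i / real (N n))) < min d 1"
      and 2: "\<forall>i. dist (w n i) (h (of_int i / real (N n))) < min d 1"
    have "dist (w n i) (h ?t) < 1" using 2 by simp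
    then have "norm (h ?t) \<le> V + 1"
      using V[of n i] norm_triangle_ineq2[of "h ?t" "w n i"] by (simp add: dist_norm norm_minus_commute)
    then show "dist (f (x n i, w n i)) (f (g ?t, h ?t)) < e"
      using V[of n i] 1 2 by (intro d(2)) auto
  qed
qed

section \<open>Compactness in positions and momenta\<close>

context lagrangian
begin

text \<open>The action bounds only the mean of the squared velocities. As forces are quadratic in
  the velocity, this bounds the variation of the momentum over one turn. At a vertex whose velocity
  does not exceed the average the momentum itself is bounded, hence everywhere. Coercivity then
  bounds velocities uniformly in \<open>N\<close>, and positions and momenta become equi-Lipschitz.
  Velocities converge as images under \<open>W\<close>.\<close>

lemma limit_solution:
  fixes N :: "nat \<Rightarrow> nat" and x :: "nat \<Rightarrow> int \<Rightarrow> real^2"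
  assumes a: "a \<in> lattice" and N: "filterlim N at_top sequentially" "\<And>n. N n > 0"
    and x: "\<And>n. quasi_periodic (N n) a (x n)" and K: "\<And>n. act (N n) (x n) \<le> K"
    and B: "\<And>n. norm (x n 0) \<le> B"
    and \<rho>: "\<And>n i. norm (res (N n) (x n) i) \<le> \<rho> n" "\<rho> \<longlonglongrightarrow> 0"
  obtains r \<gamma> v C where "strict_mono (r :: nat \<Rightarrow> nat)"
    "\<And>t. (\<gamma> has_vector_derivative v t) (at t)"
    "\<And>t. ((\<lambda>t. P (\<gamma> t, v t)) has_vector_derivative Q (\<gamma> t, v t)) (at t)"
    "continuous_on UNIV v" "\<And>t. \<gamma> (t + 1) = \<gamma> t + a"
    "grid_conv (\<lambda>n. N (r n)) (\<lambda>n. x (r n)) \<gamma>" "\<And>s t. norm (\<gamma> s - \<gamma> t) \<le> C * \<bar>s - t\<bar>"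
    "grid_conv (\<lambda>n. N (r n)) (\<lambda>n i. L (pt (N (r n)) (x (r n)) i)) (\<lambda>t. L (\<gamma> t, v t))"
proof -
  define v where "v n i = snd (pt (N n) (x n) i)" for n i
  define p where "p n i = P (pt (N n) (x n) i)" for n i
  have pt: "pt (N n) (x n) i = (x n i, v n i)" for n i
    by (simp add: v_def pt_def)
  have vW: "v n i = W (x n i, p n i)" for n i
    by (simp add: p_def pt W_P)
  obtain c where c: "c > 0" "\<And>x v. c * (norm v)\<^sup>2 \<le> L (x, v)"
    using L_lower by blast
  obtain c' where c': "c' > 0" "\<And>x v. c' * norm v \<le> norm (P (x, v))"
    using P_coercive by blast
  obtain CQ where CQ: "CQ > 0" "\<And>x v. norm (Q (x, v)) \<le> CQ * (norm v)\<^sup>2"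
    using Q_bound by blast
  obtain BP where BP: "BP > 0" "\<And>x v. v \<in> cball 0 (sqrt (\<bar>K\<bar> / c)) \<Longrightarrow> norm (P (x, v)) \<le> BP"
    using periodic_bounded[OF compact_cball continuous_on_subset[OF P_cont] P_periodic] by blast
  obtain R where R: "R > 0" "\<And>n. norm (\<rho> n) \<le> R"
    using Bseq_def convergent_imp_Bseq[OF convergentI[OF \<rho>(2)]] by blast
  have res_le: "norm (res (N n) (x n) i) \<le> R" for n i
    using \<rho>(1)[of n i] R(2)[of n] by simp
  have pstep: "p n (i + 1) - p n i = (Q (x n (i + 1), v n (i + 1)) - res (N n) (x n) (i + 1)) /\<^sub>R real (N n)" for n i
    using N(2)[of n] unfolding res_def p_def pt by simp
  have pstep_le: "norm (p n (i + 1) - p n i) \<le> (CQ * (norm (v n (i + 1)))\<^sup>2 + R) / real (N n)" for n i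
  proof -
    have "norm (Q (x n (i + 1), v n (i + 1)) - res (N n) (x n) (i + 1)) \<le> CQ * (norm (v n (i + 1)))\<^sup>2 + R"
      by (rule norm_triangle_le_diff[OF add_mono[OF CQ(2) res_le]])
    then show ?thesis
      using N(2)[of n] unfolding pstep by (simp add: divide_inverse_commute mult_left_mono)
  qed
  have per: "quasi_periodic (N n) 0 (p n)" for n
    unfolding p_def by (rule LPQ_pt_periodic[OF N(2) a x])
  have vmean: "mean (N n) (\<lambda>i. (norm (v n i))\<^sup>2) \<le> \<bar>K\<bar> / c" for n
  proof -
    have "(norm (v n i))\<^sup>2 \<le> inverse c * L (pt (N n) (x n) i)" for i
      using c(2)[of "v n i" "x n i"] c(1) by (simp add: pt field_simps)
    then have "mean (N n) (\<lambda>i. (norm (v n i))\<^sup>2) \<le> mean (N n) (\<lambda>i. inverse c * L (pt (N n) (x n) i))"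
      by (intro mean_mono)
    also have "\<dots> = inverse c * act (N n) (x n)"
      by (simp only: mean_mult act_def)
    also have "\<dots> \<le> inverse c * \<bar>K\<bar>"
      using K[of n] c(1) by (intro mult_left_mono) auto
    finally show ?thesis by (simp add: divide_inverse mult.commute)
  qed
  define Bp where "Bp = BP + (CQ * (\<bar>K\<bar> / c) + R)"
  have p_le: "norm (p n i) \<le> Bp" for n i
  proof (rule periodic_all[OF per N(2)])
    fix i assume i: "i \<in> {0..<int (N n)}"
    obtain j where j: "j \<in> {0..<int (N n)}" "(norm (v n j))\<^sup>2 \<le> \<bar>K\<bar> / c"
      using mean_le_ex[OF vmean N(2)] by blast
    then have "norm (v n j) \<le> sqrt (\<bar>K\<bar> / c)"
      by (intro real_le_rsqrt)
    then have pj: "norm (p n j) \<le> BP"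
      unfolding p_def pt by (intro BP(2)) auto
    have *: "norm (p n l - p n k) \<le> CQ * (\<bar>K\<bar> / c) + R" if "0 \<le> k" "k \<le> l" "l < int (N n)" for k l
    proof -
      have "norm (p n l - p n k) \<le> (\<Sum>i\<in>{k..<l}. norm (p n (i + 1) - p n i))"
        by (rule telescope_norm_le[OF that(2)])
      also have "\<dots> \<le> (\<Sum>i\<in>{k..<l}. (CQ * (norm (v n (i + 1)))\<^sup>2 + R) / real (N n))"
        by (intro sum_mono pstep_le)
      also have "\<dots> = (\<Sum>i\<in>{k+1..<l+1}. (CQ * (norm (v n i))\<^sup>2 + R) / real (N n))"
        by (rule sum.reindex_bij_witness[of _ "\<lambda>i. i - 1" "\<lambda>i. i + 1"]) auto
      also have "\<dots> \<le> (\<Sum>i\<in>{0..<int (N n)}. (CQ * (norm (v n i))\<^sup>2 + R) / real (N n))"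
        using that CQ(1) R(1) by (intro sum_mono2) (auto intro!: divide_nonneg_nonneg add_nonneg_nonneg mult_nonneg_nonneg)
      also have "\<dots> = mean (N n) (\<lambda>i. CQ * (norm (v n i))\<^sup>2 + R)"
        by (simp add: mean_def divide_inverse mult.commute flip: sum_distrib_left)
      also have "\<dots> \<le> CQ * (\<bar>K\<bar> / c) + R"
        unfolding mean_add mean_mult mean_const[OF N(2)]
        using vmean[of n] CQ(1) by (intro add_right_mono mult_left_mono) auto
      finally show ?thesis .
    qed
    have "norm (p n i - p n j) \<le> CQ * (\<bar>K\<bar> / c) + R"
      using *[of j i] *[of i j] i j(1) by (cases "j \<le> i") (auto simp: norm_minus_commute)
    then show "norm (p n i) \<le> Bp"
      using pj norm_triangle_ineq2[of "p n i" "p n j"] by (simp add: Bp_def)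
  qed
  define V where "V = Bp / c'"
  have v_le: "norm (v n i) \<le> V" for n i
  proof -
    have "c' * norm (v n i) \<le> Bp"
      using c'(2)[of "v n i" "x n i"] p_le[of n i] by (simp add: p_def pt)
    then show ?thesis using c'(1) by (simp add: V_def field_simps)
  qed
  define D where "D = V + (CQ * V\<^sup>2 + R)"
  have xstep: "x n (i + 1) - x n i = v n i /\<^sub>R real (N n)" for n i
    using N(2)[of n] by (simp add: v_def pt_def)
  \<comment> \<open>Pairing the two sequences yields one subsequence for both.\<close>
  define y where "y n i = (x n i, p n i)" for n i
  have ystep: "norm (y n (i + 1) - y n i) \<le> D / real (N n)" for n i
  proof -
    have "norm (x n (i + 1) - x n i) \<le> V / real (N n)"
      using v_le[of n i] N(2)[of n] unfolding xstep by (simp add: divide_inverse_commute mult_left_mono)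
    moreover have "norm (p n (i + 1) - p n i) \<le> (CQ * V\<^sup>2 + R) / real (N n)"
      using CQ(1) v_le[of n "i + 1"] N(2)[of n]
      by (intro order_trans[OF pstep_le] divide_right_mono add_right_mono mult_left_mono power_mono) auto
    ultimately show ?thesis
      using norm_Pair_le[of "x n (i + 1) - x n i" "p n (i + 1) - p n i"]
      by (simp add: y_def D_def add_divide_distrib)
  qed
  have "quasi_periodic (N n) (a, 0) (y n)" for n
    using x[of n] per[of n] by (simp add: quasi_periodic_def y_def)
  moreover have "norm (y n 0) \<le> B + Bp" for n
    using norm_Pair_le[of "x n 0" "p n 0"] B[of n] p_le[of n 0] by (simp add: y_def)
  ultimately obtain r g where r: "strict_mono (r :: nat \<Rightarrow> nat)"
    and g: "grid_conv (\<lambda>n. N (r n)) (\<lambda>n. y (r n)) g"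
    and Lip: "\<And>s t. norm (g s - g t) \<le> D * \<bar>s - t\<bar>" and g1: "\<And>t. g (t + 1) = g t + (a, 0)"
    using grid_limit[of N "(a, 0)" y "B + Bp" D] N(2) ystep by metis
  define \<gamma> where "\<gamma> t = fst (g t)" for t
  define q where "q t = snd (g t)" for t
  define w where "w t = W (\<gamma> t, q t)" for t
  have Nr: "filterlim (\<lambda>n. N (r n)) at_top sequentially"
    by (rule filterlim_compose[OF N(1) filterlim_subseq[OF r]])
  have conv_fst: "grid_conv M (\<lambda>n i. fst (z n i)) (\<lambda>t. fst (h t))"
    and conv_snd: "grid_conv M (\<lambda>n i. snd (z n i)) (\<lambda>t. snd (h t))"
    if "grid_conv M z h" for M and z :: "nat \<Rightarrow> int \<Rightarrow> (real^2) \<times> (real^2)" and h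
    using that unfolding grid_conv_def
    by (smt (verit, ccfv_threshold) dist_fst_le dist_snd_le eventually_mono)+
  have conv_Pair: "grid_conv M (\<lambda>n i. (z n i, z' n i)) (\<lambda>t. (h t, h' t))"
    if "grid_conv M z h" "grid_conv M z' h'" for M and z z' :: "nat \<Rightarrow> int \<Rightarrow> real^2" and h h'
    unfolding grid_conv_def
  proof (intro allI impI)
    fix e :: real assume "e > 0"
    from grid_convD[OF that(1) half_gt_zero[OF this]] grid_convD[OF that(2) half_gt_zero[OF this]]
    show "\<forall>\<^sub>F n in sequentially. \<forall>i. dist (z n i, z' n i) (h (of_int i / real (M n)), h' (of_int i / real (M n))) < e"
    proof (eventually_elim, intro allI)
      fix n i
      let ?t = "of_int i / real (M n)"
      assume "\<forall>i. dist (z n i) (h (of_int i / real (M n))) < e / 2" "\<forall>i. dist (z' n i) (h' (of_int i / real (M n))) < e / 2"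
      then have "dist (z n i) (h ?t) < e / 2" "dist (z' n i) (h' ?t) < e / 2" by auto
      then show "dist (z n i, z' n i) (h ?t, h' ?t) < e"
        using sqrt_sum_squares_le_sum[of "dist (z n i) (h ?t)" "dist (z' n i) (h' ?t)"]
        by (simp add: dist_Pair_Pair)
    qed
  qed
  have g_shift: "grid_conv (\<lambda>n. N (r n)) (\<lambda>n i. y (r n) (i + 1)) g"
    by (rule grid_conv_shift[OF Nr g Lip])
  have cx: "grid_conv (\<lambda>n. N (r n)) (\<lambda>n. x (r n)) \<gamma>" "grid_conv (\<lambda>n. N (r n)) (\<lambda>n. p (r n)) q"
    using conv_fst[OF g] conv_snd[OF g] by (simp_all add: y_def \<gamma>_def[abs_def] q_def[abs_def])
  have cx1: "grid_conv (\<lambda>n. N (r n)) (\<lambda>n i. x (r n) (i + 1)) \<gamma>" "grid_conv (\<lambda>n. N (r n)) (\<lambda>n i. p (r n) (i + 1)) q"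
    using conv_fst[OF g_shift] conv_snd[OF g_shift] by (simp_all add: y_def \<gamma>_def[abs_def] q_def[abs_def])
  have cv: "grid_conv (\<lambda>n. N (r n)) (\<lambda>n. v (r n)) w"
    unfolding vW w_def by (rule grid_conv_compose[OF W_cont W_periodic cx p_le])
  have cv1: "grid_conv (\<lambda>n. N (r n)) (\<lambda>n i. v (r n) (i + 1)) w"
    unfolding vW w_def by (rule grid_conv_compose[OF W_cont W_periodic cx1 p_le])
  have cQ: "grid_conv (\<lambda>n. N (r n)) (\<lambda>n i. Q (x (r n) (i + 1), v (r n) (i + 1))) (\<lambda>t. Q (\<gamma> t, w t))"
    by (rule grid_conv_compose[OF Q_cont Q_periodic cx1(1) cv1 v_le])
  have cQr: "grid_conv (\<lambda>n. N (r n)) (\<lambda>n i. Q (x (r n) (i + 1), v (r n) (i + 1)) - res (N (r n)) (x (r n)) (i + 1)) (\<lambda>t. Q (\<gamma> t, w t))"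
    unfolding grid_conv_def
  proof (intro allI impI)
    fix e :: real assume "e > 0"
    have "(\<lambda>n. \<rho> (r n)) \<longlonglongrightarrow> 0"
      using LIMSEQ_subseq_LIMSEQ[OF \<rho>(2) r] by (simp add: o_def)
    then have "\<forall>\<^sub>F n in sequentially. \<rho> (r n) < e / 2"
      using \<open>e > 0\<close> by (intro order_tendstoD) auto
    with grid_convD[OF cQ half_gt_zero[OF \<open>e > 0\<close>]]
    show "\<forall>\<^sub>F n in sequentially. \<forall>i. dist (Q (x (r n) (i + 1), v (r n) (i + 1)) - res (N (r n)) (x (r n)) (i + 1))
        (Q (\<gamma> (of_int i / real (N (r n))), w (of_int i / real (N (r n))))) < e"
    proof (eventually_elim, intro allI)
      fix n i
      let ?t = "of_int i / real (N (r n))"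
      let ?q = "Q (x (r n) (i + 1), v (r n) (i + 1))" and ?s = "res (N (r n)) (x (r n)) (i + 1)"
      assume "\<forall>i. dist (Q (x (r n) (i + 1), v (r n) (i + 1))) (Q (\<gamma> (of_int i / real (N (r n))), w (of_int i / real (N (r n))))) < e / 2"
        and "\<rho> (r n) < e / 2"
      then have "norm (?q - Q (\<gamma> ?t, w ?t)) < e / 2" "norm ?s < e / 2"
        using \<rho>(1)[of "r n" "i + 1"] by (auto simp: dist_norm)
      then have "norm ((?q - Q (\<gamma> ?t, w ?t)) - ?s) < e"
        using norm_triangle_ineq4[of "?q - Q (\<gamma> ?t, w ?t)" ?s] by linarith
      then show "dist (?q - ?s) (Q (\<gamma> ?t, w ?t)) < e"
        by (simp add: dist_norm algebra_simps)
    qed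
  qed
  have g_cont: "isCont g s" for s
  proof -
    have "((\<lambda>t. D * \<bar>t - s\<bar>) \<longlongrightarrow> D * \<bar>s - s\<bar>) (at s)"
      by (intro tendsto_intros)
    then have "((\<lambda>t. g t - g s) \<longlongrightarrow> 0) (at s)"
      by (intro Lim_null_comparison[of "\<lambda>t. g t - g s" "\<lambda>t. D * \<bar>t - s\<bar>"]) (auto simp: Lip)
    then show ?thesis by (simp add: isCont_def LIM_zero_iff)
  qed
  have contg: "continuous_on UNIV g"
    by (intro continuous_at_imp_continuous_on ballI g_cont)
  have cont\<gamma>: "continuous_on UNIV \<gamma>" "continuous_on UNIV q"
    unfolding \<gamma>_def[abs_def] q_def[abs_def] by (intro continuous_intros contg)+
  have contw: "continuous_on UNIV w"
    unfolding w_def[abs_def] by (intro continuous_on_compose2[OF W_cont] continuous_on_Pair cont\<gamma>) auto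
  have contQ: "continuous_on UNIV (\<lambda>t. Q (\<gamma> t, w t))"
    by (intro continuous_on_compose2[OF Q_cont] continuous_on_Pair cont\<gamma> contw) auto
  have deriv: "(g has_vector_derivative (w t, Q (\<gamma> t, w t))) (at t)" for t
  proof (rule grid_deriv[OF Nr g conv_Pair[OF cv cQr] _ g_cont])
    show "y (r n) (i + 1) - y (r n) i
      = (v (r n) i, Q (x (r n) (i + 1), v (r n) (i + 1)) - res (N (r n)) (x (r n)) (i + 1)) /\<^sub>R real (N (r n))" for n i
      using xstep[of "r n" i] pstep[of "r n" i] by (simp add: y_def)
    have "continuous_on UNIV (\<lambda>t. (w t, Q (\<gamma> t, w t)))"
      by (intro continuous_on_Pair contw contQ)
    then show "isCont (\<lambda>t. (w t, Q (\<gamma> t, w t))) t"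
      by (simp add: continuous_on_eq_continuous_at)
  qed
  have Pw: "P (\<gamma> t, w t) = q t" for t
    by (simp add: w_def P_W)
  show thesis
  proof (rule that[OF r _ _ contw])
    show "(\<gamma> has_vector_derivative w t) (at t)" for t
      using bounded_linear.has_vector_derivative[OF bounded_linear_fst deriv[of t]] by (simp add: \<gamma>_def[abs_def])
    show "((\<lambda>t. P (\<gamma> t, w t)) has_vector_derivative Q (\<gamma> t, w t)) (at t)" for t
      unfolding Pw using bounded_linear.has_vector_derivative[OF bounded_linear_snd deriv[of t]] by (simp add: q_def[abs_def])
    show "\<gamma> (t + 1) = \<gamma> t + a" for t
      by (simp add: \<gamma>_def g1)
    show "norm (\<gamma> s - \<gamma> t) \<le> D * \<bar>s - t\<bar>" for s t
    proof -
      have "norm (fst (g s - g t)) \<le> norm (g s - g t)"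
        using norm_fst_le[of "fst (g s - g t)" "snd (g s - g t)"] by (simp only: prod.collapse)
      then show ?thesis using Lip[of s t] by (simp add: \<gamma>_def)
    qed
    show "grid_conv (\<lambda>n. N (r n)) (\<lambda>n i. L (pt (N (r n)) (x (r n)) i)) (\<lambda>t. L (\<gamma> t, w t))"
      unfolding pt by (rule grid_conv_compose[OF L_cont L_periodic cx(1) cv v_le])
  qed (rule cx(1))
qed

end

section \<open>Two solutions from the minimum and the minimax\<close>

context lagrangian
begin

text \<open>The momentum is differentiated as a whole and the velocity is just continuous, since no
  second derivative of \<open>\<gamma>\<close> is known for a limit of discrete loops.\<close>

definition el_solution :: "real^2 \<Rightarrow> (real \<Rightarrow> real^2) \<Rightarrow> (real \<Rightarrow> real^2) \<Rightarrow> bool" where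
  "el_solution a \<gamma> v \<longleftrightarrow> (\<forall>t. (\<gamma> has_vector_derivative v t) (at t)) \<and>
     (\<forall>t. ((\<lambda>t. P (\<gamma> t, v t)) has_vector_derivative Q (\<gamma> t, v t)) (at t)) \<and>
     continuous_on UNIV v \<and> (\<forall>t. \<gamma> (t + 1) = \<gamma> t + a)"

lemma translate_invariant:
  assumes "b \<in> lattice"
  shows "act N (\<lambda>i. x i + b) = act N x" "res N (\<lambda>i. x i + b) = res N x"
proof -
  have "L (pt N (\<lambda>i. x i + b) i) = L (pt N x i)" "P (pt N (\<lambda>i. x i + b) i) = P (pt N x i)"
    "Q (pt N (\<lambda>i. x i + b) i) = Q (pt N x i)" for i
    using periodic_lattice[OF L_periodic assms] periodic_lattice[OF P_periodic assms] periodic_lattice[OF Q_periodic assms]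
    unfolding pt_translate by (simp_all add: pt_def)
  then show "act N (\<lambda>i. x i + b) = act N x" "res N (\<lambda>i. x i + b) = res N x"
    by (simp_all add: act_def res_def fun_eq_iff)
qed

text \<open>Lattice translations bring the base points into a bounded region without changing action
  or gradient. Energy conservation, a hypothesis because its proof uses derivatives of
  \<open>P\<close>, makes the limit of the actions a value of \<open>L\<close>. Means in the
  direction \<open>l\<close> converge to an integral. Their class modulo \<int> survives the
  translations, as \<open>l\<close> is integral on the lattice, and the limit, as \<int> is
  closed.\<close>

lemma solution_of_almost_critical:
  fixes N :: "nat \<Rightarrow> nat" and x :: "nat \<Rightarrow> int \<Rightarrow> real^2"
  assumes a: "a \<in> lattice" and N: "filterlim N at_top sequentially" "\<And>n. N n > 0"
    and x: "\<And>n. quasi_periodic (N n) a (x n)" and K: "\<And>n. act (N n) (x n) \<le> K"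
    and \<rho>: "\<And>n i. norm (res (N n) (x n) i) \<le> \<rho> n" "\<rho> \<longlonglongrightarrow> 0"
    and conserve: "\<And>\<gamma> v. el_solution a \<gamma> v \<Longrightarrow> \<exists>E. \<forall>t. L (\<gamma> t, v t) = E"
    and l: "\<And>n. n \<in> lattice \<Longrightarrow> n \<bullet> l \<in> \<int>"
  obtains r \<gamma> v where "strict_mono (r :: nat \<Rightarrow> nat)" "el_solution a \<gamma> v"
    "(\<lambda>n. act (N (r n)) (x (r n))) \<longlonglongrightarrow> L (\<gamma> 0, v 0)"
    "\<And>Y \<theta>. (\<And>t. (Y has_real_derivative \<gamma> t \<bullet> l) (at t)) \<Longrightarrow> (\<And>n. mean (N n) (x n) \<bullet> l - \<theta> \<in> \<int>) \<Longrightarrow>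
       Y 1 - Y 0 - \<theta> \<in> \<int>"
proof -
  have "\<exists>b. b \<in> lattice \<and> norm (x n 0 + b) \<le> 2" for n
    using lattice_reduce[of "x n 0"] by blast
  then obtain b where b: "\<And>n. b n \<in> lattice" "\<And>n. norm (x n 0 + b n) \<le> 2"
    by metis
  define y where "y n i = x n i + b n" for n i
  have y: "quasi_periodic (N n) a (y n)" "act (N n) (y n) = act (N n) (x n)" "res (N n) (y n) = res (N n) (x n)" for n
    using quasi_periodic_translate[OF x[of n], of "b n"] translate_invariant[OF b(1)[of n], of "N n" "x n"]
    unfolding y_def[abs_def] by auto
  have bounds: "act (N n) (y n) \<le> K" "norm (y n 0) \<le> 2" "norm (res (N n) (y n) i) \<le> \<rho> n" for n i
    using K b(2) \<rho>(1) y by (auto simp: y_def)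
  obtain r \<gamma> v C where r: "strict_mono (r :: nat \<Rightarrow> nat)"
    and \<gamma>: "\<And>t. (\<gamma> has_vector_derivative v t) (at t)"
    "\<And>t. ((\<lambda>t. P (\<gamma> t, v t)) has_vector_derivative Q (\<gamma> t, v t)) (at t)"
    "continuous_on UNIV v" "\<And>t. \<gamma> (t + 1) = \<gamma> t + a"
    and conv: "grid_conv (\<lambda>n. N (r n)) (\<lambda>n. y (r n)) \<gamma>" and Lip: "\<And>s t. norm (\<gamma> s - \<gamma> t) \<le> C * \<bar>s - t\<bar>"
    and convL: "grid_conv (\<lambda>n. N (r n)) (\<lambda>n i. L (pt (N (r n)) (y (r n)) i)) (\<lambda>t. L (\<gamma> t, v t))"
    by (rule limit_solution[OF a N y(1) bounds \<rho>(2)]) blast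
  have sol: "el_solution a \<gamma> v"
    using \<gamma> by (simp add: el_solution_def)
  have Nr: "filterlim (\<lambda>n. N (r n)) at_top sequentially"
    by (rule filterlim_compose[OF N(1) filterlim_subseq[OF r]])
  show thesis
  proof (rule that[OF r sol])
    obtain E where E: "\<And>t. L (\<gamma> t, v t) = E"
      using conserve[OF sol] by blast
    have "(\<lambda>n. mean (N (r n)) (\<lambda>i. L (pt (N (r n)) (y (r n)) i))) \<longlonglongrightarrow> E"
      using convL N(2) unfolding E by (intro grid_conv_mean_const[of "\<lambda>n. N (r n)"])
    then show "(\<lambda>n. act (N (r n)) (x (r n))) \<longlonglongrightarrow> L (\<gamma> 0, v 0)"
      by (simp add: E y(2)[symmetric]) (simp add: act_def)
  next
    fix Y \<theta> assume Y: "\<And>t. (Y has_real_derivative \<gamma> t \<bullet> l) (at t)" and mean: "\<And>n. mean (N n) (x n) \<bullet> l - \<theta> \<in> \<int>"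
    have "grid_conv (\<lambda>n. N (r n)) (\<lambda>n i. y (r n) i \<bullet> l) (\<lambda>t. \<gamma> t \<bullet> l)"
      unfolding grid_conv_def
    proof (intro allI impI)
      fix e :: real assume "e > 0"
      then have "e / (norm l + 1) > 0" by (simp add: add_nonneg_pos)
      from grid_convD[OF conv this]
      show "\<forall>\<^sub>F n in sequentially. \<forall>i. dist (y (r n) i \<bullet> l) (\<gamma> (of_int i / real (N (r n))) \<bullet> l) < e"
      proof (rule eventually_mono, intro allI)
        fix n i
        let ?d = "y (r n) i - \<gamma> (of_int i / real (N (r n)))"
        assume "\<forall>i. dist (y (r n) i) (\<gamma> (of_int i / real (N (r n)))) < e / (norm l + 1)"
        then have "norm ?d < e / (norm l + 1)" by (auto simp: dist_norm)
        then have lt: "norm ?d * (norm l + 1) < e" by (simp add: pos_less_divide_eq add_nonneg_pos)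
        have "\<bar>?d \<bullet> l\<bar> \<le> norm ?d * norm l" by (rule Cauchy_Schwarz_ineq2)
        also have "\<dots> \<le> norm ?d * (norm l + 1)" by (intro mult_left_mono) auto
        finally show "dist (y (r n) i \<bullet> l) (\<gamma> (of_int i / real (N (r n))) \<bullet> l) < e"
          using lt by (simp add: dist_real_def inner_diff_left)
      qed
    qed
    moreover have "\<bar>\<gamma> s \<bullet> l - \<gamma> t \<bullet> l\<bar> \<le> (C * norm l) * \<bar>s - t\<bar>" for s t
    proof -
      have "\<bar>(\<gamma> s - \<gamma> t) \<bullet> l\<bar> \<le> norm (\<gamma> s - \<gamma> t) * norm l" by (rule Cauchy_Schwarz_ineq2)
      also have "\<dots> \<le> C * \<bar>s - t\<bar> * norm l" by (intro mult_right_mono Lip) auto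
      finally show ?thesis by (simp add: inner_diff_left algebra_simps)
    qed
    ultimately have "(\<lambda>n. mean (N (r n)) (\<lambda>i. y (r n) i \<bullet> l)) \<longlonglongrightarrow> Y 1 - Y 0"
      using N(2) Y by (intro grid_mean_tendsto[OF Nr]) auto
    then have lim: "(\<lambda>n. mean (N (r n)) (\<lambda>i. y (r n) i \<bullet> l) - \<theta>) \<longlonglongrightarrow> Y 1 - Y 0 - \<theta>"
      by (intro tendsto_intros)
    have "mean (N n) (\<lambda>i. y n i \<bullet> l) - \<theta> \<in> \<int>" for n
    proof -
      have "mean (N n) (\<lambda>i. y n i \<bullet> l) - \<theta> = (mean (N n) (x n) \<bullet> l - \<theta>) + b n \<bullet> l"
        unfolding mean_inner y_def by (simp add: mean_add mean_const[OF N(2)] inner_add_left)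
      then show ?thesis using Ints_add[OF mean[of n] l[OF b(1)[of n]]] by (simp only:)
    qed
    from closed_sequentially[OF closed_Ints this lim] show "Y 1 - Y 0 - \<theta> \<in> \<int>" .
  qed
qed

text \<open>Every path of loops contains one whose mean is congruent to \<open>\<theta>\<close> in the direction \<open>l\<close>. If the minimax value
  and the minimum agree in the limit, it may be replaced by an almost minimiser with the same mean.\<close>

lemma solution_with_mean:
  assumes a: "a \<in> lattice" and e: "e \<in> lattice" "\<bar>e \<bullet> l\<bar> \<ge> 1"
    and conserve: "\<And>\<gamma> v. el_solution a \<gamma> v \<Longrightarrow> \<exists>E. \<forall>t. L (\<gamma> t, v t) = E"
    and l: "\<And>n. n \<in> lattice \<Longrightarrow> n \<bullet> l \<in> \<int>"
    and gap: "(\<lambda>n. minimax (Suc n) a e - min_act (Suc n) a) \<longlonglongrightarrow> 0"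
  obtains \<gamma> v where "el_solution a \<gamma> v"
    "\<And>Y. (\<And>t. (Y has_real_derivative \<gamma> t \<bullet> l) (at t)) \<Longrightarrow> Y 1 - Y 0 - \<theta> \<in> \<int>"
proof -
  \<comment> \<open>Two errors \<open>1 / real (Suc n)\<close> add up: the path is only almost
    optimal, and the constrained descent starts from one of its loops with a further loss.\<close>
  define \<epsilon> where "\<epsilon> n = minimax (Suc n) a e - min_act (Suc n) a + 2 / real (Suc n)" for n
  have inv: "(\<lambda>n. 1 / real (Suc n)) \<longlonglongrightarrow> 0"
    using LIMSEQ_inverse_real_of_nat by (simp add: inverse_eq_divide)
  have "\<epsilon> \<longlonglongrightarrow> 0 + 2 * 0"
    unfolding \<epsilon>_def[abs_def] using tendsto_add[OF gap tendsto_mult[OF tendsto_const[of 2] inv]] by simp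
  then have \<epsilon>: "\<epsilon> \<longlonglongrightarrow> 0" by simp
  obtain C where C: "C > 0" "\<And>N. N > 0 \<Longrightarrow> C \<in> path_levels N a e"
    using path_levels_upper[of a e] by blast
  have ex: "\<exists>z. quasi_periodic (Suc n) a z \<and> mean (Suc n) z \<bullet> l - \<theta> \<in> \<int> \<and> act (Suc n) z \<le> minimax (Suc n) a e + 2 / real (Suc n) \<and>
      (\<forall>i. norm (res (Suc n) z i - mean (Suc n) (res (Suc n) z)) \<le> 1 / real (Suc n))" for n
  proof -
    have "\<exists>c\<in>path_levels (Suc n) a e. c < minimax (Suc n) a e + 1 / real (Suc n)"
      unfolding minimax_def using C(2)[of "Suc n"] by (intro cInf_lessD) auto
    then obtain X c where X: "loop_path (Suc n) a e X" "\<And>t. t \<in> {0..1} \<Longrightarrow> act (Suc n) (X t) \<le> c"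
      "c < minimax (Suc n) a e + 1 / real (Suc n)"
      unfolding path_levels_def by blast
    obtain t where t: "t \<in> {0..1}" "mean (Suc n) (X t) \<bullet> l - \<theta> \<in> \<int>"
      using loop_path_mean[OF X(1) _ e(2)] by auto
    have "quasi_periodic (Suc n) a (X t)"
      using X(1) t(1) by (simp add: loop_path_def)
    from near_constrained_minimiser[OF _ a _ this, of "1 / real (Suc n)"]
    obtain z where z: "quasi_periodic (Suc n) a z" "mean (Suc n) z = mean (Suc n) (X t)"
      "act (Suc n) z \<le> act (Suc n) (X t) + 1 / real (Suc n)"
      "\<And>i. norm (res (Suc n) z i - mean (Suc n) (res (Suc n) z)) < 1 / real (Suc n)"
      by auto
    have "act (Suc n) z \<le> minimax (Suc n) a e + 2 / real (Suc n)"
      using z(3) X(2)[OF t(1)] X(3) by simp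
    then show ?thesis
      using z t(2) less_imp_le by metis
  qed
  then obtain z where z: "\<And>n. quasi_periodic (Suc n) a (z n)" "\<And>n. mean (Suc n) (z n) \<bullet> l - \<theta> \<in> \<int>"
    "\<And>n. act (Suc n) (z n) \<le> minimax (Suc n) a e + 2 / real (Suc n)"
    "\<And>n i. norm (res (Suc n) (z n) i - mean (Suc n) (res (Suc n) (z n))) \<le> 1 / real (Suc n)"
    by metis
  have K: "act (Suc n) (z n) \<le> C + 2" for n
  proof -
    have "2 / real (Suc n) \<le> 2" by (simp add: field_simps)
    then show ?thesis
      using z(3)[of n] minimax_le[OF C(2), of "Suc n"] by simp
  qed
  \<comment> \<open>The multiplier tends to 0, so the constrained almost critical loops are almost
    critical without constraint.\<close>
  define \<mu> where "\<mu> n = norm (mean (Suc n) (res (Suc n) (z n)))" for n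
  have "\<mu> \<longlonglongrightarrow> 0"
  proof (rule tendstoI)
    fix e' :: real assume "e' > 0"
    obtain d where d: "d > 0" "\<And>N a x. N > 0 \<Longrightarrow> a \<in> lattice \<Longrightarrow> quasi_periodic N a x \<Longrightarrow> act N x \<le> C + 2 \<Longrightarrow>
       act N x \<le> min_act N a + d \<Longrightarrow> norm (mean N (res N x)) \<le> e' / 2"
      using multiplier_bound[OF half_gt_zero[OF \<open>e' > 0\<close>], of "C + 2"] by metis
    have "\<forall>\<^sub>F n in sequentially. \<epsilon> n < d"
      using \<epsilon> d(1) by (rule order_tendstoD)
    then show "\<forall>\<^sub>F n in sequentially. dist (\<mu> n) 0 < e'"
    proof (rule eventually_mono)
      fix n assume "\<epsilon> n < d"
      then have "\<mu> n \<le> e' / 2"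
        unfolding \<mu>_def using z(1,3)[of n] K[of n] a by (intro d(2)) (auto simp: \<epsilon>_def)
      then show "dist (\<mu> n) 0 < e'"
        using \<open>e' > 0\<close> by (simp add: \<mu>_def)
    qed
  qed
  then have "(\<lambda>n. 1 / real (Suc n) + \<mu> n) \<longlonglongrightarrow> 0 + 0"
    by (intro tendsto_add inv)
  then have \<rho>: "(\<lambda>n. 1 / real (Suc n) + \<mu> n) \<longlonglongrightarrow> 0" by simp
  have res_le: "norm (res (Suc n) (z n) i) \<le> 1 / real (Suc n) + \<mu> n" for n i
    using z(4)[of n i] norm_triangle_ineq2[of "res (Suc n) (z n) i" "mean (Suc n) (res (Suc n) (z n))"]
    by (simp add: \<mu>_def)
  obtain r \<gamma> v where "el_solution a \<gamma> v"
    "\<And>Y \<theta>. (\<And>t. (Y has_real_derivative \<gamma> t \<bullet> l) (at t)) \<Longrightarrow> (\<And>n. mean (Suc n) (z n) \<bullet> l - \<theta> \<in> \<int>) \<Longrightarrow>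
       Y 1 - Y 0 - \<theta> \<in> \<int>"
    by (rule solution_of_almost_critical[OF a filterlim_Suc zero_less_Suc z(1) K res_le \<rho> conserve l]) blast+
  then show thesis
    using z(2) by (intro that) blast+
qed

text \<open>If the gap tends to 0, every mean position is attained, and the classes of 0 and 1/2
  modulo \<int> differ. Otherwise the gap stays above some \<open>e0\<close> along a subsequence,
  and limits of almost minimisers and of almost minimax loops have energies at least
  \<open>e0\<close> apart.\<close>

lemma two_solutions:
  assumes a: "a \<in> lattice" and e: "e \<in> lattice" "\<bar>e \<bullet> l\<bar> \<ge> 1"
    and conserve: "\<And>\<gamma> v. el_solution a \<gamma> v \<Longrightarrow> \<exists>E. \<forall>t. L (\<gamma> t, v t) = E"
    and l: "\<And>n. n \<in> lattice \<Longrightarrow> n \<bullet> l \<in> \<int>"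
  obtains \<gamma> v \<gamma>' v' where "el_solution a \<gamma> v" "el_solution a \<gamma>' v'"
    "L (\<gamma> 0, v 0) \<noteq> L (\<gamma>' 0, v' 0) \<or>
     (\<forall>Y Y'. (\<forall>t. (Y has_real_derivative \<gamma> t \<bullet> l) (at t)) \<longrightarrow> (\<forall>t. (Y' has_real_derivative \<gamma>' t \<bullet> l) (at t)) \<longrightarrow>
        (Y 1 - Y 0) - (Y' 1 - Y' 0) \<notin> \<int>)"
proof (cases "(\<lambda>n. minimax (Suc n) a e - min_act (Suc n) a) \<longlonglongrightarrow> 0")
  case True
  obtain \<gamma> v where 1: "el_solution a \<gamma> v"
    "\<And>Y. (\<And>t. (Y has_real_derivative \<gamma> t \<bullet> l) (at t)) \<Longrightarrow> Y 1 - Y 0 - 0 \<in> \<int>"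
    by (rule solution_with_mean[OF a e conserve l True, of 0]) blast+
  obtain \<gamma>' v' where 2: "el_solution a \<gamma>' v'"
    "\<And>Y. (\<And>t. (Y has_real_derivative \<gamma>' t \<bullet> l) (at t)) \<Longrightarrow> Y 1 - Y 0 - 1 / 2 \<in> \<int>"
    by (rule solution_with_mean[OF a e conserve l True, of "1 / 2"]) blast+
  have "(Y 1 - Y 0) - (Y' 1 - Y' 0) \<notin> \<int>"
    if "\<forall>t. (Y has_real_derivative \<gamma> t \<bullet> l) (at t)" "\<forall>t. (Y' has_real_derivative \<gamma>' t \<bullet> l) (at t)" for Y Y'
  proof
    assume "(Y 1 - Y 0) - (Y' 1 - Y' 0) \<in> \<int>"
    then have "(Y 1 - Y 0 - 0) - ((Y 1 - Y 0) - (Y' 1 - Y' 0)) - (Y' 1 - Y' 0 - 1 / 2) \<in> \<int>"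
      using 1(2)[of Y] 2(2)[of Y'] that by (intro Ints_diff) auto
    then have "(1 / 2 :: real) \<in> \<int>" by simp
    then obtain k :: int where "1 / 2 = real_of_int k" by (auto elim: Ints_cases)
    then have "real_of_int (2 * k) = real_of_int 1" by simp
    then have "2 * k = 1" by (simp only: of_int_eq_iff)
    then show False by presburger
  qed
  then show thesis
    using that[OF 1(1) 2(1)] by blast
next
  case False
  let ?m = "\<lambda>n. min_act (Suc n) a" and ?M = "\<lambda>n. minimax (Suc n) a e"
  obtain e0 where e0: "e0 > 0" "\<not> (\<forall>\<^sub>F n in sequentially. dist (?M n - ?m n) 0 < e0)"
    using False by (auto simp: tendsto_iff)
  define S where "S = {n. e0 \<le> ?M n - ?m n}"
  have mM: "?m n \<le> ?M n" for n by (rule min_act_le_minimax) simp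
  have "infinite S"
  proof
    assume "finite S"
    then have "\<forall>\<^sub>F n in sequentially. n \<notin> S"
      by (simp add: cofinite_eq_sequentially[symmetric] eventually_cofinite)
    then have "\<forall>\<^sub>F n in sequentially. dist (?M n - ?m n) 0 < e0"
      by (rule eventually_mono) (use mM in \<open>simp add: S_def dist_real_def not_le\<close>)
    with e0 show False by blast
  qed
  define s where "s = enumerate S"
  have s: "strict_mono s" "\<And>n. s n \<in> S"
    using \<open>infinite S\<close> by (simp_all add: s_def strict_mono_enumerate enumerate_in_set)
  obtain C where C: "C > 0" "\<And>N. N > 0 \<Longrightarrow> C \<in> path_levels N a e"
    using path_levels_upper[of a e] by blast
  have "\<exists>x. quasi_periodic (Suc n) a x \<and> act (Suc n) x \<le> ?m n + 1 / real (Suc n) \<and> (\<forall>i. norm (res (Suc n) x i) \<le> 1 / real (Suc n))" for n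
    by (rule near_minimiser[of "Suc n" a "1 / real (Suc n)"]) (use a less_imp_le in auto)
  then obtain x where x: "\<And>n. quasi_periodic (Suc n) a (x n)" "\<And>n. act (Suc n) (x n) \<le> ?m n + 1 / real (Suc n)"
    "\<And>n i. norm (res (Suc n) (x n) i) \<le> 1 / real (Suc n)" by metis
  have "\<exists>y. quasi_periodic (Suc n) a y \<and> \<bar>act (Suc n) y - ?M n\<bar> \<le> 1 / real (Suc n) \<and> (\<forall>i. norm (res (Suc n) y i) \<le> 1 / real (Suc n))" for n
    by (rule near_minimax[of "Suc n" a e "1 / real (Suc n)"]) (use a e less_imp_le in auto)
  then obtain y where y: "\<And>n. quasi_periodic (Suc n) a (y n)" "\<And>n. \<bar>act (Suc n) (y n) - ?M n\<bar> \<le> 1 / real (Suc n)"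
    "\<And>n i. norm (res (Suc n) (y n) i) \<le> 1 / real (Suc n)" by metis
  have MC: "?M n \<le> C" for n by (rule minimax_le[OF C(2)]) simp
  have one: "1 / real (Suc n) \<le> 1" for n by (simp add: field_simps)
  have K: "act (Suc n) (x n) \<le> C + 1" "act (Suc n) (y n) \<le> C + 1" for n
    using x(2)[of n] y(2)[of n] MC[of n] mM[of n] one[of n] by linarith+
  have inv: "(\<lambda>n. 1 / real (Suc n)) \<longlonglongrightarrow> 0"
    using LIMSEQ_inverse_real_of_nat by (simp add: inverse_eq_divide)
  have sub: "filterlim (\<lambda>n. Suc (q n)) at_top sequentially" "(\<lambda>n. 1 / real (Suc (q n))) \<longlonglongrightarrow> 0"
    if "strict_mono q" for q :: "nat \<Rightarrow> nat"
    using filterlim_compose[OF filterlim_Suc filterlim_subseq[OF that]]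
      LIMSEQ_subseq_LIMSEQ[OF inv that] by (simp_all add: o_def)
  obtain r1 \<gamma>' v' where r1: "strict_mono (r1 :: nat \<Rightarrow> nat)" "el_solution a \<gamma>' v'"
    "(\<lambda>n. act (Suc (s (r1 n))) (y (s (r1 n)))) \<longlonglongrightarrow> L (\<gamma>' 0, v' 0)"
    by (rule solution_of_almost_critical[OF a sub(1)[OF s(1)] zero_less_Suc y(1) K(2) y(3) sub(2)[OF s(1)] conserve l]) blast+
  have s1: "strict_mono (\<lambda>n. s (r1 n))"
    using strict_mono_o[OF s(1) r1(1)] by (simp add: o_def)
  \<comment> \<open>The second subsequence is extracted from the first, so that both actions
    converge along the same indices.\<close>
  obtain r2 \<gamma> v where r2: "strict_mono (r2 :: nat \<Rightarrow> nat)" "el_solution a \<gamma> v"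
    "(\<lambda>n. act (Suc (s (r1 (r2 n)))) (x (s (r1 (r2 n))))) \<longlonglongrightarrow> L (\<gamma> 0, v 0)"
    by (rule solution_of_almost_critical[OF a sub(1)[OF s1] zero_less_Suc x(1) K(1) x(3) sub(2)[OF s1] conserve l]) blast+
  let ?q = "\<lambda>n. s (r1 (r2 n))"
  have q: "strict_mono ?q"
    using strict_mono_o[OF s1 r2(1)] by (simp add: o_def)
  have "(\<lambda>n. act (Suc (?q n)) (y (?q n)) - act (Suc (?q n)) (x (?q n))) \<longlonglongrightarrow> L (\<gamma>' 0, v' 0) - L (\<gamma> 0, v 0)"
    using LIMSEQ_subseq_LIMSEQ[OF r1(3) r2(1)] by (intro tendsto_diff r2(3)) (simp add: o_def)
  moreover have "(\<lambda>n. e0 - 2 * (1 / real (Suc (?q n)))) \<longlonglongrightarrow> e0 - 2 * 0"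
    by (intro tendsto_intros sub(2)[OF q])
  moreover have "e0 - 2 * (1 / real (Suc (?q n))) \<le> act (Suc (?q n)) (y (?q n)) - act (Suc (?q n)) (x (?q n))" for n
  proof -
    have "e0 \<le> ?M (?q n) - ?m (?q n)"
      using s(2)[of "r1 (r2 n)"] by (simp add: S_def)
    then show ?thesis
      using x(2)[of "?q n"] y(2)[of "?q n"] by linarith
  qed
  ultimately have "e0 - 2 * 0 \<le> L (\<gamma>' 0, v' 0) - L (\<gamma> 0, v 0)"
    by (intro tendsto_le[OF sequentially_bot]) (auto intro: always_eventually)
  then show thesis
    using e0(1) by (intro that[OF r2(2) r1(2)]) auto
qed

end

section \<open>The energy of a Finsler metric\<close>

lemma linear_eq_inner:
  fixes g :: "'a::euclidean_space \<Rightarrow> real"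
  assumes "linear g"
  shows "g w = (\<Sum>b\<in>Basis. g b *\<^sub>R b) \<bullet> w"
proof -
  have "g (\<Sum>b\<in>Basis. (w \<bullet> b) *\<^sub>R b) = (\<Sum>b\<in>Basis. g b *\<^sub>R b) \<bullet> w"
    by (simp add: linear_sum[OF assms] linear_scale[OF assms] inner_sum_left inner_commute[of w] mult.commute)
  then show ?thesis by (simp add: euclidean_representation)
qed

locale finsler =
  fixes F :: finsler
  assumes F: "finsler_metric F"
begin

definition L :: "(real^2) \<times> (real^2) \<Rightarrow> real" where
  "L z = (F z)\<^sup>2 / 2"

definition Q :: "(real^2) \<times> (real^2) \<Rightarrow> real^2" where
  "Q z = (\<Sum>b\<in>Basis. dir_deriv (b, 0) L z *\<^sub>R b)"

definition P :: "(real^2) \<times> (real^2) \<Rightarrow> real^2" where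
  "P z = (\<Sum>b\<in>Basis. dir_deriv (0, b) L z *\<^sub>R b)"

abbreviation \<Omega> :: "((real^2) \<times> (real^2)) set" where
  "\<Omega> \<equiv> UNIV \<times> - {0}"

lemma open_\<Omega>: "open \<Omega>"
  by (intro open_Times) auto

lemma in_\<Omega>: "z \<in> \<Omega> \<longleftrightarrow> snd z \<noteq> 0"
  by (cases z) auto

lemmas F_unfolded = F[unfolded finsler_metric_def]

lemma F_smooth: "smooth_on \<Omega> F"
  by (rule F_unfolded[THEN conjunct2, THEN conjunct1])

lemma F_periodic: "periodic (\<lambda>x. F (x, v))"
  by (rule F_unfolded[THEN conjunct1, rule_format])

lemma F_pos: "v \<noteq> 0 \<Longrightarrow> F (x, v) > 0"
  by (rule F_unfolded[THEN conjunct2, THEN conjunct2, THEN conjunct1, rule_format])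

lemma F_hom: "c \<ge> 0 \<Longrightarrow> F (x, c *\<^sub>R v) = c * F (x, v)"
  by (rule F_unfolded[THEN conjunct2, THEN conjunct2, THEN conjunct2, THEN conjunct1, rule_format])

lemma F_hess: "v \<noteq> 0 \<Longrightarrow> w \<noteq> 0 \<Longrightarrow> iterated_deriv [(0, w), (0, w)] (squared F) (x, v) > 0"
  by (rule F_unfolded[THEN conjunct2, THEN conjunct2, THEN conjunct2, THEN conjunct2, rule_format])

lemma L_smooth: "smooth_on \<Omega> L"
proof -
  have "smooth_on \<Omega> (\<lambda>z. (1 / 2) * (F z * F z))"
    by (intro smooth_on_mult open_\<Omega> F_smooth smooth_on_const)
  then show ?thesis
    by (simp add: L_def[abs_def] power2_eq_square)
qed

lemma L_periodic: "periodic (\<lambda>x. L (x, v))"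
  using F_periodic by (simp add: L_def periodic_def)

lemma L_hom: "c \<ge> 0 \<Longrightarrow> L (x, c *\<^sub>R v) = c\<^sup>2 * L (x, v)"
  by (simp add: L_def F_hom power_mult_distrib)

lemma L_pos: "v \<noteq> 0 \<Longrightarrow> L (x, v) > 0"
  using F_pos[of v x] by (simp add: L_def)

text \<open>On the zero section, where smoothness is not assumed, homogeneity gives a quadratic
  bound and hence derivative 0.\<close>

lemma L_differentiable: "(L has_derivative frechet_derivative L (at z)) (at z)"
proof (cases "snd z = 0")
  case False
  then show ?thesis
    by (intro smooth_on_has_derivative[OF L_smooth open_\<Omega>]) (simp add: in_\<Omega>)
next
  case True
  have "continuous_on (UNIV \<times> sphere 0 1) L"
    using differentiable_imp_continuous_on[OF smooth_on_differentiable[OF L_smooth]]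
    by (rule continuous_on_subset) auto
  then obtain C where C: "C > 0" "\<And>x v. norm (L (x, v)) \<le> C * norm v ^ 2"
    by (rule homogeneous_bounded[OF _ L_periodic, where k = 2]) (simp_all add: L_hom)
  have "L z = 0"
    using C(2)[of "fst z" "snd z"] True by (cases z) simp
  have "(L has_derivative (\<lambda>h. 0)) (at z)"
    unfolding has_derivative_within_alt
  proof (intro conjI allI impI)
    fix e :: real assume "e > 0"
    show "\<exists>d>0. \<forall>y\<in>UNIV. norm (y - z) < d \<longrightarrow> norm (L y - L z - 0) \<le> e * norm (y - z)"
    proof (intro exI[of _ "e / C"] conjI ballI impI)
      fix y assume y: "norm (y - z) < e / C"
      have "norm (snd (y - z)) \<le> norm (fst (y - z), snd (y - z))"
        by (rule norm_snd_le)
      then have "norm (snd (y - z)) \<le> norm (y - z)"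
        by (simp only: prod.collapse)
      then have "norm (snd y) \<le> norm (y - z)"
        using True by simp
      then have "C * norm (snd y) ^ 2 \<le> C * norm (y - z) ^ 2"
        using C(1) by (intro mult_left_mono power_mono) auto
      also have "\<dots> = (C * norm (y - z)) * norm (y - z)"
        by (simp add: power2_eq_square)
      also have "\<dots> \<le> e * norm (y - z)"
        using y C(1) by (intro mult_right_mono) (auto simp: field_simps)
      finally show "norm (L y - L z - 0) \<le> e * norm (y - z)"
        using C(2)[of "fst y" "snd y"] \<open>L z = 0\<close> by simp
    qed (use \<open>e > 0\<close> C in simp)
  qed simp
  then show ?thesis
    by (metis differentiableI frechet_derivative_works)
qed

lemma L_deriv: "(L has_derivative (\<lambda>h. Q z \<bullet> fst h + P z \<bullet> snd h)) (at z)"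
proof -
  interpret D: bounded_linear "frechet_derivative L (at z)"
    by (rule has_derivative_bounded_linear[OF L_differentiable])
  have "dir_deriv h L z = Q z \<bullet> fst h + P z \<bullet> snd h" for h
  proof -
    have lin: "linear (\<lambda>w. frechet_derivative L (at z) (w, 0::real^2))" "linear (\<lambda>w. frechet_derivative L (at z) (0::real^2, w))"
      using D.add[of "(_, 0)" "(_, 0)"] D.scaleR[of _ "(_, 0)"] D.add[of "(0, _)" "(0, _)"] D.scaleR[of _ "(0, _)"]
      by (auto intro!: linearI)
    have "dir_deriv (fst h, 0) L z = Q z \<bullet> fst h" "dir_deriv (0, snd h) L z = P z \<bullet> snd h"
      unfolding Q_def P_def by (rule linear_eq_inner[OF lin(1)], rule linear_eq_inner[OF lin(2)])
    then show ?thesis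
      using D.add[of "(fst h, 0)" "(0, snd h)"] by simp
  qed
  then have "frechet_derivative L (at z) = (\<lambda>h. Q z \<bullet> fst h + P z \<bullet> snd h)"
    by (rule ext)
  then show ?thesis
    using L_differentiable[of z] by (simp only:)
qed

text \<open>Lets the translation and scaling rules for \<open>Q\<close> and \<open>P\<close> be read
  off by differentiating those of \<open>L\<close>.\<close>

lemma PQ_unique:
  assumes "(L has_derivative (\<lambda>h. q \<bullet> fst h + p \<bullet> snd h)) (at z)"
  shows "Q z = q" "P z = p"
proof -
  have "(\<lambda>h. Q z \<bullet> fst h + P z \<bullet> snd h) = (\<lambda>h. q \<bullet> fst h + p \<bullet> snd h)"
    by (rule has_derivative_unique[OF L_deriv assms])
  then have *: "Q z \<bullet> fst h + P z \<bullet> snd h = q \<bullet> fst h + p \<bullet> snd h" for h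
    by meson
  have "Q z \<bullet> w = q \<bullet> w" "P z \<bullet> w = p \<bullet> w" for w
    using *[of "(w, 0)"] *[of "(0, w)"] by simp_all
  then show "Q z = q" "P z = p"
    using vector_eq_rdot by blast+
qed

lemma dir_deriv_L: "dir_deriv (0, b) L z = P z \<bullet> b" "dir_deriv (b, 0) L z = Q z \<bullet> b"
  unfolding frechet_derivative_at[OF L_deriv, symmetric] by simp_all

lemma PQ_translate:
  assumes "n \<in> lattice"
  shows "Q (x + n, v) = Q (x, v)" "P (x + n, v) = P (x, v)"
proof -
  have "((\<lambda>y. L (y + (n, 0))) has_derivative
      (\<lambda>h. Q ((x, v) + (n, 0)) \<bullet> fst h + P ((x, v) + (n, 0)) \<bullet> snd h)) (at (x, v))"
    by (rule has_derivative_compose[where f = "\<lambda>y. y + (n, 0)" and g = L, OF _ L_deriv])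
       (auto intro!: derivative_eq_intros)
  then have "((\<lambda>y. L (y + (n, 0))) has_derivative (\<lambda>h. Q (x + n, v) \<bullet> fst h + P (x + n, v) \<bullet> snd h)) (at (x, v))"
    by simp
  moreover have "(\<lambda>y. L (y + (n, 0))) = L"
    using periodic_lattice[OF L_periodic assms] by (auto simp: fun_eq_iff)
  ultimately have "(L has_derivative (\<lambda>h. Q (x + n, v) \<bullet> fst h + P (x + n, v) \<bullet> snd h)) (at (x, v))"
    by simp
  from PQ_unique[OF this] show "Q (x + n, v) = Q (x, v)" "P (x + n, v) = P (x, v)"
    by simp_all
qed

lemma PQ_scale:
  assumes "c > 0"
  shows "Q (x, c *\<^sub>R v) = c\<^sup>2 *\<^sub>R Q (x, v)" "P (x, c *\<^sub>R v) = c *\<^sub>R P (x, v)"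
proof -
  have eq: "L y = c\<^sup>2 * L (fst y, inverse c *\<^sub>R snd y)" for y
    using L_hom[of c "fst y" "inverse c *\<^sub>R snd y"] assms by simp
  have "((\<lambda>y. L (fst y, inverse c *\<^sub>R snd y)) has_derivative
      (\<lambda>h. Q (x, v) \<bullet> fst (fst h, inverse c *\<^sub>R snd h) + P (x, v) \<bullet> snd (fst h, inverse c *\<^sub>R snd h))) (at (x, c *\<^sub>R v))"
    by (rule has_derivative_compose[where f = "\<lambda>y. (fst y, inverse c *\<^sub>R snd y)"])
       (use assms L_deriv[of "(x, v)"] in \<open>auto intro!: derivative_eq_intros\<close>)
  then have "((\<lambda>y. c\<^sup>2 * L (fst y, inverse c *\<^sub>R snd y)) has_derivative
      (\<lambda>h. c\<^sup>2 * (Q (x, v) \<bullet> fst h + P (x, v) \<bullet> (inverse c *\<^sub>R snd h)))) (at (x, c *\<^sub>R v))"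
    by (intro has_derivative_mult_right) simp
  moreover have "(\<lambda>h. c\<^sup>2 * (Q (x, v) \<bullet> fst h + P (x, v) \<bullet> (inverse c *\<^sub>R snd h)))
      = (\<lambda>h. (c\<^sup>2 *\<^sub>R Q (x, v)) \<bullet> fst h + (c *\<^sub>R P (x, v)) \<bullet> snd h)"
    using assms by (auto simp: fun_eq_iff field_simps power2_eq_square)
  ultimately have "(L has_derivative (\<lambda>h. (c\<^sup>2 *\<^sub>R Q (x, v)) \<bullet> fst h + (c *\<^sub>R P (x, v)) \<bullet> snd h)) (at (x, c *\<^sub>R v))"
    by (simp only: eq[symmetric])
  from PQ_unique[OF this] show "Q (x, c *\<^sub>R v) = c\<^sup>2 *\<^sub>R Q (x, v)" "P (x, c *\<^sub>R v) = c *\<^sub>R P (x, v)"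
    by simp_all
qed

lemma PQ_zero: "Q (x, 0) = 0" "P (x, 0) = 0"
proof -
  have "Q (x, 0) = 4 *\<^sub>R Q (x, 0)" "P (x, 0) = 2 *\<^sub>R P (x, 0)"
    using PQ_scale[of 2 x 0] by simp_all
  then show "Q (x, 0) = 0" "P (x, 0) = 0"
    using scaleR_cancel_right[of 4 "Q (x, 0)" 1] scaleR_cancel_right[of 2 "P (x, 0)" 1] by simp_all
qed

lemma PQ_hom:
  assumes "c \<ge> 0"
  shows "Q (x, c *\<^sub>R v) = c\<^sup>2 *\<^sub>R Q (x, v)" "P (x, c *\<^sub>R v) = c *\<^sub>R P (x, v)"
proof -
  consider "c = 0" | "c > 0" using assms by linarith
  then show "Q (x, c *\<^sub>R v) = c\<^sup>2 *\<^sub>R Q (x, v)" "P (x, c *\<^sub>R v) = c *\<^sub>R P (x, v)"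
    by (cases; simp only: PQ_scale; simp add: PQ_zero)+
qed

lemma P_smooth: "smooth_on \<Omega> P" and Q_smooth: "smooth_on \<Omega> Q"
  unfolding P_def[abs_def] Q_def[abs_def]
  by (intro smooth_on_sum smooth_on_scaleR smooth_on_dir_deriv smooth_on_const L_smooth open_\<Omega> finite_Basis)+

lemma P_periodic: "periodic (\<lambda>x. P (x, v))" and Q_periodic: "periodic (\<lambda>x. Q (x, v))"
  using PQ_translate by (auto simp: periodic_def lattice_def)

lemma P_cont: "continuous_on UNIV P"
proof (rule homogeneous_continuous[where k = 1])
  show "continuous_on \<Omega> P"
    by (intro differentiable_imp_continuous_on smooth_on_differentiable P_smooth)
qed (simp_all add: P_periodic PQ_hom)

lemma Q_cont: "continuous_on UNIV Q"
proof (rule homogeneous_continuous[where k = 2])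
  show "continuous_on \<Omega> Q"
    by (intro differentiable_imp_continuous_on smooth_on_differentiable Q_smooth)
qed (simp_all add: Q_periodic PQ_hom)

lemma P_deriv: "snd z \<noteq> 0 \<Longrightarrow> (P has_derivative frechet_derivative P (at z)) (at z)"
  by (intro smooth_on_has_derivative[OF P_smooth open_\<Omega>]) (simp add: in_\<Omega>)

lemma P_hess:
  assumes "snd z \<noteq> 0" "w \<noteq> 0"
  shows "dir_deriv (0, w) P z \<bullet> w > 0"
proof -
  have eq: "dir_deriv (0, w) (squared F) y = 2 * (P y \<bullet> w)" for y
  proof -
    have "((\<lambda>y. 2 * L y) has_derivative (\<lambda>h. 2 * frechet_derivative L (at y) h)) (at y)"
      by (intro has_derivative_mult_right L_differentiable)
    then have "(squared F has_derivative (\<lambda>h. 2 * frechet_derivative L (at y) h)) (at y)"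
      by (simp add: L_def)
    from frechet_derivative_at[OF this, symmetric] show ?thesis
      by (simp add: dir_deriv_L)
  qed
  have "((\<lambda>y. 2 * (P y \<bullet> w)) has_derivative (\<lambda>h. 2 * (dir_deriv h P z \<bullet> w))) (at z)"
    by (intro has_derivative_mult_right has_derivative_inner_left P_deriv assms)
  from frechet_derivative_at[OF this, symmetric]
  have "iterated_deriv [(0, w), (0, w)] (squared F) z = 2 * (dir_deriv (0, w) P z \<bullet> w)"
    by (simp add: eq)
  then show ?thesis
    using F_hess[OF assms, of "fst z"] by (simp del: iterated_deriv.simps)
qed

lemma P_inj:
  assumes eq: "P (x, v) = P (x, w)" shows "v = w"
proof (rule ccontr)
  assume ne: "v \<noteq> w"
  define u where "u = v - w"
  have u: "u \<noteq> 0" using ne by (simp add: u_def)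
  show False
  proof (cases "\<exists>s\<in>{0..1}. w + s *\<^sub>R u = 0")
    case False
    define f where "f s = P (x, w + s *\<^sub>R u) \<bullet> u" for s
    have deriv: "(f has_real_derivative dir_deriv (0, u) P (x, w + s *\<^sub>R u) \<bullet> u) (at s)" if "s \<in> {0..1}" for s
    proof -
      have nz: "snd (x, w + s *\<^sub>R u) \<noteq> 0" using False that by auto
      interpret D: bounded_linear "frechet_derivative P (at (x, w + s *\<^sub>R u))"
        by (rule has_derivative_bounded_linear[OF P_deriv[OF nz]])
      have "((\<lambda>s. P (x, w + s *\<^sub>R u)) has_derivative (\<lambda>h. dir_deriv (0, h *\<^sub>R u) P (x, w + s *\<^sub>R u))) (at s)"
        by (rule has_derivative_compose[where f = "\<lambda>s. (x, w + s *\<^sub>R u)", OF _ P_deriv[OF nz]])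
           (auto intro!: derivative_eq_intros)
      then have "(f has_derivative (\<lambda>h. dir_deriv (0, h *\<^sub>R u) P (x, w + s *\<^sub>R u) \<bullet> u)) (at s)"
        unfolding f_def[abs_def] by (rule has_derivative_inner_left)
      then show ?thesis
        by (rule has_derivative_imp_has_field_derivative) (use D.scaleR[of _ "(0, u)"] in simp)
    qed
    have "f 0 < f 1"
    proof (rule DERIV_pos_imp_increasing[of 0 1 f])
      fix s :: real assume s: "0 \<le> s" "s \<le> 1"
      have "snd (x, w + s *\<^sub>R u) \<noteq> 0" using False s by auto
      from P_hess[OF this u] deriv[of s] s
      show "\<exists>y. (f has_real_derivative y) (at s) \<and> 0 < y" by auto
    qed simp
    then show False
      using eq by (simp add: f_def u_def)
  next
    case True
    \<comment> \<open>Now \<open>v\<close> and \<open>w\<close> point in opposite directions, or one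
      of them is 0. Pairing with the common momentum shows that a convex combination of their two
      energies vanishes.\<close>
    then obtain s where s: "0 \<le> s" "s \<le> 1" "(1 - s) *\<^sub>R w = - (s *\<^sub>R v)"
      by (auto simp: u_def algebra_simps add_eq_0_iff2)
    have L2: "P (x, v) \<bullet> v = 2 * L (x, v)" "P (x, v) \<bullet> w = 2 * L (x, w)"
      using euler_homogeneous[OF L_deriv L_hom, of x v] euler_homogeneous[OF L_deriv L_hom, of x w] eq by simp_all
    have "(1 - s) * (P (x, v) \<bullet> w) = - (s * (P (x, v) \<bullet> v))"
      using arg_cong[OF s(3), of "\<lambda>y. P (x, v) \<bullet> y"] by simp
    then have sum: "(1 - s) * L (x, w) + s * L (x, v) = 0"
      unfolding L2 by (simp add: algebra_simps)
    have nonneg: "L (x, w) \<ge> 0" "L (x, v) \<ge> 0" by (simp_all add: L_def)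
    have "(1 - s) * L (x, w) \<ge> 0" "s * L (x, v) \<ge> 0"
      using nonneg s(1,2) by auto
    with sum have "(1 - s) * L (x, w) = 0" "s * L (x, v) = 0"
      by linarith+
    then have "s = 1 \<or> w = 0" "s = 0 \<or> v = 0"
      using L_pos[of w x] L_pos[of v x] by auto
    then have "v = 0 \<or> w = 0" by auto
    then have "P (x, v) = 0" using eq PQ_zero[of x] by auto
    then have "L (x, v) = 0" "L (x, w) = 0" using L2 by auto
    then have "v = 0" "w = 0"
      using L_pos[of w x] L_pos[of v x] by auto
    then show False using ne by simp
  qed
qed

sublocale lagrangian L P Q
proof
  show "(L has_derivative (\<lambda>h. Q z \<bullet> fst h + P z \<bullet> snd h)) (at z)" for z
    by (rule L_deriv)
qed (fact P_cont Q_cont L_periodic P_periodic Q_periodic L_hom PQ_hom L_pos P_inj)+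

end

section \<open>Regularity of solutions\<close>

lemma smooth_on_nth:
  "open S \<Longrightarrow> smooth_on S f \<Longrightarrow> smooth_on S (\<lambda>z. (f z :: real^'n) $ i)"
  by (rule smooth_on_bounded_linear[OF _ bounded_linear_vec_nth])

context finsler
begin

text \<open>The velocity is \<open>W\<close> applied to position and momentum, both differentiable
  in time. As a continuous inverse, \<open>W\<close> is differentiable where the derivative of the
  Legendre map is invertible, which holds at nonzero velocity.\<close>

lemma velocity_differentiable:
  assumes sol: "el_solution a \<gamma> v" and nz: "v t \<noteq> 0"
  obtains v' where "(v has_vector_derivative v') (at t)"
proof -
  let ?z = "(\<gamma> t, v t)"
  let ?\<Phi> = "\<lambda>z. (fst z, P z)" and ?\<Psi> = "\<lambda>y. (fst y, W y)"
  let ?D = "\<lambda>h. (fst h, frechet_derivative P (at ?z) h)"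
  have nz': "snd ?z \<noteq> 0" using nz by simp
  interpret D: bounded_linear "frechet_derivative P (at ?z)"
    by (rule has_derivative_bounded_linear[OF P_deriv[OF nz']])
  have lin: "linear ?D"
    by (intro linearI) (simp_all add: D.add D.scaleR)
  have "inj ?D"
    unfolding linear_injective_0[OF lin]
  proof (intro allI impI)
    fix h assume h: "?D h = 0"
    then have "dir_deriv (0, snd h) P ?z = 0" by (cases h) (simp add: zero_prod_def)
    then have "snd h = 0" using P_hess[OF nz', of "snd h"] by auto
    then show "h = 0" using h by (simp add: prod_eq_iff)
  qed
  then obtain g where g: "linear g" "g \<circ> ?D = id"
    using linear_injective_left_inverse[OF lin] by blast
  let ?y = "(\<gamma> t, P ?z)"
  have cont\<Psi>: "continuous_on UNIV ?\<Psi>"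
    by (intro continuous_on_Pair continuous_on_fst continuous_on_id W_cont)
  have "(?\<Psi> has_derivative g) (at ?y)"
  proof (rule has_derivative_inverse_basic[where f = ?\<Phi> and T = UNIV])
    have eq: "?\<Psi> ?y = ?z" by (simp add: W_P)
    show "(?\<Phi> has_derivative ?D) (at (?\<Psi> ?y))"
      unfolding eq by (intro has_derivative_Pair has_derivative_fst has_derivative_ident P_deriv nz')
    show "bounded_linear g" using g(1) by (simp add: linear_conv_bounded_linear)
    show "continuous (at ?y) ?\<Psi>"
      using cont\<Psi> by (simp add: continuous_on_eq_continuous_at)
    show "?\<Phi> (?\<Psi> y) = y" for y
      using P_W[of "fst y" "snd y"] by simp
  qed (use g in auto)
  moreover have "((\<lambda>t. (\<gamma> t, P (\<gamma> t, v t))) has_vector_derivative (v t, Q ?z)) (at t)"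
    using sol by (intro has_vector_derivative_Pair) (auto simp: el_solution_def)
  ultimately have "((\<lambda>t. ?\<Psi> (\<gamma> t, P (\<gamma> t, v t))) has_derivative (\<lambda>h. g (h *\<^sub>R (v t, Q ?z)))) (at t)"
    unfolding has_vector_derivative_def
    by (rule has_derivative_compose[where g = ?\<Psi>, rotated])
  then have "((\<lambda>t. (\<gamma> t, v t)) has_derivative (\<lambda>h. h *\<^sub>R g (v t, Q ?z))) (at t)"
    by (simp only: fst_conv W_P linear_scale[OF g(1)])
  then have "(v has_derivative (\<lambda>h. h *\<^sub>R snd (g (v t, Q ?z)))) (at t)"
    using has_derivative_snd[of "\<lambda>t. (\<gamma> t, v t)"] by fastforce
  then show thesis
    by (intro that) (simp add: has_vector_derivative_def)
qed

text \<open>Differentiating \<open>L\<close> directly and differentiating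
  \<open>2 * L = P \<bullet> v\<close> with the Euler-Lagrange equation give the same value for
  \<open>L\<close> and for \<open>2 * L\<close>, so it is 0. Since the velocity is known to be
  differentiable only where it is nonzero, a clopen argument spreads a positive energy over the
  line.\<close>

lemma energy_conservation:
  assumes sol: "el_solution a \<gamma> v"
  shows "\<exists>E. \<forall>t. L (\<gamma> t, v t) = E"
proof -
  let ?f = "\<lambda>t. L (\<gamma> t, v t)"
  have \<gamma>: "(\<gamma> has_vector_derivative v t) (at t)" "((\<lambda>t. P (\<gamma> t, v t)) has_vector_derivative Q (\<gamma> t, v t)) (at t)" for t
    using sol by (auto simp: el_solution_def)
  have cont\<gamma>: "continuous_on UNIV \<gamma>"
    using \<gamma>(1) by (intro continuous_at_imp_continuous_on) (auto dest: has_vector_derivative_continuous)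
  have cont: "continuous_on UNIV ?f"
    using sol by (intro continuous_on_compose2[OF L_cont] continuous_on_Pair cont\<gamma>) (auto simp: el_solution_def)
  have deriv: "(?f has_real_derivative 0) (at t)" if "?f t > 0" for t
  proof -
    have nz: "v t \<noteq> 0" using that L_0 by auto
    then obtain v' where v': "(v has_vector_derivative v') (at t)"
      using velocity_differentiable[OF sol] by blast
    have "((\<lambda>t. (\<gamma> t, v t)) has_derivative (\<lambda>h. (h *\<^sub>R v t, h *\<^sub>R v'))) (at t)"
      using has_derivative_Pair[OF \<gamma>(1)[of t, unfolded has_vector_derivative_def] v'[unfolded has_vector_derivative_def]] .
    from has_derivative_compose[OF this L_deriv]
    have 1: "(?f has_real_derivative Q (\<gamma> t, v t) \<bullet> v t + P (\<gamma> t, v t) \<bullet> v') (at t)"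
      by (rule has_derivative_imp_has_field_derivative) (simp add: algebra_simps)
    have "((\<lambda>t. P (\<gamma> t, v t) \<bullet> v t) has_derivative
        (\<lambda>h. P (\<gamma> t, v t) \<bullet> (h *\<^sub>R v') + (h *\<^sub>R Q (\<gamma> t, v t)) \<bullet> v t)) (at t)"
      using has_derivative_inner[OF \<gamma>(2)[of t, unfolded has_vector_derivative_def] v'[unfolded has_vector_derivative_def]] .
    then have "((\<lambda>t. 2 * ?f t) has_real_derivative Q (\<gamma> t, v t) \<bullet> v t + P (\<gamma> t, v t) \<bullet> v') (at t)"
      unfolding P_snd by (rule has_derivative_imp_has_field_derivative) (simp add: algebra_simps)
    moreover have "((\<lambda>t. 2 * ?f t) has_real_derivative 2 * (Q (\<gamma> t, v t) \<bullet> v t + P (\<gamma> t, v t) \<bullet> v')) (at t)"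
      by (rule DERIV_cmult[OF 1])
    ultimately have "Q (\<gamma> t, v t) \<bullet> v t + P (\<gamma> t, v t) \<bullet> v' = 0"
      by (auto dest: DERIV_unique)
    with 1 show ?thesis by simp
  qed
  show ?thesis
  proof (cases "\<exists>t0. ?f t0 > 0")
    case False
    then have "?f t = 0" for t using L_nonneg[of "(\<gamma> t, v t)"] by (auto simp: not_less intro: antisym)
    then show ?thesis by blast
  next
    case True
    then obtain t0 where t0: "?f t0 > 0" by blast
    define S where "S = {t. ?f t = ?f t0}"
    have "closed S"
      unfolding S_def by (intro closed_Collect_eq cont continuous_on_const)
    moreover have "open S"
      unfolding open_dist
    proof
      fix t assume "t \<in> S"
      then have eq: "?f t = ?f t0" by (simp add: S_def)
      have "open {s. 0 < ?f s}"
        by (intro open_Collect_less cont continuous_on_const)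
      moreover have "t \<in> {s. 0 < ?f s}" using eq t0 by simp
      ultimately obtain d where d: "d > 0" "ball t d \<subseteq> {s. 0 < ?f s}"
        using openE by blast
      have "\<exists>c. \<forall>s\<in>ball t d. ?f s = c"
      proof (rule has_field_derivative_zero_constant)
        fix s assume "s \<in> ball t d"
        then have "?f s > 0" using d(2) by blast
        then show "(?f has_real_derivative 0) (at s within ball t d)"
          by (rule has_field_derivative_at_within[OF deriv])
      qed simp
      then have "?f s = ?f t" if "s \<in> ball t d" for s
        using that d(1) by (metis centre_in_ball)
      then show "\<exists>d>0. \<forall>s. dist s t < d \<longrightarrow> s \<in> S"
        using d(1) eq by (intro exI[of _ d]) (auto simp: S_def dist_commute)
    qed
    moreover have "t0 \<in> S" by (simp add: S_def)
    ultimately have "S = UNIV" using clopen[of S] by blast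
    then show ?thesis unfolding S_def by blast
  qed
qed

text \<open>The acceleration as a function of position and velocity, obtained by solving the
  differentiated Legendre relation by Cramer's rule.\<close>

definition "A1 z = dir_deriv (0, axis 1 1) P z"
definition "A2 z = dir_deriv (0, axis 2 1) P z"
definition "rhs z = Q z - dir_deriv (snd z, 0) P z"
definition "det2 z = A1 z $ 1 * A2 z $ 2 - A1 z $ 2 * A2 z $ 1"
definition "accel z = (inverse (det2 z) * (rhs z $ 1 * A2 z $ 2 - rhs z $ 2 * A2 z $ 1)) *\<^sub>R axis 1 (1::real)
   + (inverse (det2 z) * (A1 z $ 1 * rhs z $ 2 - A1 z $ 2 * rhs z $ 1)) *\<^sub>R axis (2::2) 1"

lemma dir_deriv_P_snd:
  assumes "snd z \<noteq> 0"
  shows "dir_deriv (0, w) P z = w $ 1 *\<^sub>R A1 z + w $ 2 *\<^sub>R A2 z"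
proof -
  interpret D: bounded_linear "frechet_derivative P (at z)"
    by (rule has_derivative_bounded_linear[OF P_deriv[OF assms]])
  have "(0::real^2, w) = w $ 1 *\<^sub>R (0, axis 1 1) + w $ 2 *\<^sub>R (0, axis 2 1)"
    by (auto simp: vec_eq_iff forall_2 axis_def)
  then show ?thesis
    by (simp add: A1_def A2_def D.add D.scaleR flip: scaleR_Pair)
qed

lemma det2_nonzero:
  assumes z: "snd z \<noteq> 0"
  shows "det2 z \<noteq> 0"
proof
  assume 0: "det2 z = 0"
  have *: "w = 0" if "w $ 1 *\<^sub>R A1 z + w $ 2 *\<^sub>R A2 z = 0" for w :: "real^2"
    using P_hess[OF z, of w] that by (auto simp: dir_deriv_P_snd[OF z])
  \<comment> \<open>With a vanishing determinant both vectors lie in the kernel of the fibre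
    Hessian, which is trivial. Up to sign their entries are those of the Hessian, so it would be
    0.\<close>
  define w1 w2 :: "real^2" where "w1 = vector [A2 z $ 1, - (A1 z $ 1)]" and "w2 = vector [A2 z $ 2, - (A1 z $ 2)]"
  have "w1 $ 1 *\<^sub>R A1 z + w1 $ 2 *\<^sub>R A2 z = 0" "w2 $ 1 *\<^sub>R A1 z + w2 $ 2 *\<^sub>R A2 z = 0"
    using 0 by (simp_all add: w1_def w2_def vec_eq_iff forall_2 det2_def vector_2 algebra_simps)
  then have "w1 = 0" "w2 = 0" using * by blast+
  then have "A1 z = 0" "A2 z = 0"
    by (simp_all add: w1_def w2_def vec_eq_iff forall_2 vector_2)
  then have "axis 1 1 = (0::real^2)"
    using *[of "axis 1 1"] by simp
  then show False by (simp add: axis_eq_0_iff)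
qed

lemma accel_unique:
  assumes z: "snd z \<noteq> 0" and w: "dir_deriv (0, w) P z = rhs z"
  shows "w = accel z"
proof -
  have "rhs z $ 1 = w $ 1 * A1 z $ 1 + w $ 2 * A2 z $ 1" "rhs z $ 2 = w $ 1 * A1 z $ 2 + w $ 2 * A2 z $ 2"
    using w[symmetric] by (simp_all add: dir_deriv_P_snd[OF z])
  then have "rhs z $ 1 * A2 z $ 2 - rhs z $ 2 * A2 z $ 1 = det2 z * w $ 1"
    "A1 z $ 1 * rhs z $ 2 - A1 z $ 2 * rhs z $ 1 = det2 z * w $ 2"
    by (simp_all add: det2_def algebra_simps)
  then show ?thesis
    using det2_nonzero[OF z] by (simp add: accel_def vec_eq_iff forall_2 axis_def)
qed

lemma accel_smooth: "smooth_on \<Omega> accel"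
proof -
  have A: "smooth_on \<Omega> A1" "smooth_on \<Omega> A2"
    unfolding A1_def[abs_def] A2_def[abs_def] by (intro smooth_on_dir_deriv open_\<Omega> P_smooth)+
  have "smooth_on \<Omega> (\<lambda>z. (snd z, 0) :: (real^2) \<times> (real^2))"
    by (intro smooth_on_linear bounded_linear_Pair bounded_linear_snd bounded_linear_zero)
  then have R: "smooth_on \<Omega> rhs"
    unfolding rhs_def[abs_def]
    by (intro smooth_on_diff smooth_on_deriv_along open_\<Omega> P_smooth Q_smooth)
  have det: "smooth_on \<Omega> det2"
    unfolding det2_def[abs_def] by (intro smooth_on_diff smooth_on_mult smooth_on_nth open_\<Omega> A)
  show ?thesis
    unfolding accel_def[abs_def]
    by (intro smooth_on_add smooth_on_scaleR smooth_on_mult smooth_on_diff smooth_on_inverse smooth_on_nth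
        smooth_on_const open_\<Omega> A R det det2_nonzero) auto
qed

text \<open>\<open>a \<noteq> 0\<close> rules out constant curves, so the conserved energy is
  positive and the velocity never vanishes. Position and velocity then form an integral curve of the
  smooth field \<open>(snd z, accel z)\<close> off the zero section, and
  \<open>smooth_on_real_chain\<close> applies.\<close>

lemma solution_geodesic:
  assumes sol: "el_solution a \<gamma> v" and a: "a \<noteq> 0"
  shows "geodesic F \<gamma>" "\<And>t. v t \<noteq> 0"
proof -
  have \<gamma>: "(\<gamma> has_vector_derivative v t) (at t)" "((\<lambda>t. P (\<gamma> t, v t)) has_vector_derivative Q (\<gamma> t, v t)) (at t)" for t
    using sol by (auto simp: el_solution_def)
  obtain E where E: "\<And>t. L (\<gamma> t, v t) = E"
    using energy_conservation[OF sol] by blast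
  have "E > 0"
  proof (rule ccontr)
    assume "\<not> E > 0"
    then have "v t = 0" for t
      using E[of t] L_pos[of "v t" "\<gamma> t"] by auto
    then have "(\<gamma> has_derivative (\<lambda>h. 0)) (at t)" for t
      using \<gamma>(1)[of t] by (simp add: has_vector_derivative_def)
    then obtain c where "\<And>t. \<gamma> t = c"
      using has_derivative_zero_constant[of UNIV \<gamma>] by auto
    then show False
      using sol a by (auto simp: el_solution_def)
  qed
  show nz: "v t \<noteq> 0" for t
    using E[of t] \<open>E > 0\<close> L_0 by auto
  have v': "(v has_vector_derivative accel (\<gamma> t, v t)) (at t)" for t
  proof -
    let ?z = "(\<gamma> t, v t)"
    have nz': "snd ?z \<noteq> 0" using nz by simp
    interpret D: bounded_linear "frechet_derivative P (at ?z)"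
      by (rule has_derivative_bounded_linear[OF P_deriv[OF nz']])
    obtain w where w: "(v has_vector_derivative w) (at t)"
      using velocity_differentiable[OF sol nz] by blast
    have "((\<lambda>t. (\<gamma> t, v t)) has_derivative (\<lambda>h. (h *\<^sub>R v t, h *\<^sub>R w))) (at t)"
      using has_derivative_Pair[OF \<gamma>(1)[of t, unfolded has_vector_derivative_def] w[unfolded has_vector_derivative_def]] .
    from has_derivative_compose[OF this P_deriv[OF nz']]
    have "((\<lambda>t. P (\<gamma> t, v t)) has_derivative (\<lambda>h. h *\<^sub>R dir_deriv (v t, w) P ?z)) (at t)"
      by (simp only: D.scaleR flip: scaleR_Pair)
    then have "((\<lambda>t. P (\<gamma> t, v t)) has_vector_derivative dir_deriv (v t, w) P ?z) (at t)"
      by (simp only: has_vector_derivative_def)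
    then have "dir_deriv (v t, w) P ?z = Q ?z"
      using \<gamma>(2)[of t] vector_derivative_unique_at by blast
    moreover have "dir_deriv (v t, w) P ?z = dir_deriv (v t, 0) P ?z + dir_deriv (0, w) P ?z"
      using D.add[of "(v t, 0)" "(0, w)"] by simp
    ultimately have "dir_deriv (0, w) P ?z = rhs ?z"
      by (simp add: rhs_def algebra_simps)
    from accel_unique[OF nz' this] w show ?thesis by simp
  qed
  have "smooth_on \<Omega> (\<lambda>z. (snd z, 0) + (0, accel z))"
    by (intro smooth_on_add smooth_on_linear smooth_on_bounded_linear[OF _ _ accel_smooth] open_\<Omega>
        bounded_linear_Pair bounded_linear_snd bounded_linear_zero bounded_linear_ident)
  then have X: "smooth_on \<Omega> (\<lambda>z. (snd z, accel z))"
    by simp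
  have "smooth_on UNIV (\<lambda>t. fst (\<gamma> t, v t))"
  proof (rule smooth_on_real_chain[OF open_\<Omega> X _ _ smooth_on_linear[OF bounded_linear_fst]])
    show "((\<lambda>t. (\<gamma> t, v t)) has_vector_derivative (snd (\<gamma> t, v t), accel (\<gamma> t, v t))) (at t)" for t
      using has_vector_derivative_Pair[OF \<gamma>(1) v'] by simp
    show "(\<gamma> t, v t) \<in> \<Omega>" for t using nz by simp
  qed
  then have smooth: "smooth_on UNIV \<gamma>" by simp
  have vd: "vector_derivative \<gamma> (at t) = v t" for t
    by (rule vector_derivative_at[OF \<gamma>(1)])
  have "F (\<gamma> t, v t) = sqrt (2 * E)" for t
    using E[of t] F_pos[OF nz[of t], of "\<gamma> t"] by (intro real_sqrt_unique[symmetric]) (auto simp: L_def)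
  then have speed: "\<exists>c>0. \<forall>t. F (\<gamma> t, v t) = c"
    using \<open>E > 0\<close> by (intro exI[of _ "sqrt (2 * E)"]) auto
  have EL: "((\<lambda>s. iterated_deriv [(0, b)] (\<lambda>z. (F z)\<^sup>2 / 2) (\<gamma> s, v s)) has_real_derivative
              iterated_deriv [(b, 0)] (\<lambda>z. (F z)\<^sup>2 / 2) (\<gamma> t, v t)) (at t)" for b t
  proof -
    have "((\<lambda>s. P (\<gamma> s, v s) \<bullet> b) has_derivative (\<lambda>h. (h *\<^sub>R Q (\<gamma> t, v t)) \<bullet> b)) (at t)"
      by (rule has_derivative_inner_left[OF \<gamma>(2)[unfolded has_vector_derivative_def]])
    then have "((\<lambda>s. P (\<gamma> s, v s) \<bullet> b) has_real_derivative Q (\<gamma> t, v t) \<bullet> b) (at t)"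
      by (rule has_derivative_imp_has_field_derivative) simp
    then show ?thesis
      by (simp add: dir_deriv_L flip: L_def)
  qed
  show "geodesic F \<gamma>"
    unfolding geodesic_def Let_def vd using smooth speed EL by blast
qed

end

section \<open>Loops on the torus and their lifts\<close>

lemma cis_2pi_eq_iff: "cis (2 * pi * x) = cis (2 * pi * y) \<longleftrightarrow> x - y \<in> \<int>"
proof
  assume "cis (2 * pi * x) = cis (2 * pi * y)"
  then have "cis (2 * pi * x) / cis (2 * pi * y) = 1" by simp
  then have "cos (2 * pi * x - 2 * pi * y) = 1"
    unfolding cis_divide by (metis Re_complex_of_real cis.sel(1) of_real_1)
  then obtain n :: int where "2 * pi * x - 2 * pi * y = real_of_int n * 2 * pi"
    unfolding cos_one_2pi_int by blast
  then have "2 * pi * (x - y) = 2 * pi * real_of_int n" by (simp add: algebra_simps)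
  then have "x - y = real_of_int n" by simp
  then show "x - y \<in> \<int>" by simp
next
  assume "x - y \<in> \<int>"
  then obtain n where "x - y = real_of_int n" by (rule Ints_cases)
  then have "x = y + real_of_int n" by simp
  then have "cis (2 * pi * x) = cis (2 * pi * y) * cis (2 * pi * real_of_int n)"
    by (simp add: distrib_left flip: cis_mult)
  then show "cis (2 * pi * x) = cis (2 * pi * y)"
    by (simp add: cis_multiple_2pi)
qed

lemma torus_cover_eq_iff: "torus_cover x = torus_cover y \<longleftrightarrow> x - y \<in> lattice"
  by (simp add: torus_cover_def cis_2pi_eq_iff lattice_def forall_2)

lemma torus_cover_add: "n \<in> lattice \<Longrightarrow> torus_cover (x + n) = torus_cover x"
  by (simp add: torus_cover_eq_iff)

lemma torus_cover_in: "torus_cover x \<in> torus"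
  by (simp add: torus_def torus_cover_def)

lemma continuous_on_torus_cover: "continuous_on S f \<Longrightarrow> continuous_on S (\<lambda>t. torus_cover (f t))"
  unfolding torus_cover_def by (intro continuous_intros)

lemma lattice_norm_less_1:
  assumes "n \<in> lattice" "norm n < 1"
  shows "n = 0"
proof -
  have "n $ i = 0" for i
  proof -
    have "\<bar>n $ i\<bar> < 1" using component_le_norm_cart[of n i] assms(2) by linarith
    moreover obtain k :: int where "n $ i = k"
      using assms(1) by (auto simp: lattice_def elim: Ints_cases)
    ultimately show ?thesis by simp
  qed
  then show ?thesis by (simp add: vec_eq_iff)
qed

text \<open>The difference of two lifts is continuous with values in the lattice, hence
  constant.\<close>

lemma lift_unique:
  assumes cont: "continuous_on UNIV \<gamma>" "continuous_on UNIV \<delta>"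
    and eq: "\<And>t::real. torus_cover (\<delta> t) = torus_cover (\<gamma> t)"
  obtains n where "n \<in> lattice" "\<And>t. \<delta> t = \<gamma> t + n"
proof
  let ?n = "\<delta> 0 - \<gamma> 0"
  have lat: "\<delta> t - \<gamma> t \<in> lattice" for t using eq[of t] by (simp add: torus_cover_eq_iff)
  then show "?n \<in> lattice" .
  have "(\<lambda>t. (\<delta> t - \<gamma> t) $ i) constant_on UNIV" for i
  proof (rule continuous_discrete_range_constant)
    show "continuous_on UNIV (\<lambda>t. (\<delta> t - \<gamma> t) $ i)"
      by (intro continuous_intros cont)
    show "\<exists>e>0. \<forall>y. y \<in> UNIV \<and> (\<delta> y - \<gamma> y) $ i \<noteq> (\<delta> x - \<gamma> x) $ i \<longrightarrow> e \<le> norm ((\<delta> y - \<gamma> y) $ i - (\<delta> x - \<gamma> x) $ i)" for x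
    proof (intro exI[of _ 1] conjI allI impI)
      fix y assume *: "y \<in> UNIV \<and> (\<delta> y - \<gamma> y) $ i \<noteq> (\<delta> x - \<gamma> x) $ i"
      obtain j k :: int where "(\<delta> y - \<gamma> y) $ i = j" "(\<delta> x - \<gamma> x) $ i = k"
        using lat[of x] lat[of y] unfolding lattice_def by (auto elim!: allE[of _ i] Ints_cases)
      then show "1 \<le> norm ((\<delta> y - \<gamma> y) $ i - (\<delta> x - \<gamma> x) $ i)"
        using * by (simp flip: of_int_diff of_int_abs)
    qed simp
  qed simp
  then have "(\<delta> t - \<gamma> t) $ i = (\<delta> 0 - \<gamma> 0) $ i" for t i
    unfolding constant_on_def by (metis UNIV_I)
  then have eq: "\<delta> t - \<gamma> t = ?n" for t
    unfolding vec_eq_iff by blast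
  show "\<delta> t = \<gamma> t + ?n" for t
    unfolding eq[of t, symmetric] by simp
qed

text \<open>The straight homotopy in the plane descends: both lifts advance by the same lattice
  vector, so each intermediate curve closes on the torus.\<close>

lemma homotopic_loops_torus_cover:
  assumes cont: "continuous_on UNIV \<gamma>" "continuous_on UNIV \<delta>" and b: "b \<in> lattice"
    and per: "\<And>t. \<gamma> (t + 1) = \<gamma> t + b" "\<And>t. \<delta> (t + 1) = \<delta> t + b"
  shows "homotopic_loops torus (torus_cover \<circ> \<gamma>) (torus_cover \<circ> \<delta>)"
proof -
  let ?h = "\<lambda>y. torus_cover ((1 - fst y) *\<^sub>R \<gamma> (snd y) + fst y *\<^sub>R \<delta> (snd y))"
  have "continuous_on ({0..1} \<times> {0..1}) ?h"
    by (intro continuous_on_torus_cover continuous_intros continuous_on_compose2[OF cont(1)] continuous_on_compose2[OF cont(2)]) auto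
  moreover have "pathfinish (?h \<circ> Pair t) = pathstart (?h \<circ> Pair t)" for t
  proof -
    have "(1 - t) *\<^sub>R \<gamma> 1 + t *\<^sub>R \<delta> 1 = ((1 - t) *\<^sub>R \<gamma> 0 + t *\<^sub>R \<delta> 0) + b"
      using per[of 0] by (simp add: algebra_simps)
    then show ?thesis
      using torus_cover_add[OF b, of "(1 - t) *\<^sub>R \<gamma> 0 + t *\<^sub>R \<delta> 0"]
      by (simp add: pathfinish_def pathstart_def)
  qed
  ultimately show ?thesis
    unfolding homotopic_loops by (intro exI[of _ ?h]) (auto simp: torus_cover_in)
qed


section \<open>Periods and multiplicity\<close>

definition periods :: "(real \<Rightarrow> 'a) \<Rightarrow> real set" where
  "periods c = {a. \<forall>t. c (t + a) = c t}"

lemma periods_add: "a \<in> periods c \<Longrightarrow> b \<in> periods c \<Longrightarrow> a + b \<in> periods c"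
  by (simp add: periods_def flip: add.assoc)

lemma periods_uminus: "a \<in> periods c \<Longrightarrow> - a \<in> periods c"
  unfolding periods_def mem_Collect_eq by (metis add.assoc add.right_inverse add.right_neutral add.commute)

lemma periods_of_nat: "a \<in> periods c \<Longrightarrow> real k * a \<in> periods c"
proof (induction k)
  case (Suc k)
  then show ?case using periods_add[of a c "real k * a"] by (simp add: distrib_right)
qed (simp add: periods_def)

lemma periods_of_int: "a \<in> periods c \<Longrightarrow> of_int k * a \<in> periods c"
  using periods_of_nat[of a c "nat k"] periods_uminus[OF periods_of_nat[of a c "nat (- k)"]]
  by (cases "k \<ge> 0") simp_all

lemma periods_diff_of_int: "a \<in> periods c \<Longrightarrow> b \<in> periods c \<Longrightarrow> b - of_int k * a \<in> periods c"
  using periods_add[OF _ periods_uminus[OF periods_of_int], of b c a k] by simp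

lemma string_mult_eq: "string_mult (range (\<lambda>a. rotate_loop a c)) = card (periods c \<inter> {0..<1})"
proof -
  have "(\<forall>c'\<in>range (\<lambda>a. rotate_loop a c). rotate_loop a c' = c') \<longleftrightarrow> a \<in> periods c" for a
  proof
    assume "\<forall>c'\<in>range (\<lambda>a. rotate_loop a c). rotate_loop a c' = c'"
    then have "rotate_loop a (rotate_loop 0 c) = rotate_loop 0 c" by blast
    then show "a \<in> periods c" by (simp add: periods_def rotate_loop_def fun_eq_iff)
  next
    assume a: "a \<in> periods c"
    have "c (t + a + b) = c (t + b)" for t b
      using a unfolding periods_def mem_Collect_eq by (metis add.assoc add.commute)
    then show "\<forall>c'\<in>range (\<lambda>a. rotate_loop a c). rotate_loop a c' = c'"
      by (auto simp: rotate_loop_def)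
  qed
  then show ?thesis
    by (simp add: string_mult_def) (auto intro: arg_cong[where f = card])
qed

text \<open>This also holds if the set of periods in \<open>[0, 1)\<close> is infinite, as its cardinality is then \<open>0\<close>.\<close>

lemma dvd_card_periods:
  assumes "p > 0" "1 / real p \<in> periods c"
  shows "p dvd card (periods c \<inter> {0..<1})"
proof -
  let ?A = "periods c \<inter> {0..<1 / real p}"
  \<comment> \<open>Division with remainder by \<open>1 / real p\<close>: each period in [0, 1) is
    uniquely a multiple \<open>j / p\<close> with \<open>j < p\<close> plus a period below
    \<open>1 / real p\<close>.\<close>
  let ?f = "\<lambda>y. fst y + real (snd y) * (1 / real p)"
  let ?g = "\<lambda>b. (b - of_int \<lfloor>b * real p\<rfloor> * (1 / real p), nat \<lfloor>b * real p\<rfloor>)"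
  have "bij_betw ?f (?A \<times> {..<p}) (periods c \<inter> {0..<1})"
  proof (rule bij_betw_byWitness[where f' = ?g])
    show "\<forall>y\<in>?A \<times> {..<p}. ?g (?f y) = y"
    proof
      fix y assume "y \<in> ?A \<times> {..<p}"
      then obtain a j where y: "y = (a, j)" "0 \<le> a" "a < 1 / real p"
        by (cases y) auto
      then have "\<lfloor>?f y * real p\<rfloor> = int j"
        using assms(1) by (intro floor_unique) (auto simp: field_simps)
      then show "?g (?f y) = y"
        using y(1) by simp
    qed
    show "\<forall>b\<in>periods c \<inter> {0..<1}. ?f (?g b) = b"
      by auto
    show "?f ` (?A \<times> {..<p}) \<subseteq> periods c \<inter> {0..<1}"
    proof (rule image_subsetI)
      fix y assume "y \<in> ?A \<times> {..<p}"
      then obtain a j where y: "y = (a, j)" and a: "a \<in> periods c" "0 \<le> a" "a < 1 / real p" and j: "j < p"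
        by (cases y) auto
      have "a + real j * (1 / real p) < 1 / real p + real (p - 1) * (1 / real p)"
        using a j by (intro add_less_le_mono mult_right_mono) auto
      also have "\<dots> = 1" using assms(1) by (simp add: of_nat_diff field_simps)
      finally show "?f y \<in> periods c \<inter> {0..<1}"
        using a periods_add[OF a(1) periods_of_nat[OF assms(2), of j]] by (simp add: y)
    qed
    show "?g ` (periods c \<inter> {0..<1}) \<subseteq> ?A \<times> {..<p}"
    proof (rule image_subsetI)
      fix b assume b: "b \<in> periods c \<inter> {0..<1}"
      let ?r = "b - of_int \<lfloor>b * real p\<rfloor> * (1 / real p)"
      have "?r = frac (b * real p) / real p"
        using assms(1) by (simp add: frac_def field_simps)
      then have "0 \<le> ?r" "?r < 1 / real p"
        using assms(1) frac_lt_1[of "b * real p"] by (simp_all only: frac_ge_0 divide_strict_right_mono divide_nonneg_nonneg of_nat_0_le_iff of_nat_0_less_iff)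
      moreover have "b * real p < real p" using b assms(1) by simp
      then have "nat \<lfloor>b * real p\<rfloor> < p" using b assms(1) by (simp add: floor_less_iff nat_less_iff)
      moreover have "?r \<in> periods c"
        using b by (intro periods_diff_of_int[OF assms(2)]) simp
      ultimately show "?g b \<in> ?A \<times> {..<p}"
        by (simp only: mem_Sigma_iff Int_iff atLeastLessThan_iff lessThan_iff)
    qed
  qed
  then have "card (?A \<times> {..<p}) = card (periods c \<inter> {0..<1})"
    by (rule bij_betw_same_card)
  then show ?thesis
    by (simp add: card_cartesian_product) (metis dvd_triv_right)
qed

text \<open>A group of periods bounded away from 0 is generated by its least positive element, here
  \<open>1 / k\<close> with \<open>k\<close> the multiplicity. Discreteness also makes the
  cardinality a true count and not the value 0 of an infinite set.\<close>

lemma inverse_in_periods: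
  assumes p: "p > 0" "p dvd card (periods c \<inter> {0..<1})" and one: "1 \<in> periods c"
    and \<eta>: "\<eta> > 0" "\<And>a. a \<in> periods c \<Longrightarrow> 0 < a \<Longrightarrow> \<eta> \<le> a"
  shows "1 / real p \<in> periods c"
proof -
  let ?S = "periods c \<inter> {0..<1}" and ?T = "periods c \<inter> {0<..1}"
  have "finite (periods c \<inter> {0..1})"
  proof (rule inj_on_finite[where f = "\<lambda>a. \<lfloor>a / \<eta>\<rfloor>" and B = "{0..\<lfloor>1 / \<eta>\<rfloor>}"])
    show "inj_on (\<lambda>a. \<lfloor>a / \<eta>\<rfloor>) (periods c \<inter> {0..1})"
    proof (rule inj_onI, rule ccontr)
      have *: False if "a \<in> periods c" "b \<in> periods c" "\<lfloor>a / \<eta>\<rfloor> = \<lfloor>b / \<eta>\<rfloor>" "a < b" for a b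
      proof -
        have "\<eta> \<le> b - a"
          using periods_add[OF that(2) periods_uminus[OF that(1)]] that(4) by (intro \<eta>(2)) auto
        then have "1 \<le> b / \<eta> - a / \<eta>" using \<eta>(1) by (simp flip: diff_divide_distrib)
        moreover have "b / \<eta> < of_int \<lfloor>a / \<eta>\<rfloor> + 1" "of_int \<lfloor>a / \<eta>\<rfloor> \<le> a / \<eta>"
          unfolding that(3) by linarith (simp flip: that(3))
        ultimately show False by linarith
      qed
      fix a b assume "a \<in> periods c \<inter> {0..1}" "b \<in> periods c \<inter> {0..1}" "\<lfloor>a / \<eta>\<rfloor> = \<lfloor>b / \<eta>\<rfloor>" "a \<noteq> b"
      then show False using *[of a b] *[of b a] by force
    qed
    show "(\<lambda>a. \<lfloor>a / \<eta>\<rfloor>) ` (periods c \<inter> {0..1}) \<subseteq> {0..\<lfloor>1 / \<eta>\<rfloor>}"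
      using \<eta>(1) by (auto intro!: floor_mono divide_right_mono)
  qed simp
  then have finT: "finite ?T" by (rule rev_finite_subset) auto
  define a0 where "a0 = Min ?T"
  have "?T \<noteq> {}" using one by auto
  then have a0: "a0 \<in> periods c" "0 < a0" "a0 \<le> 1"
    using Min_in[OF finT] by (auto simp: a0_def)
  have zero: "r = 0" if "r \<in> periods c" "0 \<le> r" "r < a0" for r
  proof (rule ccontr)
    assume "r \<noteq> 0"
    then have "r \<in> ?T" using that a0 by auto
    then have "a0 \<le> r" unfolding a0_def by (intro Min_le finT)
    with that show False by simp
  qed
  have mult: "b = of_int \<lfloor>b / a0\<rfloor> * a0" if "b \<in> periods c" for b
  proof -
    have "b - of_int \<lfloor>b / a0\<rfloor> * a0 = frac (b / a0) * a0"
      using a0 by (simp add: frac_def left_diff_distrib)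
    then have "b - of_int \<lfloor>b / a0\<rfloor> * a0 = 0"
      using a0 frac_lt_1[of "b / a0"] by (intro zero periods_diff_of_int that) auto
    then show ?thesis by simp
  qed
  define k where "k = nat \<lfloor>1 / a0\<rfloor>"
  have k: "1 = real k * a0" "k > 0"
    using mult[OF one] a0 by (auto simp: k_def)
  have "bij_betw (\<lambda>j. real j * a0) {..<k} ?S"
  proof (rule bij_betw_byWitness[where f' = "\<lambda>b. nat \<lfloor>b / a0\<rfloor>"])
    show "(\<lambda>j. real j * a0) ` {..<k} \<subseteq> ?S"
    proof (rule image_subsetI)
      fix j assume "j \<in> {..<k}"
      then have "real j * a0 < real k * a0" using a0 by simp
      then show "real j * a0 \<in> ?S" using a0 periods_of_nat[OF a0(1), of j] k(1) by simp
    qed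
    show "\<forall>b\<in>?S. real (nat \<lfloor>b / a0\<rfloor>) * a0 = b"
    proof
      fix b assume b: "b \<in> ?S"
      then have "real (nat \<lfloor>b / a0\<rfloor>) = of_int \<lfloor>b / a0\<rfloor>" using a0 by simp
      then show "real (nat \<lfloor>b / a0\<rfloor>) * a0 = b" using mult[of b] b by simp
    qed
    show "(\<lambda>b. nat \<lfloor>b / a0\<rfloor>) ` ?S \<subseteq> {..<k}"
    proof (rule image_subsetI)
      fix b assume b: "b \<in> ?S"
      have "of_int \<lfloor>b / a0\<rfloor> * a0 < real k * a0" using mult[of b] b k(1) by simp
      then have "of_int \<lfloor>b / a0\<rfloor> < real k" using a0 by simp
      then show "nat \<lfloor>b / a0\<rfloor> \<in> {..<k}" using k(2) by auto
    qed
  qed (use a0 in auto)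
  from bij_betw_same_card[OF this] have "card ?S = k" by simp
  with p(2) have "p dvd k" by simp
  then obtain q where "k = p * q" by (rule dvdE)
  then have "1 / real p = real q * a0"
    using k p(1) by (simp add: field_simps)
  then show ?thesis using periods_of_nat[OF a0(1)] by simp
qed


section \<open>Strings\<close>

lemma has_vector_derivative_continuous_on_UNIV:
  "(\<And>t. (\<gamma> has_vector_derivative v t) (at t)) \<Longrightarrow> continuous_on UNIV \<gamma>"
  by (intro continuous_at_imp_continuous_on ballI) (rule has_vector_derivative_continuous)

context finsler
begin

lemma F_zero: "F (x, 0) = 0"
  using F_hom[of 0 x 0] by simp

lemma geodesic_derivative:
  assumes "geodesic F \<gamma>"
  obtains v where "\<And>t. (\<gamma> has_vector_derivative v t) (at t)" "\<And>t. v t \<noteq> 0"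
proof (rule that[of "\<lambda>t. vector_derivative \<gamma> (at t)"])
  have *: "smooth_on UNIV \<gamma>" "\<exists>c>0. \<forall>t. F (\<gamma> t, vector_derivative \<gamma> (at t)) = c"
    using assms by (auto simp: geodesic_def Let_def)
  show "(\<gamma> has_vector_derivative vector_derivative \<gamma> (at t)) (at t)" for t
    using smooth_on_differentiable[OF *(1)] by (simp add: vector_derivative_works[symmetric] differentiable_on_def)
  show "vector_derivative \<gamma> (at t) \<noteq> 0" for t
    using *(2) F_zero by (metis less_irrefl)
qed

text \<open>A short period moves the lift by a lattice vector of norm below 1, hence by 0. For short
  times this contradicts the nonzero velocity at time 0.\<close>

lemma geodesic_periods_discrete:
  assumes "geodesic F \<gamma>"
  obtains \<eta> where "\<eta> > 0" "\<And>a. a \<in> periods (torus_cover \<circ> \<gamma>) \<Longrightarrow> 0 < a \<Longrightarrow> \<eta> \<le> a"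
proof -
  obtain v where v: "\<And>t. (\<gamma> has_vector_derivative v t) (at t)" "\<And>t. v t \<noteq> 0"
    using geodesic_derivative[OF assms] by blast
  have "continuous (at 0) \<gamma>" by (rule has_vector_derivative_continuous[OF v(1)])
  then obtain \<eta>1 where \<eta>1: "\<eta>1 > 0" "\<And>t. dist t 0 < \<eta>1 \<Longrightarrow> dist (\<gamma> t) (\<gamma> 0) < 1"
    unfolding continuous_at_eps_delta by (metis zero_less_one)
  have "norm (v 0) / 2 > 0" using v(2) by simp
  then obtain \<eta>2 where \<eta>2: "\<eta>2 > 0" "\<And>t. norm (t - 0) < \<eta>2 \<Longrightarrow> norm (\<gamma> t - \<gamma> 0 - (t - 0) *\<^sub>R v 0) \<le> norm (v 0) / 2 * norm (t - 0)"
    using v(1)[of 0] unfolding has_vector_derivative_def has_derivative_at_alt by blast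
  show thesis
  proof (rule that[of "min \<eta>1 \<eta>2"])
    fix a assume a: "a \<in> periods (torus_cover \<circ> \<gamma>)" "0 < a"
    show "min \<eta>1 \<eta>2 \<le> a"
    proof (rule ccontr)
      assume "\<not> min \<eta>1 \<eta>2 \<le> a"
      then have small: "a < \<eta>1" "a < \<eta>2" by auto
      have "(torus_cover \<circ> \<gamma>) (0 + a) = (torus_cover \<circ> \<gamma>) 0"
        using a(1) unfolding periods_def by blast
      then have "\<gamma> a - \<gamma> 0 \<in> lattice" by (simp add: torus_cover_eq_iff)
      moreover have "norm (\<gamma> a - \<gamma> 0) < 1"
        using \<eta>1(2)[of a] small a(2) by (simp add: dist_norm)
      ultimately have "\<gamma> a - \<gamma> 0 = 0" by (rule lattice_norm_less_1)
      then have "a * norm (v 0) \<le> norm (v 0) / 2 * a"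
        using \<eta>2(2)[of a] small a(2) by simp
      then show False using a(2) v(2)[of 0] by simp
    qed
  qed (use \<eta>1 \<eta>2 in simp)
qed

text \<open>Homogeneity scales the force by the square of \<open>p\<close>; on the momentum side one
  factor comes from the momentum and one from the chain rule.\<close>

lemma el_solution_iterate:
  assumes sol: "el_solution a \<gamma> v" and p: "p > 0"
  shows "el_solution (real p *\<^sub>R a) (\<lambda>t. \<gamma> (real p * t)) (\<lambda>t. real p *\<^sub>R v (real p * t))"
proof -
  have scale: "((\<lambda>t. real p * t) has_vector_derivative real p) (at t)" for t
    by (auto intro!: derivative_eq_intros simp: has_real_derivative_iff_has_vector_derivative[symmetric])
  have \<gamma>: "((\<lambda>t. \<gamma> (real p * t)) has_vector_derivative real p *\<^sub>R v (real p * t)) (at t)" for t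
    using vector_diff_chain_at[OF scale[of t], of \<gamma> "v (real p * t)"] sol by (simp add: el_solution_def o_def)
  have "((\<lambda>t. P (\<gamma> (real p * t), v (real p * t))) has_vector_derivative real p *\<^sub>R Q (\<gamma> (real p * t), v (real p * t))) (at t)" for t
    using vector_diff_chain_at[OF scale[of t], of "\<lambda>t. P (\<gamma> t, v t)" "Q (\<gamma> (real p * t), v (real p * t))"] sol
    by (simp add: el_solution_def o_def)
  then have "((\<lambda>t. real p *\<^sub>R P (\<gamma> (real p * t), v (real p * t))) has_vector_derivative
      real p *\<^sub>R real p *\<^sub>R Q (\<gamma> (real p * t), v (real p * t))) (at t)" for t
    by (intro bounded_linear.has_vector_derivative[OF bounded_linear_scaleR_right])
  then have P: "((\<lambda>t. P (\<gamma> (real p * t), real p *\<^sub>R v (real p * t))) has_vector_derivative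
      Q (\<gamma> (real p * t), real p *\<^sub>R v (real p * t))) (at t)" for t
    by (simp add: PQ_hom power2_eq_square)
  have shift: "\<gamma> (t + real k) = \<gamma> t + real k *\<^sub>R a" for t k
  proof (induction k)
    case (Suc k)
    have "\<gamma> (t + real (Suc k)) = \<gamma> ((t + real k) + 1)" by (simp add: algebra_simps)
    also have "\<dots> = \<gamma> (t + real k) + a" using sol by (simp add: el_solution_def)
    finally show ?case using Suc by (simp add: scaleR_add_left)
  qed simp
  have "continuous_on UNIV v"
    using sol by (simp add: el_solution_def)
  then have "continuous_on UNIV (\<lambda>t. v (real p * t))"
    by (rule continuous_on_compose2) (auto intro!: continuous_intros)
  then have "continuous_on UNIV (\<lambda>t. real p *\<^sub>R v (real p * t))"
    by (rule continuous_on_scaleR[OF continuous_on_const])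
  moreover have "\<gamma> (real p * (t + 1)) = \<gamma> (real p * t) + real p *\<^sub>R a" for t
    using shift[of "real p * t" p] by (simp add: distrib_left)
  ultimately show ?thesis
    unfolding el_solution_def using \<gamma> P by blast
qed

lemma el_solution_continuous: "el_solution a \<gamma> v \<Longrightarrow> continuous_on UNIV \<gamma>"
  by (rule has_vector_derivative_continuous_on_UNIV) (auto simp: el_solution_def)

definition iterate_string :: "nat \<Rightarrow> (real \<Rightarrow> real^2) \<Rightarrow> (real \<Rightarrow> complex \<times> complex) set" where
  "iterate_string p \<gamma> = range (\<lambda>r. rotate_loop r (\<lambda>t. torus_cover (\<gamma> (real p * t))))"

text \<open>\<open>\<delta>\<close> will be a lift of the given loop. It identifies the class,
  because loops whose lifts have the same translation vector are freely homotopic. Divisibility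
  comes from the period \<open>1 / real p\<close> of the iterate.\<close>

lemma iterate_string_props:
  assumes sol: "el_solution a \<gamma> v" and a: "a \<in> lattice" "a \<noteq> 0" and p: "p > 0"
    and \<delta>: "continuous_on UNIV \<delta>" "\<And>t. \<delta> (t + 1) = \<delta> t + real p *\<^sub>R a"
    and \<beta>: "free_homotopy_class \<beta>" "torus_cover \<circ> \<delta> \<in> \<beta>"
  shows "geodesic_string F (iterate_string p \<gamma>)" "string_has_class (iterate_string p \<gamma>) \<beta>"
    "p dvd string_mult (iterate_string p \<gamma>)"
proof -
  let ?g = "\<lambda>t. \<gamma> (real p * t)"
  note it = el_solution_iterate[OF sol p]
  have pa: "real p *\<^sub>R a \<in> lattice" "real p *\<^sub>R a \<noteq> 0"
    using a p by (auto intro: lattice_scaleR)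
  have per: "?g (t + 1) = ?g t + real p *\<^sub>R a" for t
    using it by (simp add: el_solution_def)
  have "closed_geodesic F (\<lambda>t. torus_cover (?g t))"
    unfolding closed_geodesic_def
  proof (intro conjI allI exI)
    show "torus_cover (?g (t + 1)) = torus_cover (?g t)" for t
      unfolding per by (rule torus_cover_add[OF pa(1)])
    show "geodesic F ?g" by (rule solution_geodesic(1)[OF it pa(2)])
  qed auto
  then show "geodesic_string F (iterate_string p \<gamma>)"
    unfolding geodesic_string_def iterate_string_def by blast
  obtain q where q: "\<beta> = {c. homotopic_loops torus q c}"
    using \<beta>(1) by (auto simp: free_homotopy_class_def)
  show "string_has_class (iterate_string p \<gamma>) \<beta>"
    unfolding string_has_class_def
  proof
    fix c assume "c \<in> iterate_string p \<gamma>"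
    then obtain r where r: "c = torus_cover \<circ> (\<lambda>t. ?g (t + r))"
      by (auto simp: iterate_string_def rotate_loop_def o_def)
    have "homotopic_loops torus (torus_cover \<circ> \<delta>) c"
      unfolding r
    proof (rule homotopic_loops_torus_cover[OF \<delta>(1) _ pa(1) \<delta>(2)])
      show "continuous_on UNIV (\<lambda>t. ?g (t + r))"
        by (intro continuous_on_compose2[OF el_solution_continuous[OF it]] continuous_intros) auto
      show "?g (t + 1 + r) = ?g (t + r) + real p *\<^sub>R a" for t
        using per[of "t + r"] by (simp add: algebra_simps)
    qed
    then show "c \<in> \<beta>"
      using \<beta>(2) homotopic_loops_trans unfolding q by blast
  qed
  have "1 / real p \<in> periods (\<lambda>t. torus_cover (?g t))"
  proof -
    have "?g (t + 1 / real p) = ?g t + a" for t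
      using sol p by (simp add: distrib_left el_solution_def)
    then show ?thesis by (simp add: periods_def torus_cover_add[OF a(1)])
  qed
  from dvd_card_periods[OF p this] show "p dvd string_mult (iterate_string p \<gamma>)"
    unfolding iterate_string_def string_mult_eq .
qed

text \<open>Lifts of equal strings agree up to a time shift and a lattice vector. Antiderivatives
  stand for integrals here, so their existence is part of the conclusion.\<close>

lemma iterate_string_eq:
  assumes sol: "el_solution a \<gamma> v" "el_solution a \<gamma>' v'" and p: "p > 0"
    and l: "a \<bullet> l = 0" "\<And>n. n \<in> lattice \<Longrightarrow> n \<bullet> l \<in> \<int>"
    and eq: "iterate_string p \<gamma> = iterate_string p \<gamma>'"
  shows "L (\<gamma> 0, v 0) = L (\<gamma>' 0, v' 0)"
    "\<exists>Y Y'. (\<forall>t. (Y has_real_derivative \<gamma> t \<bullet> l) (at t)) \<and> (\<forall>t. (Y' has_real_derivative \<gamma>' t \<bullet> l) (at t)) \<and>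
        (Y 1 - Y 0) - (Y' 1 - Y' 0) \<in> \<int>"
proof -
  note cont = el_solution_continuous[OF sol(1)] el_solution_continuous[OF sol(2)]
  have "rotate_loop 0 (\<lambda>t. torus_cover (\<gamma>' (real p * t))) \<in> iterate_string p \<gamma>'"
    unfolding iterate_string_def by blast
  then have "rotate_loop 0 (\<lambda>t. torus_cover (\<gamma>' (real p * t))) \<in> iterate_string p \<gamma>"
    using eq by simp
  then obtain r where r: "\<And>t. torus_cover (\<gamma>' (real p * t)) = torus_cover (\<gamma> (real p * (t + r)))"
    by (auto simp: iterate_string_def rotate_loop_def fun_eq_iff)
  \<comment> \<open>Undoing the rescaling by \<open>p\<close> turns equality of the iterates into a
    relation between the original curves.\<close>
  define s where "s = real p * r"
  have "torus_cover (\<gamma>' t) = torus_cover (\<gamma> (t + s))" for t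
    using r[of "t / real p"] p by (simp add: s_def distrib_left)
  moreover have "continuous_on UNIV (\<lambda>t. \<gamma> (t + s))"
    by (intro continuous_on_compose2[OF cont(1)] continuous_intros) auto
  ultimately obtain n where n: "n \<in> lattice" "\<And>t. \<gamma>' t = \<gamma> (t + s) + n"
    using lift_unique[OF _ cont(2), of "\<lambda>t. \<gamma> (t + s)"] by blast
  have "((\<lambda>t. \<gamma> (t + s) + n) has_vector_derivative v (t + s)) (at t)" for t
  proof -
    have "((\<lambda>t. t + s) has_vector_derivative 1) (at t)"
      by (auto intro!: derivative_eq_intros)
    from vector_diff_chain_at[OF this, of \<gamma> "v (t + s)"] sol(1)
    show ?thesis by (simp add: el_solution_def o_def has_vector_derivative_add_const)
  qed
  moreover have "\<gamma>' = (\<lambda>t. \<gamma> (t + s) + n)"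
    using n(2) by (rule ext)
  ultimately have d: "(\<gamma>' has_vector_derivative v (t + s)) (at t)" for t
    by simp
  have "(\<gamma>' has_vector_derivative v' t) (at t)" for t
    using sol(2) by (simp add: el_solution_def)
  then have v': "v' t = v (t + s)" for t
    using d by (rule vector_derivative_unique_at)
  obtain E where E: "\<And>t. L (\<gamma> t, v t) = E"
    using energy_conservation[OF sol(1)] by blast
  have "L (\<gamma>' 0, v' 0) = L (\<gamma> s, v s)"
    using periodic_lattice[OF L_periodic n(1)] by (simp add: n(2) v')
  then show "L (\<gamma> 0, v 0) = L (\<gamma>' 0, v' 0)" by (simp add: E)
  have "continuous_on UNIV (\<lambda>t. \<gamma> t \<bullet> l)"
    by (intro continuous_intros cont)
  then have "isCont (\<lambda>t. \<gamma> t \<bullet> l) t" for t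
    by (simp add: continuous_on_eq_continuous_at)
  then have "\<exists>Y. \<forall>t::real. - \<infinity> < ereal t \<longrightarrow> ereal t < \<infinity> \<longrightarrow> (Y has_vector_derivative \<gamma> t \<bullet> l) (at t)"
    by (intro einterval_antiderivative) auto
  then obtain Y where Y: "\<And>t. (Y has_real_derivative \<gamma> t \<bullet> l) (at t)"
    by (auto simp: has_real_derivative_iff_has_vector_derivative)
  define Y' where "Y' t = Y (t + s) + t * (n \<bullet> l)" for t
  have Y_shift: "((\<lambda>t. Y (t + u)) has_real_derivative \<gamma> (t + u) \<bullet> l) (at t)" for t u
    using Y[of "t + u"] by (simp add: DERIV_shift)
  have Y': "(Y' has_real_derivative \<gamma>' t \<bullet> l) (at t)" for t
    unfolding Y'_def[abs_def] n(2) inner_add_left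
    by (rule DERIV_add[OF Y_shift]) (auto intro!: derivative_eq_intros)
  \<comment> \<open>The integral over one period does not depend on the starting time, because
    \<open>a \<bullet> l = 0\<close> makes the integrand 1-periodic.\<close>
  have "((\<lambda>t. Y (t + 1) - Y t) has_real_derivative \<gamma> (t + 1) \<bullet> l - \<gamma> t \<bullet> l) (at t)" for t
    by (rule DERIV_diff[OF Y_shift Y])
  then have "\<forall>t. ((\<lambda>t. Y (t + 1) - Y t) has_real_derivative 0) (at t)"
    using sol(1) l(1) by (simp add: el_solution_def inner_add_left)
  from DERIV_isconst_all[OF this, of s 0] have "Y (s + 1) - Y s = Y (0 + 1) - Y 0" .
  then have "(Y 1 - Y 0) - (Y' 1 - Y' 0) = - (n \<bullet> l)"
    by (simp add: Y'_def add.commute)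
  then have "(Y 1 - Y 0) - (Y' 1 - Y' 0) \<in> \<int>"
    using l(2)[OF n(1)] by simp
  then show "\<exists>Y Y'. (\<forall>t. (Y has_real_derivative \<gamma> t \<bullet> l) (at t)) \<and> (\<forall>t. (Y' has_real_derivative \<gamma>' t \<bullet> l) (at t)) \<and>
        (Y 1 - Y 0) - (Y' 1 - Y' 0) \<in> \<int>"
    using Y Y' by blast
qed

lemma another_string:
  assumes p: "p > 0" and \<beta>: "free_homotopy_class \<beta>" "nontrivial_class \<beta>"
    and s: "geodesic_string F s" "string_has_class s \<beta>" "p dvd string_mult s"
  shows "\<exists>s'. s' \<noteq> s \<and> geodesic_string F s' \<and> string_has_class s' \<beta> \<and> p dvd string_mult s'"
proof -
  obtain c where c: "closed_geodesic F c" "s = range (\<lambda>r. rotate_loop r c)"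
    using s(1) unfolding geodesic_string_def by blast
  from c(1) obtain \<gamma> where \<gamma>: "geodesic F \<gamma>" "c = torus_cover \<circ> \<gamma>"
    unfolding closed_geodesic_def by blast
  have c1: "c (t + 1) = c t" for t
    using c(1) by (simp add: closed_geodesic_def)
  obtain w where "\<And>t. (\<gamma> has_vector_derivative w t) (at t)"
    using geodesic_derivative[OF \<gamma>(1)] by blast
  then have cont: "continuous_on UNIV \<gamma>"
    by (rule has_vector_derivative_continuous_on_UNIV)
  obtain \<eta> where \<eta>: "\<eta> > 0" "\<And>a. a \<in> periods c \<Longrightarrow> 0 < a \<Longrightarrow> \<eta> \<le> a"
    using geodesic_periods_discrete[OF \<gamma>(1), folded \<gamma>(2)] by blast
  have "1 / real p \<in> periods c"
  proof (rule inverse_in_periods[OF p _ _ \<eta>])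
    show "p dvd card (periods c \<inter> {0..<1})"
      using s(3) unfolding c(2) string_mult_eq .
    show "1 \<in> periods c" using c1 by (simp add: periods_def)
  qed
  then have "torus_cover (\<gamma> (t + 1 / real p)) = torus_cover (\<gamma> t)" for t
    by (simp add: periods_def \<gamma>(2))
  moreover have "continuous_on UNIV (\<lambda>t. \<gamma> (t + 1 / real p))"
    by (intro continuous_on_compose2[OF cont] continuous_intros) auto
  ultimately obtain a where a: "a \<in> lattice" "\<And>t. \<gamma> (t + 1 / real p) = \<gamma> t + a"
    using lift_unique[OF cont, of "\<lambda>t. \<gamma> (t + 1 / real p)"] by blast
  have "\<gamma> (t + real k * (1 / real p)) = \<gamma> t + real k *\<^sub>R a" for t k
  proof (induction k)
    case (Suc k)
    have "\<gamma> (t + real (Suc k) * (1 / real p)) = \<gamma> ((t + real k * (1 / real p)) + 1 / real p)"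
      by (simp add: algebra_simps add_divide_distrib)
    then show ?case using Suc a(2) by (simp add: scaleR_add_left)
  qed simp
  from this[of _ p] have per: "\<gamma> (t + 1) = \<gamma> t + real p *\<^sub>R a" for t
    using p by simp
  have "rotate_loop 0 c \<in> s" unfolding c(2) by blast
  then have c\<beta>: "torus_cover \<circ> \<gamma> \<in> \<beta>"
    using s(2) by (auto simp: string_has_class_def rotate_loop_def \<gamma>(2) o_def)
  \<comment> \<open>Otherwise the lift closes up and the loop is homotopic to a constant.\<close>
  have "a \<noteq> 0"
  proof
    assume "a = 0"
    have "homotopic_loops torus (torus_cover \<circ> \<gamma>) (torus_cover \<circ> (\<lambda>_. 0))"
      by (rule homotopic_loops_torus_cover[OF cont _ lattice_0]) (use per \<open>a = 0\<close> in auto)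
    then have "(\<lambda>_. torus_cover 0) \<in> \<beta>"
      using c\<beta> \<beta>(1) homotopic_loops_trans by (auto simp: free_homotopy_class_def o_def)
    then show False
      using \<beta>(2) torus_cover_in by (auto simp: nontrivial_class_def)
  qed
  \<comment> \<open>\<open>a\<close> turned by a right angle: orthogonal to \<open>a\<close> and
    integral on the lattice.\<close>
  define l :: "real^2" where "l = vector [- (a $ 2), a $ 1]"
  have inner_l: "n \<bullet> l = n $ 2 * a $ 1 - n $ 1 * a $ 2" for n
    by (simp add: l_def inner_vec_def sum_2 vector_2)
  have l: "a \<bullet> l = 0" "\<And>n. n \<in> lattice \<Longrightarrow> n \<bullet> l \<in> \<int>"
    using a(1) by (auto simp: inner_l lattice_def intro!: Ints_diff Ints_mult)
  have int_abs: "\<bar>x\<bar> \<ge> 1" if "x \<in> \<int>" "x \<noteq> 0" for x :: real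
    using that by (rule Ints_nonzero_abs_ge1)
  have aZ: "a $ i \<in> \<int>" for i using a(1) by (simp add: lattice_def)
  \<comment> \<open>A coordinate vector pairs with \<open>l\<close> to a coordinate of
    \<open>a\<close> up to sign, an integer of size at least 1 if nonzero.\<close>
  obtain e where e: "e \<in> lattice" "\<bar>e \<bullet> l\<bar> \<ge> 1"
  proof (cases "a $ 1 = 0")
    case False
    then show ?thesis
      using int_abs[OF aZ[of 1]] by (intro that[of "axis 2 1"]) (auto simp: inner_l lattice_def axis_def)
  next
    case True
    then have "a $ 2 \<noteq> 0" using \<open>a \<noteq> 0\<close> by (auto simp: vec_eq_iff forall_2)
    then show ?thesis
      using int_abs[OF aZ[of 2]] by (intro that[of "axis 1 1"]) (auto simp: inner_l lattice_def axis_def)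
  qed
  obtain \<gamma>1 v1 \<gamma>2 v2 where sol: "el_solution a \<gamma>1 v1" "el_solution a \<gamma>2 v2"
    and ne: "L (\<gamma>1 0, v1 0) \<noteq> L (\<gamma>2 0, v2 0) \<or>
     (\<forall>Y Y'. (\<forall>t. (Y has_real_derivative \<gamma>1 t \<bullet> l) (at t)) \<longrightarrow> (\<forall>t. (Y' has_real_derivative \<gamma>2 t \<bullet> l) (at t)) \<longrightarrow>
        (Y 1 - Y 0) - (Y' 1 - Y' 0) \<notin> \<int>)"
    by (rule two_solutions[OF a(1) e energy_conservation l(2)]) blast+
  have "iterate_string p \<gamma>1 \<noteq> iterate_string p \<gamma>2"
    using iterate_string_eq[OF sol p l] ne by blast
  then consider "iterate_string p \<gamma>1 \<noteq> s" | "iterate_string p \<gamma>2 \<noteq> s" by blast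
  then show ?thesis
    using iterate_string_props[OF sol(1) a(1) \<open>a \<noteq> 0\<close> p cont per \<beta>(1) c\<beta>]
      iterate_string_props[OF sol(2) a(1) \<open>a \<noteq> 0\<close> p cont per \<beta>(1) c\<beta>] by cases blast+
qed

end

lemma residual_in_topspace: "residual_in X (topspace X)"
  unfolding residual_in_def by (auto intro!: exI[of _ "\<lambda>_. topspace X"])

theorem corollary1p5:
  shows "\<exists>k :: nat. \<forall>G\<^sub>0. flat_riemannian_metric G\<^sub>0 \<longrightarrow>
    (\<exists>\<epsilon>::real. \<epsilon> > 0 \<and>
      (\<exists>R. residual_in
              (subtopology Cinf_topology
                {F. finsler_metric F \<and> finsler_dist k F (riemannian_norm G\<^sub>0) < ennreal \<epsilon>}) R \<and>
        (\<forall>F\<in>R. \<forall>p::nat. \<forall>\<beta>. prime p \<longrightarrow> free_homotopy_class \<beta> \<longrightarrow> nontrivial_class \<beta> \<longrightarrow>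
          (\<forall>s. geodesic_string F s \<and> string_has_class s \<beta> \<and> p dvd string_mult s \<longrightarrow>
            (\<exists>s'. s' \<noteq> s \<and>
               geodesic_string F s' \<and> string_has_class s' \<beta> \<and> p dvd string_mult s')))))"
proof (intro exI[of _ "0::nat"] allI impI exI[of _ "1::real"] conjI)
  fix G\<^sub>0
  let ?X = "subtopology Cinf_topology {F. finsler_metric F \<and> finsler_dist 0 F (riemannian_norm G\<^sub>0) < ennreal 1}"
  \<comment> \<open>The residual set is the whole space: \<open>another_string\<close> yields the
    conclusion for each of its metrics.\<close>
  show "\<exists>R. residual_in ?X R \<and>
      (\<forall>F\<in>R. \<forall>p::nat. \<forall>\<beta>. prime p \<longrightarrow> free_homotopy_class \<beta> \<longrightarrow> nontrivial_class \<beta> \<longrightarrow>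
          (\<forall>s. geodesic_string F s \<and> string_has_class s \<beta> \<and> p dvd string_mult s \<longrightarrow>
            (\<exists>s'. s' \<noteq> s \<and> geodesic_string F s' \<and> string_has_class s' \<beta> \<and> p dvd string_mult s')))"
  proof (intro exI[of _ "topspace ?X"] conjI residual_in_topspace ballI allI impI)
  fix F and p :: nat and \<beta> s
  assume "F \<in> topspace ?X" and p: "prime p" and \<beta>: "free_homotopy_class \<beta>" "nontrivial_class \<beta>"
    and s: "geodesic_string F s \<and> string_has_class s \<beta> \<and> p dvd string_mult s"
  have "finsler_metric F"
    using \<open>F \<in> topspace ?X\<close> unfolding topspace_subtopology by blast
  then interpret finsler F
    by unfold_locales
  show "\<exists>s'. s' \<noteq> s \<and> geodesic_string F s' \<and> string_has_class s' \<beta> \<and> p dvd string_mult s'"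
    using another_string[OF prime_gt_0_nat[OF p] \<beta>] s by blast
  qed
qed simp

end
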